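(* The Sex-Equal Stable Marriage (SESM), Balanced Stable Marriage (BSM), max-Stable Marriage with Ties (max-SMT) and min-Stable Marriage with Ties (min-SMT) problems are all solvable in time $n^{\mathcal{O}(\mathtt{tw})}$, where $\mathtt{tw}$ is the treewidth of the primal graph.
   Context: An instance of Stable Marriage consists of a set of men $M$ and a set of women $W$ (agents $A=M\cup W$, $n=|A|$), where each agent $a$ has a preference list given by a function $\mathsf{p}_a$ from a subset of agents of the opposite sex to positive integers (smaller value = more preferred); acceptability is symmetric. In Stable Marriage (SM) each $\mathsf{p}_a$ is injective; in Stable Marriage with Ties (SMT) it need not be injective. A matching $\mu$ is stable if every matched pair is mutually acceptable and there is no blocking pair, i.e. no mutually acceptable man $m$ and woman $w$ each of whom is either unmatched or strictly prefers the other to their current partner. For a stable matching $\mu$, $\mathsf{sat}_M(\mu)=\sum_{(m,w)\in\mu}\mathsf{p}_m(w)$ and $\mathsf{sat}_W(\mu)=\sum_{(m,w)\in\mu}\mathsf{p}_w(m)$. SESM (on SM instances): find a stable matching minimizing $|\mathsf{sat}_M(\mu)-\mathsf{sat}_W(\mu)|$. BSM (on SM instances): find a stable matching minimizing $\max\{\mathsf{sat}_M(\mu),\mathsf{sat}_W(\mu)\}$. max-SMT / min-SMT (on SMT instances): find a stable matching of maximum / minimum size. The primal graph of an instance is the bipartite graph with one vertex per agent and an edge between $m$ and $w$ whenever they are acceptable to each other. It is assumed that a tree decomposition of width $\mathtt{tw}$ is given.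
   Formalization: For SESM and BSM the preference values are assumed at most n^k, and for all four problems the given tree decomposition has at most n^k nodes (k arbitrary, the constant in O(tw) may depend on k); with unbounded values or decompositions no bound in n and tw alone can hold. *)

theory Defs
  imports Complex_Main "HOL-Library.Landau_Symbols"
begin

section \<open>Stable marriage instances\<close>

text \<open>
  Agents are named by natural numbers.  \<open>pref I a\<close> is the partial function that maps every agent
  acceptable to \<open>a\<close> to its value in the preference list of \<open>a\<close> (smaller is better).
\<close>

record sm_inst =
  men :: "nat set"
  women :: "nat set"
  pref :: "nat \<Rightarrow> nat \<rightharpoonup> nat"

definition agents :: "sm_inst \<Rightarrow> nat set" where
  "agents I = men I \<union> women I"

definition acceptable :: "sm_inst \<Rightarrow> nat \<Rightarrow> nat \<Rightarrow> bool" where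
  "acceptable I a b \<longleftrightarrow> b \<in> dom (pref I a)"

definition smt_instance :: "sm_inst \<Rightarrow> bool" where
  "smt_instance I \<longleftrightarrow>
     finite (men I) \<and> finite (women I) \<and> men I \<inter> women I = {} \<and>
     (\<forall>a b. acceptable I a b \<longrightarrow>
        a \<in> men I \<and> b \<in> women I \<or> a \<in> women I \<and> b \<in> men I) \<and>
     (\<forall>a b. acceptable I a b \<longrightarrow> acceptable I b a) \<and>
     (\<forall>a b p. pref I a b = Some p \<longrightarrow> p > 0)"

definition sm_instance :: "sm_inst \<Rightarrow> bool" where
  "sm_instance I \<longleftrightarrow> smt_instance I \<and> (\<forall>a \<in> agents I. inj_on (pref I a) (dom (pref I a)))"

text \<open>A pair \<open>(m, w)\<close> of a matching consists of a man \<open>m\<close> and a woman \<open>w\<close>.\<close>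

type_synonym matching = "(nat \<times> nat) set"

definition is_matching :: "sm_inst \<Rightarrow> matching \<Rightarrow> bool" where
  "is_matching I \<mu> \<longleftrightarrow> \<mu> \<subseteq> men I \<times> women I \<and>
     (\<forall>(m, w) \<in> \<mu>. \<forall>(m', w') \<in> \<mu>. m = m' \<longleftrightarrow> w = w')"

definition prefers :: "sm_inst \<Rightarrow> nat \<Rightarrow> nat \<Rightarrow> nat \<Rightarrow> bool" where
  "prefers I a b c \<longleftrightarrow> the (pref I a b) < the (pref I a c)"

definition blocking_pair :: "sm_inst \<Rightarrow> matching \<Rightarrow> nat \<Rightarrow> nat \<Rightarrow> bool" where
  "blocking_pair I \<mu> m w \<longleftrightarrow>
     m \<in> men I \<and> w \<in> women I \<and> acceptable I m w \<and> acceptable I w m \<and>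
     (m \<notin> Domain \<mu> \<or> (\<exists>w'. (m, w') \<in> \<mu> \<and> prefers I m w w')) \<and>
     (w \<notin> Range \<mu> \<or> (\<exists>m'. (m', w) \<in> \<mu> \<and> prefers I w m m'))"

definition stable_matching :: "sm_inst \<Rightarrow> matching \<Rightarrow> bool" where
  "stable_matching I \<mu> \<longleftrightarrow> is_matching I \<mu> \<and>
     (\<forall>(m, w) \<in> \<mu>. acceptable I m w \<and> acceptable I w m) \<and>
     \<not> (\<exists>m w. blocking_pair I \<mu> m w)"

definition sat_M :: "sm_inst \<Rightarrow> matching \<Rightarrow> nat" where
  "sat_M I \<mu> = (\<Sum>(m, w) \<in> \<mu>. the (pref I m w))"

definition sat_W :: "sm_inst \<Rightarrow> matching \<Rightarrow> nat" where
  "sat_W I \<mu> = (\<Sum>(m, w) \<in> \<mu>. the (pref I w m))"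


section \<open>The four optimisation problems\<close>

definition sesm_solution :: "sm_inst \<Rightarrow> matching \<Rightarrow> bool" where
  "sesm_solution I = is_arg_min (\<lambda>\<mu>. \<bar>int (sat_M I \<mu>) - int (sat_W I \<mu>)\<bar>) (stable_matching I)"

definition bsm_solution :: "sm_inst \<Rightarrow> matching \<Rightarrow> bool" where
  "bsm_solution I = is_arg_min (\<lambda>\<mu>. max (sat_M I \<mu>) (sat_W I \<mu>)) (stable_matching I)"

definition max_smt_solution :: "sm_inst \<Rightarrow> matching \<Rightarrow> bool" where
  "max_smt_solution I = is_arg_max card (stable_matching I)"

definition min_smt_solution :: "sm_inst \<Rightarrow> matching \<Rightarrow> bool" where
  "min_smt_solution I = is_arg_min card (stable_matching I)"


section \<open>Treewidth\<close>

text \<open>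
  A finite simple undirected graph is a pair of a vertex set and a set of two-element vertex sets.
\<close>

type_synonym ugraph = "nat set \<times> nat set set"

definition simple_graph :: "ugraph \<Rightarrow> bool" where
  "simple_graph = (\<lambda>(V, E). finite V \<and> (\<forall>e \<in> E. e \<subseteq> V \<and> card e = 2))"

definition connected_in :: "nat set set \<Rightarrow> nat set \<Rightarrow> bool" where
  "connected_in E S \<longleftrightarrow>
     (\<forall>u \<in> S. \<forall>v \<in> S. (u, v) \<in> {(x, y). x \<in> S \<and> y \<in> S \<and> {x, y} \<in> E}\<^sup>*)"

definition is_cycle :: "nat set set \<Rightarrow> nat list \<Rightarrow> bool" where
  "is_cycle E xs \<longleftrightarrow> length xs \<ge> 3 \<and> distinct xs \<and>
     (\<forall>i < length xs. {xs ! i, xs ! (Suc i mod length xs)} \<in> E)"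

definition is_tree :: "ugraph \<Rightarrow> bool" where
  "is_tree = (\<lambda>(V, E). simple_graph (V, E) \<and> V \<noteq> {} \<and> connected_in E V \<and>
     \<not> (\<exists>xs. is_cycle E xs))"

definition tree_decomposition :: "ugraph \<Rightarrow> ugraph \<Rightarrow> (nat \<Rightarrow> nat set) \<Rightarrow> bool" where
  "tree_decomposition G T \<beta> \<longleftrightarrow> is_tree T \<and>
     (\<Union>x \<in> fst T. \<beta> x) = fst G \<and>
     (\<forall>e \<in> snd G. \<exists>x \<in> fst T. e \<subseteq> \<beta> x) \<and>
     (\<forall>v \<in> fst G. connected_in (snd T) {x \<in> fst T. v \<in> \<beta> x})"

text \<open>Truncated subtraction: the graph without vertices gets width 0 instead of -1.\<close>

definition td_width :: "ugraph \<Rightarrow> (nat \<Rightarrow> nat set) \<Rightarrow> nat" where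
  "td_width T \<beta> = Max ((\<lambda>x. card (\<beta> x)) ` fst T) - 1"

definition treewidth :: "ugraph \<Rightarrow> nat" where
  "treewidth G = (LEAST w. \<exists>T \<beta>. tree_decomposition G T \<beta> \<and> td_width T \<beta> = w)"

definition primal_graph :: "sm_inst \<Rightarrow> ugraph" where
  "primal_graph I = (agents I, {{m, w} | m w. m \<in> men I \<and> w \<in> women I \<and> acceptable I m w})"


section \<open>Model of computation\<close>

text \<open>
  Programs are lists of mutually recursive first-order function bodies over a heap of natural
  numbers and pairs.  Variables are de Bruijn indices into the current environment; \<open>Call f es\<close>
  evaluates the body of the \<open>f\<close>-th function in the environment consisting of the values of \<open>es\<close>.
  Only numbers can be compared or tested, so no step depends on the size of a structured value;
  arguments and components are passed by reference.

  Every evaluated expression node costs one step.  Arithmetic is restricted to addition,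
  truncated subtraction and comparison, so that numbers get at most one bit longer per step;
  hence (as for a unit-cost random access machine with these operations) step counts are
  polynomially related to the running time of Turing machines.
\<close>

datatype val = Num nat | VPair val val

datatype expr =
    Var nat
  | Const nat
  | Add expr expr
  | Sub expr expr
  | Less expr expr
  | MkPair expr expr
  | Fst expr
  | Snd expr
  | IsPair expr
  | Cond expr expr expr
  | LetIn expr expr
  | Call nat "expr list"

type_synonym prog = "expr list"

text \<open>\<open>eval P \<rho> e v t\<close>: in environment \<open>\<rho>\<close>, expression \<open>e\<close> evaluates to \<open>v\<close> in exactly \<open>t\<close> steps.\<close>

inductive
  eval :: "prog \<Rightarrow> val list \<Rightarrow> expr \<Rightarrow> val \<Rightarrow> nat \<Rightarrow> bool" and
  evals :: "prog \<Rightarrow> val list \<Rightarrow> expr list \<Rightarrow> val list \<Rightarrow> nat \<Rightarrow> bool"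
  for P :: prog
where
  eval_Var: "i < length \<rho> \<Longrightarrow> eval P \<rho> (Var i) (\<rho> ! i) 1"
| eval_Const: "eval P \<rho> (Const n) (Num n) 1"
| eval_Add: "eval P \<rho> e1 (Num m) s \<Longrightarrow> eval P \<rho> e2 (Num n) t \<Longrightarrow>
    eval P \<rho> (Add e1 e2) (Num (m + n)) (s + t + 1)"
| eval_Sub: "eval P \<rho> e1 (Num m) s \<Longrightarrow> eval P \<rho> e2 (Num n) t \<Longrightarrow>
    eval P \<rho> (Sub e1 e2) (Num (m - n)) (s + t + 1)"
| eval_Less: "eval P \<rho> e1 (Num m) s \<Longrightarrow> eval P \<rho> e2 (Num n) t \<Longrightarrow>
    eval P \<rho> (Less e1 e2) (Num (if m < n then 1 else 0)) (s + t + 1)"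
| eval_MkPair: "eval P \<rho> e1 v s \<Longrightarrow> eval P \<rho> e2 w t \<Longrightarrow>
    eval P \<rho> (MkPair e1 e2) (VPair v w) (s + t + 1)"
| eval_Fst: "eval P \<rho> e (VPair v w) t \<Longrightarrow> eval P \<rho> (Fst e) v (t + 1)"
| eval_Snd: "eval P \<rho> e (VPair v w) t \<Longrightarrow> eval P \<rho> (Snd e) w (t + 1)"
| eval_IsPair_Pair: "eval P \<rho> e (VPair v w) t \<Longrightarrow> eval P \<rho> (IsPair e) (Num 1) (t + 1)"
| eval_IsPair_Num: "eval P \<rho> e (Num n) t \<Longrightarrow> eval P \<rho> (IsPair e) (Num 0) (t + 1)"
| eval_Cond_True: "eval P \<rho> e (Num n) s \<Longrightarrow> n \<noteq> 0 \<Longrightarrow> eval P \<rho> e1 v t \<Longrightarrow>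
    eval P \<rho> (Cond e e1 e2) v (s + t + 1)"
| eval_Cond_False: "eval P \<rho> e (Num 0) s \<Longrightarrow> eval P \<rho> e2 v t \<Longrightarrow>
    eval P \<rho> (Cond e e1 e2) v (s + t + 1)"
| eval_LetIn: "eval P \<rho> e1 v s \<Longrightarrow> eval P (v # \<rho>) e2 w t \<Longrightarrow>
    eval P \<rho> (LetIn e1 e2) w (s + t + 1)"
| eval_Call: "evals P \<rho> es vs s \<Longrightarrow> f < length P \<Longrightarrow> eval P vs (P ! f) v t \<Longrightarrow>
    eval P \<rho> (Call f es) v (s + t + 1)"
| evals_Nil: "evals P \<rho> [] [] 0"
| evals_Cons: "eval P \<rho> e v s \<Longrightarrow> evals P \<rho> es vs t \<Longrightarrow>
    evals P \<rho> (e # es) (v # vs) (s + t)"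

text \<open>Evaluation is deterministic, including the number of steps.\<close>

inductive_cases eval_elims:
  "eval P \<rho> (Var i) v t" "eval P \<rho> (Const n) v t" "eval P \<rho> (Add e1 e2) v t"
  "eval P \<rho> (Sub e1 e2) v t" "eval P \<rho> (Less e1 e2) v t" "eval P \<rho> (MkPair e1 e2) v t"
  "eval P \<rho> (Fst e) v t" "eval P \<rho> (Snd e) v t" "eval P \<rho> (IsPair e) v t"
  "eval P \<rho> (Cond e e1 e2) v t" "eval P \<rho> (LetIn e1 e2) v t" "eval P \<rho> (Call f es) v t"
  "evals P \<rho> [] vs t" "evals P \<rho> (e # es) vs t"

lemma eval_deterministic:
  "eval P \<rho> e v t \<Longrightarrow> eval P \<rho> e v' t' \<Longrightarrow> v = v' \<and> t = t'"
  "evals P \<rho> es vs t \<Longrightarrow> evals P \<rho> es vs' t' \<Longrightarrow> vs = vs' \<and> t = t'"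
proof (induction arbitrary: v' t' and vs' t' rule: eval_evals.inducts)
  case eval_Var
  from eval_Var.prems show ?case
    by (rule eval_elims) (auto)
next
  case eval_Const
  from eval_Const.prems show ?case
    by (rule eval_elims) (auto)
next
  case eval_Add
  from eval_Add.prems show ?case
    by (rule eval_elims) (auto dest!: eval_Add.IH(2,4))
next
  case eval_Sub
  from eval_Sub.prems show ?case
    by (rule eval_elims) (auto dest!: eval_Sub.IH(2,4))
next
  case eval_Less
  from eval_Less.prems show ?case
    by (rule eval_elims) (auto dest!: eval_Less.IH(2,4))
next
  case eval_MkPair
  from eval_MkPair.prems show ?case
    by (rule eval_elims) (auto dest!: eval_MkPair.IH(2,4))
next
  case eval_Fst
  from eval_Fst.prems show ?case
    by (rule eval_elims) (auto dest!: eval_Fst.IH(2))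
next
  case eval_Snd
  from eval_Snd.prems show ?case
    by (rule eval_elims) (auto dest!: eval_Snd.IH(2))
next
  case eval_IsPair_Pair
  from eval_IsPair_Pair.prems show ?case
    by (rule eval_elims) (auto dest!: eval_IsPair_Pair.IH(2))
next
  case eval_IsPair_Num
  from eval_IsPair_Num.prems show ?case
    by (rule eval_elims) (auto dest!: eval_IsPair_Num.IH(2))
next
  case eval_Cond_True
  from eval_Cond_True.prems show ?case
    by (rule eval_elims) (auto dest!: eval_Cond_True.IH(2,4) simp: eval_Cond_True.hyps)
next
  case eval_Cond_False
  from eval_Cond_False.prems show ?case
    by (rule eval_elims) (auto dest!: eval_Cond_False.IH(2,4))
next
  case eval_LetIn
  from eval_LetIn.prems show ?case
    by (rule eval_elims) (auto dest!: eval_LetIn.IH(2,4))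
next
  case eval_Call
  from eval_Call.prems show ?case
    by (rule eval_elims) (auto dest!: eval_Call.IH(2,5))
next
  case evals_Nil
  from evals_Nil.prems show ?case
    by (rule eval_elims) (auto)
next
  case evals_Cons
  from evals_Cons.prems show ?case
    by (rule eval_elims) (auto dest!: evals_Cons.IH(2,4))
qed

text \<open>The program's entry point is its first function, called with the input as only argument.\<close>

definition runs_to :: "prog \<Rightarrow> val \<Rightarrow> val \<Rightarrow> nat \<Rightarrow> bool" where
  "runs_to P inp out t \<longleftrightarrow> eval P [inp] (Call 0 [Var 0]) out t"


section \<open>Encoding of inputs and outputs\<close>

fun enc_list :: "val list \<Rightarrow> val" where
  "enc_list [] = Num 0"
| "enc_list (v # vs) = VPair v (enc_list vs)"

definition enc_pair :: "nat \<times> nat \<Rightarrow> val" where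
  "enc_pair = (\<lambda>(a, b). VPair (Num a) (Num b))"

text \<open>
  One side of the market is presented as a list of its agents, each together with the list of its
  acceptable partners and their values; both lists may come in any order.
\<close>

type_synonym side_list = "(nat \<times> (nat \<times> nat) list) list"

definition lists_side :: "sm_inst \<Rightarrow> nat set \<Rightarrow> side_list \<Rightarrow> bool" where
  "lists_side I S L \<longleftrightarrow> distinct (map fst L) \<and> fst ` set L = S \<and>
     (\<forall>(a, ps) \<in> set L. distinct (map fst ps) \<and> map_of ps = pref I a)"

definition enc_side :: "side_list \<Rightarrow> val" where
  "enc_side L = enc_list (map (\<lambda>(a, ps). VPair (Num a) (enc_list (map enc_pair ps))) L)"

text \<open>
  The tree of a tree decomposition is presented with an arbitrary node as root; every node carries
  its name and its bag.
\<close>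

datatype rooted_td = Node (td_name: nat) (td_bag: "nat list") (td_children: "rooted_td list")

primrec td_nodes :: "rooted_td \<Rightarrow> (nat \<times> nat list) list" where
  "td_nodes (Node x b ts) = (x, b) # concat (map td_nodes ts)"

primrec td_edges :: "rooted_td \<Rightarrow> nat set set" where
  "td_edges (Node x b ts) = {{x, td_name t} | t. t \<in> set ts} \<union> \<Union> (set (map td_edges ts))"

definition lists_td :: "ugraph \<Rightarrow> (nat \<Rightarrow> nat set) \<Rightarrow> rooted_td \<Rightarrow> bool" where
  "lists_td T \<beta> r \<longleftrightarrow> distinct (map fst (td_nodes r)) \<and>
     T = (fst ` set (td_nodes r), td_edges r) \<and>
     (\<forall>(x, b) \<in> set (td_nodes r). distinct b \<and> set b = \<beta> x)"

primrec enc_td :: "rooted_td \<Rightarrow> val" where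
  "enc_td (Node x b ts) =
     VPair (Num x) (VPair (enc_list (map Num b)) (enc_list (map enc_td ts)))"

definition encodes_input :: "val \<Rightarrow> sm_inst \<Rightarrow> ugraph \<Rightarrow> (nat \<Rightarrow> nat set) \<Rightarrow> bool" where
  "encodes_input v I T \<beta> \<longleftrightarrow>
     (\<exists>ms ws r. lists_side I (men I) ms \<and> lists_side I (women I) ws \<and> lists_td T \<beta> r \<and>
        v = VPair (enc_side ms) (VPair (enc_side ws) (enc_td r)))"

definition encodes_matching :: "val \<Rightarrow> matching \<Rightarrow> bool" where
  "encodes_matching v \<mu> \<longleftrightarrow>
     (\<exists>xs. distinct xs \<and> set xs = \<mu> \<and> v = enc_list (map enc_pair xs))"


section \<open>Solvability in time $n^{O(tw)}$\<close>

text \<open>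
  The number \<open>n\<close> of agents, counted as 2 for the trivial instances with at most one agent: for
  \<open>n \<le> 1\<close>, a bound \<open>n ^ e\<close> would allow at most one step, whatever the exponent \<open>e\<close>.
\<close>

definition num_agents :: "sm_inst \<Rightarrow> nat" where
  "num_agents I = max 2 (card (agents I))"

definition prefs_at_most :: "nat \<Rightarrow> sm_inst \<Rightarrow> bool" where
  "prefs_at_most b I \<longleftrightarrow> (\<forall>a c p. pref I a c = Some p \<longrightarrow> p \<le> b)"

text \<open>
  \<open>admissible k\<close> is the class of inputs under consideration, which may depend on a degree \<open>k\<close>
  limiting their size.  A single program must solve the problem for all \<open>k\<close>; only the constant
  hidden in \<open>O(tw)\<close> may depend on \<open>k\<close>.

  The given tree decomposition is one of minimum width; reading it takes time linear in its number
  of nodes, so this number has to be polynomial in \<open>n\<close>, of an arbitrary degree \<open>k\<close>.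

  The asymptotics is for the treewidth tending to infinity, so for every fixed treewidth, in
  particular 0, the exponent is just some constant.
\<close>

definition solvable_in_time_n_pow_O_tw ::
    "(nat \<Rightarrow> sm_inst \<Rightarrow> bool) \<Rightarrow> (sm_inst \<Rightarrow> matching \<Rightarrow> bool) \<Rightarrow> bool" where
  "solvable_in_time_n_pow_O_tw admissible solution \<longleftrightarrow>
     (\<exists>P. \<forall>k. \<exists>g :: nat \<Rightarrow> nat. (\<lambda>w. real (g w)) \<in> O(\<lambda>w. real w) \<and>
        (\<forall>I T \<beta> inp.
           admissible k I \<longrightarrow>
           tree_decomposition (primal_graph I) T \<beta> \<longrightarrow>
           td_width T \<beta> = treewidth (primal_graph I) \<longrightarrow>
           card (fst T) \<le> num_agents I ^ k \<longrightarrow>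
           encodes_input inp I T \<beta> \<longrightarrow>
           (\<exists>out \<mu> t. runs_to P inp out t \<and> encodes_matching out \<mu> \<and> solution I \<mu> \<and>
              t \<le> num_agents I ^ g (treewidth (primal_graph I)))))"

text \<open>
  The objectives of SESM and BSM add up preference values, and with values exponential in \<open>n\<close>
  both problems can express the Partition problem even if the treewidth is bounded.  As usual the
  values are therefore taken to be bounded by a polynomial in \<open>n\<close>; positions in a preference
  list, being at most \<open>n\<close>, are the case \<open>k = 1\<close>.  For SMT no such restriction is needed.
\<close>

definition poly_sm_instance :: "nat \<Rightarrow> sm_inst \<Rightarrow> bool" where
  "poly_sm_instance k I \<longleftrightarrow> sm_instance I \<and> prefs_at_most (num_agents I ^ k) I"

end

theory Submission
  imports Defs
begin

text \<open>
  Describe a matching by the function that maps every agent to its partner or to ``unmatched''.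
  Stability then becomes a constraint on the values at the two ends of every edge of the primal graph,
  and all four objectives depend only on a pair of numbers, each of them a sum of
  weights of single agents: the two satisfactions, or the number of (un)matched men.  So dynamic
  programming over the tree decomposition works: the table of a node contains, for every assignment of
  its bag and every pair of weights, at most one assignment of the agents below the node that
  satisfies the constraints.  Every agent has at most \<open>n + 1\<close> values and the weights are polynomial in
  \<open>n\<close>, so tables have size \<open>n\<^sup>O\<^sup>(\<^sup>t\<^sup>w\<^sup>)\<close>, and everything else is polynomial in this size.  A stable
  matching exists by deferred acceptance, so the table of the root is not empty.
\<close>

section \<open>Evaluation with time bounds\<close>

text \<open>One assignment per key suffices by an exchange argument: if two partial assignments have
  prescribed values on their overlap, the weight of their union is determined by their separate
  weights. An agent without a value is compatible with everyone, so constraints survive restriction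
  and can be tested bag by bag; every acceptable pair meets in some bag.

  The machine has no arrays, so every access is a linear search. All costs are therefore measured in
  one number \<open>S\<close> that bounds lists and tables alike, and any polynomial in
  \<open>S\<close> is good enough. The treewidth and the degree \<open>k\<close> occur only in the
  choice of \<open>S\<close>, a power of the number of agents with exponent
  \<open>2 * tw + 2 * k + 6\<close>; the program depends on neither.

  Two costs need separate care. In the recursion over the tree, time must be added over the nodes,
  since a bound multiplied at each level would grow with the depth. And assignments are concatenated
  without removing repeated entries; their length is the total size of the bags below a node, which
  is still polynomial.\<close>

definition ev :: "prog \<Rightarrow> val list \<Rightarrow> expr \<Rightarrow> val \<Rightarrow> nat \<Rightarrow> bool" where
  "ev P \<rho> e v T \<longleftrightarrow> (\<exists>t \<le> T. eval P \<rho> e v t)"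

definition evs :: "prog \<Rightarrow> val list \<Rightarrow> expr list \<Rightarrow> val list \<Rightarrow> nat \<Rightarrow> bool" where
  "evs P \<rho> es vs T \<longleftrightarrow> (\<exists>t \<le> T. evals P \<rho> es vs t)"

definition ev_fun :: "prog \<Rightarrow> nat \<Rightarrow> val list \<Rightarrow> val \<Rightarrow> nat \<Rightarrow> bool" where
  "ev_fun P f vs v T \<longleftrightarrow> f < length P \<and> ev P vs (P ! f) v T"

fun is_pair :: "val \<Rightarrow> bool" where
  "is_pair (VPair _ _) = True"
| "is_pair (Num _) = False"

text \<open>At most one of the two strict comparisons holds, so truncated subtraction of their sum
  from 1 tests equality.\<close>

definition eEq :: "expr \<Rightarrow> expr \<Rightarrow> expr" where
  "eEq a b = Sub (Const 1) (Add (Less a b) (Less b a))"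
definition eAnd :: "expr \<Rightarrow> expr \<Rightarrow> expr" where
  "eAnd a b = Cond a b (Const 0)"
definition eOr :: "expr \<Rightarrow> expr \<Rightarrow> expr" where
  "eOr a b = Cond a (Const 1) b"
definition eNot :: "expr \<Rightarrow> expr" where
  "eNot a = Cond a (Const 0) (Const 1)"

text \<open>Value and time are compared by separate premises. A proof can thus let the evaluation
  rules build both by resolution and leave the comparison with the intended value and bound to the
  simplifier.\<close>

lemma ev_weaken: "ev P \<rho> e v' T' \<Longrightarrow> v' = v \<Longrightarrow> T' \<le> T \<Longrightarrow> ev P \<rho> e v T"
  by (auto simp: ev_def intro: le_trans)

lemma ev_fun_weaken: "ev_fun P f vs v' T' \<Longrightarrow> v' = v \<Longrightarrow> T' \<le> T \<Longrightarrow> ev_fun P f vs v T"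
  by (auto simp: ev_fun_def intro: ev_weaken)

lemma ev_Var: "i < length \<rho> \<Longrightarrow> ev P \<rho> (Var i) (\<rho> ! i) 1"
  unfolding ev_def using eval_Var by blast

lemma ev_Vars:
  "ev P (a # \<rho>) (Var 0) a 1"
  "ev P (a # b # \<rho>) (Var 1) b 1"
  "ev P (a # b # c # \<rho>) (Var 2) c 1"
  "ev P (a # b # c # d # \<rho>) (Var 3) d 1"
  "ev P (a # b # c # d # e # \<rho>) (Var 4) e 1"
  "ev P (a # b # c # d # e # f # \<rho>) (Var 5) f 1"
  "ev P (a # b # c # d # e # f # g # \<rho>) (Var 6) g 1"
  by (rule ev_weaken, rule ev_Var, simp, simp, simp)+

lemma ev_Const: "ev P \<rho> (Const n) (Num n) 1"
  unfolding ev_def using eval_Const by blast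

lemma ev_Add: "ev P \<rho> e1 (Num m) s \<Longrightarrow> ev P \<rho> e2 (Num n) t \<Longrightarrow> ev P \<rho> (Add e1 e2) (Num (m + n)) (s + t + 1)"
  by (unfold ev_def) (metis eval_Add add_le_mono le_refl)

lemma ev_Sub: "ev P \<rho> e1 (Num m) s \<Longrightarrow> ev P \<rho> e2 (Num n) t \<Longrightarrow> ev P \<rho> (Sub e1 e2) (Num (m - n)) (s + t + 1)"
  by (unfold ev_def) (metis eval_Sub add_le_mono le_refl)

lemma ev_Less: "ev P \<rho> e1 (Num m) s \<Longrightarrow> ev P \<rho> e2 (Num n) t \<Longrightarrow> ev P \<rho> (Less e1 e2) (Num (of_bool (m < n))) (s + t + 1)"
  unfolding ev_def of_bool_def by (metis (full_types) eval_Less add_le_mono le_refl)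

lemma ev_MkPair: "ev P \<rho> e1 v s \<Longrightarrow> ev P \<rho> e2 w t \<Longrightarrow> ev P \<rho> (MkPair e1 e2) (VPair v w) (s + t + 1)"
  by (unfold ev_def) (metis eval_MkPair add_le_mono le_refl)

lemma ev_Fst: "ev P \<rho> e (VPair v w) t \<Longrightarrow> ev P \<rho> (Fst e) v (t + 1)"
  by (unfold ev_def) (metis eval_Fst add_le_mono le_refl)

lemma ev_Snd: "ev P \<rho> e (VPair v w) t \<Longrightarrow> ev P \<rho> (Snd e) w (t + 1)"
  by (unfold ev_def) (metis eval_Snd add_le_mono le_refl)

lemma ev_IsPair: "ev P \<rho> e v t \<Longrightarrow> ev P \<rho> (IsPair e) (Num (of_bool (is_pair v))) (t + 1)"
proof -
  assume "ev P \<rho> e v t"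
  then obtain s where s: "s \<le> t" "eval P \<rho> e v s" by (auto simp: ev_def)
  have "eval P \<rho> (IsPair e) (Num (of_bool (is_pair v))) (s + 1)"
    using s by (cases v) (auto intro: eval_IsPair_Pair eval_IsPair_Num simp del: One_nat_def simp: of_bool_def)
  then show ?thesis using s unfolding ev_def by (intro exI[of _ "s + 1"]) simp
qed

text \<open>The branch premises are guarded because the branch not taken may be stuck, for instance
  at \<open>Fst\<close> of a number. Charging both branches makes the bound independent of
  \<open>p\<close>.\<close>

lemma ev_Cond:
  assumes "ev P \<rho> e (Num (of_bool p)) s" "p \<Longrightarrow> ev P \<rho> e1 v t1" "\<not> p \<Longrightarrow> ev P \<rho> e2 w t2"
  shows "ev P \<rho> (Cond e e1 e2) (if p then v else w) (s + t1 + t2 + 1)"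
proof (cases p)
  case True
  with assms obtain s' t' where "eval P \<rho> e (Num 1) s'" "s' \<le> s" "eval P \<rho> e1 v t'" "t' \<le> t1"
    by (auto simp: ev_def)
  then have "eval P \<rho> (Cond e e1 e2) v (s' + t' + 1)"
    by (intro eval_Cond_True) auto
  then show ?thesis using True \<open>s' \<le> s\<close> \<open>t' \<le> t1\<close>
    unfolding ev_def by (intro exI[of _ "s' + t' + 1"]) auto
next
  case False
  with assms obtain s' t' where "eval P \<rho> e (Num 0) s'" "s' \<le> s" "eval P \<rho> e2 w t'" "t' \<le> t2"
    by (auto simp: ev_def)
  then have "eval P \<rho> (Cond e e1 e2) w (s' + t' + 1)"
    by (intro eval_Cond_False) auto
  then show ?thesis using False \<open>s' \<le> s\<close> \<open>t' \<le> t2\<close>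
    unfolding ev_def by (intro exI[of _ "s' + t' + 1"]) auto
qed

lemma ev_LetIn: "ev P \<rho> e1 v s \<Longrightarrow> ev P (v # \<rho>) e2 w t \<Longrightarrow> ev P \<rho> (LetIn e1 e2) w (s + t + 1)"
  by (unfold ev_def) (metis eval_LetIn add_le_mono le_refl)

lemma ev_Call: "evs P \<rho> es vs s \<Longrightarrow> ev_fun P f vs v t \<Longrightarrow> ev P \<rho> (Call f es) v (s + t + 1)"
  unfolding ev_def evs_def ev_fun_def by (metis eval_Call add_le_mono le_refl)

lemma evs_Nil: "evs P \<rho> [] [] 0"
  by (auto simp: evs_def intro: evals_Nil)

lemma evs_Cons: "ev P \<rho> e v s \<Longrightarrow> evs P \<rho> es vs t \<Longrightarrow> evs P \<rho> (e # es) (v # vs) (s + t)"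
  by (unfold ev_def evs_def) (metis evals_Cons add_le_mono)

lemma ev_eEq:
  assumes "ev P \<rho> a (Num m) s" "ev P \<rho> b (Num n) t"
  shows "ev P \<rho> (eEq a b) (Num (of_bool (m = n))) (2 * s + 2 * t + 5)"
  unfolding eEq_def
  by (rule ev_weaken, (rule ev_Sub ev_Add ev_Const ev_Less assms)+) auto

lemma ev_eAnd:
  assumes "ev P \<rho> a (Num (of_bool p)) s" "ev P \<rho> b (Num (of_bool q)) t"
  shows "ev P \<rho> (eAnd a b) (Num (of_bool (p \<and> q))) (s + t + 2)"
  unfolding eAnd_def
  by (rule ev_weaken, (rule ev_Cond ev_Const assms)+) auto

lemma ev_eOr:
  assumes "ev P \<rho> a (Num (of_bool p)) s" "ev P \<rho> b (Num (of_bool q)) t"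
  shows "ev P \<rho> (eOr a b) (Num (of_bool (p \<or> q))) (s + t + 2)"
  unfolding eOr_def
  by (rule ev_weaken, (rule ev_Cond ev_Const assms)+) auto

lemma ev_eNot:
  assumes "ev P \<rho> a (Num (of_bool p)) s"
  shows "ev P \<rho> (eNot a) (Num (of_bool (\<not> p))) (s + 3)"
  unfolding eNot_def
  by (rule ev_weaken, (rule ev_Cond ev_Const assms)+) auto

lemmas ev_rules = ev_Vars ev_Const ev_Add ev_Sub ev_Less ev_MkPair ev_Fst ev_Snd ev_IsPair ev_Cond
  ev_LetIn ev_Call evs_Nil evs_Cons ev_eEq ev_eAnd ev_eOr ev_eNot

text \<open>The machine's form of \<open>foldr\<close>: recursion on the list in
  \<open>Var 0\<close>, with \<open>k\<close> further arguments passed on unchanged, and the result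
  for the tail bound before \<open>step\<close> is evaluated.\<close>

definition Loop :: "nat \<Rightarrow> nat \<Rightarrow> expr \<Rightarrow> expr \<Rightarrow> expr" where
  "Loop f k step base = Cond (IsPair (Var 0))
     (LetIn (Call f (Snd (Var 0) # map Var [1..<Suc k])) step) base"

lemma evs_params: "evs P (v # ps) (map Var [1..<Suc (length ps)]) ps (length ps)"
proof -
  have "i \<le> length ps \<Longrightarrow> evs P (v # ps) (map Var [Suc i..<Suc (length ps)]) (drop i ps) (length ps - i)" for i
  proof (induction "length ps - i" arbitrary: i)
    case 0
    then show ?case by (auto intro: evs_Nil)
  next
    case (Suc n)
    then have i: "i < length ps" by auto
    have "evs P (v # ps) (Var (Suc i) # map Var [Suc (Suc i)..<Suc (length ps)]) (((v # ps) ! Suc i) # drop (Suc i) ps) (1 + (length ps - Suc i))"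
      by (rule evs_Cons, rule ev_Var, use i Suc in auto)
    moreover have "1 + (length ps - Suc i) = length ps - i" using i by simp
    ultimately show ?case using i by (simp add: upt_conv_Cons Cons_nth_drop_Suc del: upt_Suc)
  qed
  from this[of 0] show ?thesis by simp
qed

text \<open>Here \<open>d\<close> encodes list elements and \<open>e\<close> accumulators. The step
  is required only at splits of the actual list, where the accumulator is a fold over a suffix; this
  makes invariants of suffixes, such as bounds on table sizes, available inside the step. The
  overhead \<open>k + 8\<close> covers the test, the recursive call with its \<open>k + 1\<close>
  arguments and the binding.\<close>

lemma ev_fun_Loop:
  assumes f: "f < length P" "P ! f = Loop f k step base" "length ps = k"
    and base: "ev P (Num 0 # ps) base (e z) s0"
    and step: "\<And>ys x zs. xs = zs @ x # ys \<Longrightarrow>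
      ev P (e (foldr F ys z) # VPair (d x) (enc_list (map d ys)) # ps) step (e (F x (foldr F ys z))) (s x)"
  shows "ev_fun P f (enc_list (map d xs) # ps) (e (foldr F xs z))
    (s0 + (k + 8) + (\<Sum>x\<leftarrow>xs. s x + (k + 8)))"
  using step
proof (induction xs)
  case Nil
  have "ev P (Num 0 # ps) (P ! f) (e z) (s0 + (k + 8))"
    unfolding f Loop_def
    \<comment> \<open>The true branch is vacuous on the empty list, so nothing else would determine
      its time bound.\<close>
    by (rule ev_weaken, rule ev_Cond[where ?t1.0 = 0], rule ev_IsPair, rule ev_Vars, simp, rule base) auto
  with f show ?case by (simp add: ev_fun_def)
next
  case (Cons x xs)
  let ?R = "s0 + (k + 8) + (\<Sum>x\<leftarrow>xs. s x + (k + 8))"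
  have IH: "ev_fun P f (enc_list (map d xs) # ps) (e (foldr F xs z)) ?R"
  proof (rule Cons.IH)
    fix ys y zs assume "xs = zs @ y # ys"
    then show "ev P (e (foldr F ys z) # VPair (d y) (enc_list (map d ys)) # ps) step (e (F y (foldr F ys z))) (s y)"
      using Cons.prems[of "x # zs" y ys] by simp
  qed
  have st: "ev P (e (foldr F xs z) # VPair (d x) (enc_list (map d xs)) # ps) step (e (F x (foldr F xs z))) (s x)"
    using Cons.prems[of "[]" x xs] by simp
  have c: "ev P (VPair (d x) (enc_list (map d xs)) # ps) (Call f (Snd (Var 0) # map Var [1..<Suc k])) (e (foldr F xs z)) (2 + k + ?R + 1)"
    by (rule ev_weaken, rule ev_Call, rule evs_Cons, rule ev_Snd, rule ev_Vars,
        rule evs_params[of P _ ps, unfolded f], rule IH) (auto simp: f)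
  have "ev P (VPair (d x) (enc_list (map d xs)) # ps) (P ! f) (e (F x (foldr F xs z))) (2 + (2 + k + ?R + 1 + s x + 1) + 0 + 1)"
    unfolding f Loop_def
    by (rule ev_weaken, rule ev_Cond, rule ev_IsPair, rule ev_Vars, rule ev_LetIn, rule c, rule st) auto
  with f show ?case by (auto simp: ev_fun_def elim!: ev_weaken)
qed

lemma ev_fun_Loop_uniform:
  assumes f: "f < length P" "P ! f = Loop f k step base" "length ps = k"
    and base: "ev P (Num 0 # ps) base (e z) s"
    and step: "\<And>ys x zs. xs = zs @ x # ys \<Longrightarrow>
      ev P (e (foldr F ys z) # VPair (d x) (enc_list (map d ys)) # ps) step (e (F x (foldr F ys z))) s"
    and len: "length xs \<le> S"
  shows "ev_fun P f (enc_list (map d xs) # ps) (e (foldr F xs z)) ((S + 1) * (s + (k + 8)))"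
proof (rule ev_fun_weaken[OF ev_fun_Loop[where s = "\<lambda>_. s", OF f base step]])
  have "length xs * (s + (k + 8)) \<le> S * (s + (k + 8))" using len by (rule mult_right_mono) simp
  then show "s + (k + 8) + (\<Sum>x\<leftarrow>xs. s + (k + 8)) \<le> (S + 1) * (s + (k + 8))"
    by (simp add: sum_list_triv algebra_simps)
qed auto

section \<open>Existence of stable matchings\<close>

lemma exists_maximal_state:
  fixes h :: "'a \<Rightarrow> nat"
  assumes "Q x0" "\<And>x. Q x \<Longrightarrow> h x \<le> B"
  shows "\<exists>x. Q x \<and> (\<forall>y. Q y \<longrightarrow> h y \<le> h x)"
  using assms by (intro ex_has_greatest_nat[of Q x0 h "Suc B"]) (auto simp: less_Suc_eq_le)

text \<open>The states of deferred acceptance with men proposing, where \<open>R\<close> holds the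
  rejected proposals. Ties are decided in favour of the partner a woman already has.\<close>

definition deferred_state :: "sm_inst \<Rightarrow> matching \<Rightarrow> matching \<Rightarrow> bool" where
  "deferred_state I \<mu> R \<longleftrightarrow>
     is_matching I \<mu> \<and> (\<forall>(m, w) \<in> \<mu>. acceptable I m w \<and> acceptable I w m) \<and>
     R \<subseteq> men I \<times> women I \<and> \<mu> \<inter> R = {} \<and>
     (\<forall>(m, w) \<in> R. \<exists>m'. (m', w) \<in> \<mu> \<and> \<not> prefers I w m m') \<and>
     (\<forall>(m, w) \<in> \<mu>. \<forall>w'. acceptable I m w' \<longrightarrow> prefers I m w' w \<longrightarrow> (m, w') \<in> R)"

text \<open>Instead of running the algorithm, take a state with \<open>card \<mu> + card R\<close>
  maximal. If an unmatched man had an acceptable woman outside \<open>R\<close>, his proposal to the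
  best of them would increase this sum: a free woman enlarges \<open>\<mu>\<close>, a swap keeps the
  size of \<open>\<mu>\<close> and adds the displaced man to \<open>R\<close>, and a refusal
  enlarges \<open>R\<close>. So every blocking pair would lie in \<open>R\<close>, which contradicts
  the invariant on the woman's partner.\<close>

lemma stable_matching_exists:
  assumes I: "smt_instance I"
  shows "\<exists>\<mu>. stable_matching I \<mu>"
proof -
  have fin: "finite (men I \<times> women I)" using I by (auto simp: smt_instance_def)
  let ?Q = "\<lambda>(\<mu>, R). deferred_state I \<mu> R"
  let ?h = "\<lambda>(\<mu> :: matching, R :: matching). card \<mu> + card R"
  have "?Q ({}, {})" by (auto simp: deferred_state_def is_matching_def)
  moreover have "?h x \<le> 2 * card (men I \<times> women I)" if "?Q x" for x
    using that card_mono[OF fin, of "fst x"] card_mono[OF fin, of "snd x"]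
    by (cases x) (auto simp: deferred_state_def is_matching_def)
  ultimately obtain s where "?Q s" "\<And>s'. ?Q s' \<Longrightarrow> ?h s' \<le> ?h s"
    using exists_maximal_state[of ?Q "({}, {})" ?h "2 * card (men I \<times> women I)"] by meson
  then obtain \<mu> R where st: "deferred_state I \<mu> R"
    and mx: "\<And>\<mu>' R'. deferred_state I \<mu>' R' \<Longrightarrow> card \<mu>' + card R' \<le> card \<mu> + card R"
    by (cases s) force
  have mat: "\<mu> \<subseteq> men I \<times> women I"
    and inj: "\<And>m w m' w'. (m, w) \<in> \<mu> \<Longrightarrow> (m', w') \<in> \<mu> \<Longrightarrow> m = m' \<longleftrightarrow> w = w'"
    and acc: "\<And>m w. (m, w) \<in> \<mu> \<Longrightarrow> acceptable I m w \<and> acceptable I w m"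
    and R: "R \<subseteq> men I \<times> women I" and disj: "\<mu> \<inter> R = {}"
    and rej: "\<And>m w. (m, w) \<in> R \<Longrightarrow> \<exists>m'. (m', w) \<in> \<mu> \<and> \<not> prefers I w m m'"
    and best: "\<And>m w w'. (m, w) \<in> \<mu> \<Longrightarrow> acceptable I m w' \<Longrightarrow> prefers I m w' w \<Longrightarrow> (m, w') \<in> R"
    using st unfolding deferred_state_def is_matching_def by fast+
  have fin2: "finite \<mu>" "finite R" using mat R fin finite_subset by blast+
  have all_rejected: "(m, w) \<in> R" if m: "m \<in> men I" "m \<notin> Domain \<mu>" and w: "acceptable I m w" for m w
  proof (rule ccontr)
    assume nR: "(m, w) \<notin> R"
    let ?C = "\<lambda>w. acceptable I m w \<and> (m, w) \<notin> R"
    obtain v where v: "?C v" and vmin: "\<And>y. ?C y \<Longrightarrow> the (pref I m v) \<le> the (pref I m y)"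
      using ex_has_least_nat[of ?C w "\<lambda>w. the (pref I m w)"] w nR by blast
    have vI: "v \<in> women I" "acceptable I v m" using I v m by (auto simp: smt_instance_def)
    have vbest: "(m, w') \<in> R" if "acceptable I m w'" "prefers I m w' v" for w'
      using vmin[of w'] that by (force simp: prefers_def)
    show False
    proof (cases "v \<in> Range \<mu>")
      case False
      have "deferred_state I (insert (m, v) \<mu>) R"
        unfolding deferred_state_def is_matching_def
      proof (intro conjI)
        show "\<forall>(a, b) \<in> insert (m, v) \<mu>. \<forall>(a', b') \<in> insert (m, v) \<mu>. (a = a') = (b = b')"
          using inj m False by (auto simp: Domain_iff Range_iff)
        show "\<forall>(a, b)\<in>R. \<exists>m'. (m', b) \<in> insert (m, v) \<mu> \<and> \<not> prefers I b a m'"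
          using rej by blast
        show "\<forall>(m, w)\<in>insert (m, v) \<mu>. \<forall>w'. acceptable I m w' \<longrightarrow> prefers I m w' w \<longrightarrow> (m, w') \<in> R"
          using best vbest by blast
      qed (use mat R disj acc v vI m in auto)
      from mx[OF this] show False using m fin2 by (auto simp: Domain_iff card_insert_if)
    next
      case True
      then obtain m' where m': "(m', v) \<in> \<mu>" by auto
      have mm: "m \<noteq> m'" using m m' by auto
      show False
      proof (cases "prefers I v m m'")
        case True
        let ?\<mu> = "insert (m, v) (\<mu> - {(m', v)})"
        have "deferred_state I ?\<mu> (insert (m', v) R)"
          unfolding deferred_state_def is_matching_def
        proof (intro conjI)
          show "\<forall>(a, b) \<in> ?\<mu>. \<forall>(a', b') \<in> ?\<mu>. (a = a') = (b = b')"
            using inj m m' by (auto simp: Domain_iff Range_iff)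
          show "\<forall>(m, w)\<in>insert (m', v) R. \<exists>m''. (m'', w) \<in> ?\<mu> \<and> \<not> prefers I w m m''"
          proof (clarify)
            fix a b assume "(a, b) \<in> insert (m', v) R"
            then consider "a = m'" "b = v" | "(a, b) \<in> R" by blast
            then show "\<exists>m''. (m'', b) \<in> ?\<mu> \<and> \<not> prefers I b a m''"
            proof cases
              case 1 then show ?thesis using True by (auto simp: prefers_def)
            next
              case 2
              then obtain a' where a': "(a', b) \<in> \<mu>" "\<not> prefers I b a a'" using rej by blast
              show ?thesis
              proof (cases "b = v")
                case True
                then have "a' = m'" using a' m' inj by blast
                then show ?thesis using a' True \<open>prefers I v m m'\<close> by (auto simp: prefers_def)
              next
                case False
                then show ?thesis using a' by auto
              qed
            qed
          qed
          show "\<forall>(m, w)\<in>?\<mu>. \<forall>w'. acceptable I m w' \<longrightarrow> prefers I m w' w \<longrightarrow> (m, w') \<in> insert (m', v) R"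
            using best vbest by blast
          show "?\<mu> \<inter> insert (m', v) R = {}" using disj mm v by auto
        qed (use mat R acc v vI m m' in auto)
        from mx[OF this] have "card ?\<mu> + card (insert (m', v) R) \<le> card \<mu> + card R" .
        moreover have "card ?\<mu> = card \<mu>"
          using m m' fin2 card_Suc_Diff1[of \<mu> "(m', v)"] by (subst card_insert_disjoint) (auto simp del: card_Diff_insert)
        moreover have "card (insert (m', v) R) = Suc (card R)"
          using m' disj fin2 by (subst card_insert_disjoint) auto
        ultimately show False by simp
      next
        case False
        have "deferred_state I \<mu> (insert (m, v) R)"
          unfolding deferred_state_def is_matching_def
        proof (intro conjI)
          show "\<forall>(a, b) \<in> \<mu>. \<forall>(a', b') \<in> \<mu>. (a = a') = (b = b')"
            using inj by blast
          show "\<forall>(m, w)\<in>insert (m, v) R. \<exists>m'. (m', w) \<in> \<mu> \<and> \<not> prefers I w m m'"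
            using rej m' False by blast
          show "\<forall>(a, b)\<in>\<mu>. \<forall>w'. acceptable I a w' \<longrightarrow> prefers I a w' b \<longrightarrow> (a, w') \<in> insert (m, v) R"
            using best by blast
          show "\<mu> \<inter> insert (m, v) R = {}" using disj m by auto
        qed (use mat R acc v vI m in auto)
        from mx[OF this] show False using v fin2 by (auto simp: card_insert_if)
      qed
    qed
  qed
  have "\<not> blocking_pair I \<mu> m w" for m w
  proof
    assume b: "blocking_pair I \<mu> m w"
    then have "(m, w) \<in> R" using all_rejected best by (auto simp: blocking_pair_def)
    then obtain m' where m': "(m', w) \<in> \<mu>" "\<not> prefers I w m m'" using rej by blast
    then obtain m'' where "(m'', w) \<in> \<mu>" "prefers I w m m''" using b by (auto simp: blocking_pair_def)
    then show False using m' inj by blast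
  qed
  then have "stable_matching I \<mu>" using mat inj acc unfolding stable_matching_def is_matching_def by blast
  then show ?thesis ..
qed

section \<open>Stable matchings as solutions of a binary constraint problem\<close>

text \<open>
  An assignment maps an agent to 0 if the agent has not been treated yet, to 1 if the agent is
  unmatched and to \<open>p + 2\<close> if the agent is matched to \<open>p\<close>.  The value 0 of \<open>rank_of\<close> means not
  acceptable; this is unambiguous as preference values are positive.
\<close>

definition rank_of :: "sm_inst \<Rightarrow> nat \<Rightarrow> nat \<Rightarrow> nat" where
  "rank_of I u v = (case pref I u v of None \<Rightarrow> 0 | Some q \<Rightarrow> q)"

definition wishes :: "sm_inst \<Rightarrow> nat \<Rightarrow> nat \<Rightarrow> nat \<Rightarrow> bool" where
  "wishes I u c v \<longleftrightarrow> c < 2 \<or> rank_of I u v < rank_of I u (c - 2)"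

text \<open>Being trivial for untreated agents, the constraint passes to restrictions of an
  assignment; being trivial for unacceptable pairs, it may be imposed on all pairs of a bag and not
  just on edges. The remaining two conditions say that partnership is mutual and that the pair does
  not block.\<close>

definition compatible :: "sm_inst \<Rightarrow> nat \<Rightarrow> nat \<Rightarrow> nat \<Rightarrow> nat \<Rightarrow> bool" where
  "compatible I u c v d \<longleftrightarrow> c = 0 \<or> d = 0 \<or> rank_of I u v = 0 \<or>
     (c \<noteq> v + 2 \<or> d = u + 2) \<and> \<not> (wishes I u c v \<and> wishes I v d u)"

definition choices :: "sm_inst \<Rightarrow> nat \<Rightarrow> nat set" where
  "choices I v = insert 1 ((\<lambda>p. p + 2) ` dom (pref I v))"

definition valid :: "sm_inst \<Rightarrow> nat set \<Rightarrow> (nat \<times> nat) set \<Rightarrow> (nat \<Rightarrow> nat) \<Rightarrow> bool" where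
  "valid I X E f \<longleftrightarrow> (\<forall>v \<in> X. f v \<in> choices I v) \<and> (\<forall>v. v \<notin> X \<longrightarrow> f v = 0) \<and>
     (\<forall>(u, v) \<in> E. compatible I u (f u) v (f v))"

definition matching_of :: "sm_inst \<Rightarrow> (nat \<Rightarrow> nat) \<Rightarrow> matching" where
  "matching_of I f = {(m, w). m \<in> men I \<and> f m = w + 2}"

definition assignment_of :: "sm_inst \<Rightarrow> matching \<Rightarrow> nat \<Rightarrow> nat" where
  "assignment_of I \<mu> v = (if v \<notin> agents I then 0
     else if v \<in> Domain \<mu> then (THE w. (v, w) \<in> \<mu>) + 2
     else if v \<in> Range \<mu> then (THE m. (m, v) \<in> \<mu>) + 2 else 1)"

lemma choices_pos: "c \<in> choices I v \<Longrightarrow> 0 < c"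
  by (auto simp: choices_def)

text \<open>\<open>E\<close> may be larger than the set of acceptable pairs: it will be the set of
  all pairs that share a bag.\<close>

locale full_constraints =
  fixes I E
  assumes I: "smt_instance I"
    and E: "\<And>u v. acceptable I u v \<Longrightarrow> (u, v) \<in> E"
begin

lemma rank_pos: "rank_of I u v \<noteq> 0 \<longleftrightarrow> acceptable I u v"
  using I unfolding smt_instance_def rank_of_def acceptable_def
  by (auto split: option.splits)

lemma rank_the: "acceptable I u v \<Longrightarrow> rank_of I u v = the (pref I u v)"
  by (auto simp: rank_of_def acceptable_def)

lemma acceptable_sym: "acceptable I u v \<Longrightarrow> acceptable I v u"
  using I by (auto simp: smt_instance_def)

lemma acceptable_men: "acceptable I u v \<Longrightarrow> u \<in> men I \<Longrightarrow> v \<in> women I"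
  using I by (auto simp: smt_instance_def)

lemma acceptable_women: "acceptable I u v \<Longrightarrow> u \<in> women I \<Longrightarrow> v \<in> men I"
  using I by (auto simp: smt_instance_def)

lemma acceptable_agents: "acceptable I u v \<Longrightarrow> u \<in> agents I \<and> v \<in> agents I"
  using I by (auto simp: smt_instance_def agents_def)

lemma partner_sym:
  assumes f: "valid I (agents I) E f" and u: "u \<in> agents I" "f u = v + 2"
  shows "acceptable I u v" "f v = u + 2"
proof -
  show a: "acceptable I u v" using f u by (auto simp: valid_def choices_def acceptable_def)
  have "v \<in> agents I" using acceptable_agents[OF a] by simp
  then have "f v \<noteq> 0" using f choices_pos by (fastforce simp: valid_def)
  then show "f v = u + 2" using f E[OF a] u rank_pos[of u v] a
    by (fastforce simp: valid_def compatible_def)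
qed

text \<open>\<open>matching_of\<close> reads only the values of the men. Mutuality of partners makes
  the values of the women describe the same matching, so both sides can be treated alike
  afterwards.\<close>

lemma matching_of_women:
  assumes f: "valid I (agents I) E f"
  shows "(m, w) \<in> matching_of I f \<longleftrightarrow> w \<in> women I \<and> f w = m + 2"
  using partner_sym[OF f, of m w] partner_sym[OF f, of w m] acceptable_men[of m w] acceptable_women[of w m]
  by (auto simp: matching_of_def agents_def)

lemma stable_matching_of:
  assumes f: "valid I (agents I) E f"
  shows "stable_matching I (matching_of I f)"
proof -
  note W = matching_of_women[OF f]
  have M: "(m, w) \<in> matching_of I f \<longleftrightarrow> m \<in> men I \<and> f m = w + 2" for m w
    by (auto simp: matching_of_def)
  have acc: "acceptable I m w \<and> acceptable I w m" if "(m, w) \<in> matching_of I f" for m w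
    using partner_sym(1)[OF f, of m w] that acceptable_sym by (auto simp: M agents_def)
  have pos: "v \<in> agents I \<Longrightarrow> f v \<noteq> 0" for v
    using f choices_pos by (fastforce simp: valid_def)
  have "\<not> blocking_pair I (matching_of I f) m w" for m w
  proof
    assume b: "blocking_pair I (matching_of I f) m w"
    then have mw: "m \<in> men I" "w \<in> women I" and a: "acceptable I m w" "acceptable I w m"
      by (auto simp: blocking_pair_def)
    have "wishes I m (f m) w"
    proof (cases "f m < 2")
      case False
      then have "f m = (f m - 2) + 2" by simp
      then have "(m, f m - 2) \<in> matching_of I f" using mw M by blast
      then have "prefers I m w (f m - 2) \<and> acceptable I m (f m - 2)" using b M acc
        by (fastforce simp: blocking_pair_def)
      then show ?thesis using a by (auto simp: wishes_def prefers_def rank_the)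
    qed (simp add: wishes_def)
    moreover have "wishes I w (f w) m"
    proof (cases "f w < 2")
      case False
      then have "f w = (f w - 2) + 2" by simp
      then have "(f w - 2, w) \<in> matching_of I f" using mw W by blast
      then have "prefers I w m (f w - 2) \<and> acceptable I w (f w - 2)" using b W acc
        by (fastforce simp: blocking_pair_def)
      then show ?thesis using a by (auto simp: wishes_def prefers_def rank_the)
    qed (simp add: wishes_def)
    moreover have "compatible I m (f m) w (f w)" using f E[OF a(1)] by (auto simp: valid_def)
    moreover have "f m \<noteq> 0" "f w \<noteq> 0" using pos mw by (auto simp: agents_def)
    ultimately show False using rank_pos[of m w] a by (auto simp: compatible_def)
  qed
  moreover have "is_matching I (matching_of I f)"
    unfolding is_matching_def using M W by fastforce
  ultimately show ?thesis using acc by (auto simp: stable_matching_def)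
qed

lemma assignment_of_men:
  assumes \<mu>: "is_matching I \<mu>" and "(m, w) \<in> \<mu>"
  shows "assignment_of I \<mu> m = w + 2"
proof -
  have "(THE w. (m, w) \<in> \<mu>) = w" using assms by (fastforce simp: is_matching_def)
  then show ?thesis using assms by (auto simp: assignment_of_def is_matching_def agents_def)
qed

lemma assignment_of_women:
  assumes \<mu>: "is_matching I \<mu>" and "(m, w) \<in> \<mu>"
  shows "assignment_of I \<mu> w = m + 2"
proof -
  have "(THE m. (m, w) \<in> \<mu>) = m" using assms by (fastforce simp: is_matching_def)
  moreover have "w \<notin> Domain \<mu>" "w \<in> women I" using assms I by (auto simp: is_matching_def smt_instance_def)
  ultimately show ?thesis using assms by (auto simp: assignment_of_def is_matching_def agents_def)
qed

lemma assignment_of_unmatched: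
  "v \<in> agents I \<Longrightarrow> v \<notin> Domain \<mu> \<Longrightarrow> v \<notin> Range \<mu> \<Longrightarrow> assignment_of I \<mu> v = 1"
  by (simp add: assignment_of_def)

lemma matching_of_assignment_of:
  assumes \<mu>: "is_matching I \<mu>"
  shows "matching_of I (assignment_of I \<mu>) = \<mu>"
proof -
  have "(m, w) \<in> \<mu>" if "m \<in> men I" "assignment_of I \<mu> m = w + 2" for m w
  proof (cases "m \<in> Domain \<mu>")
    case True
    then show ?thesis using that assignment_of_men[OF \<mu>] by fastforce
  next
    case False
    moreover have "m \<notin> Range \<mu>" using that \<mu> I by (auto simp: is_matching_def smt_instance_def)
    ultimately show ?thesis using that by (simp add: assignment_of_def split: if_splits)
  qed
  then show ?thesis using assignment_of_men[OF \<mu>] \<mu> by (auto simp: matching_of_def is_matching_def)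
qed

text \<open>Every pair of agents is compatible here, unacceptable ones by definition, so any set
  \<open>E'\<close> of pairs of agents is allowed.\<close>

lemma valid_assignment_of:
  assumes st: "stable_matching I \<mu>" and E': "E' \<subseteq> agents I \<times> agents I"
  shows "valid I (agents I) E' (assignment_of I \<mu>)"
proof -
  let ?f = "assignment_of I \<mu>"
  have \<mu>: "is_matching I \<mu>" and acc: "\<And>m w. (m, w) \<in> \<mu> \<Longrightarrow> acceptable I m w \<and> acceptable I w m"
    using st by (auto simp: stable_matching_def)
  have cases: "?f v = 1 \<and> v \<notin> Domain \<mu> \<and> v \<notin> Range \<mu> \<or>
      (\<exists>w. (v, w) \<in> \<mu> \<and> ?f v = w + 2) \<or> (\<exists>m. (m, v) \<in> \<mu> \<and> ?f v = m + 2)" if "v \<in> agents I" for v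
  proof -
    consider w where "(v, w) \<in> \<mu>" | m where "(m, v) \<in> \<mu>" | "v \<notin> Domain \<mu>" "v \<notin> Range \<mu>" by blast
    then show ?thesis
    proof cases
      case 1
      then show ?thesis using assignment_of_men[OF \<mu> 1] by blast
    next
      case 2
      then show ?thesis using assignment_of_women[OF \<mu> 2] by blast
    next
      case 3
      then show ?thesis using assignment_of_unmatched[OF that 3] by blast
    qed
  qed
  have ch: "?f v \<in> choices I v" if "v \<in> agents I" for v
    using cases[OF that] acc by (auto simp: choices_def acceptable_def)
  have wish_man: "m \<notin> Domain \<mu> \<or> (\<exists>w'. (m, w') \<in> \<mu> \<and> prefers I m w w')"
    if "wishes I m (?f m) w" "m \<in> men I" "acceptable I m w" for m w
  proof -
    have "m \<notin> Range \<mu>" using that \<mu> I by (auto simp: is_matching_def smt_instance_def)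
    then show ?thesis using that cases[of m] acc by (auto simp: agents_def wishes_def prefers_def rank_the)
  qed
  have wish_woman: "w \<notin> Range \<mu> \<or> (\<exists>m'. (m', w) \<in> \<mu> \<and> prefers I w m m')"
    if "wishes I w (?f w) m" "w \<in> women I" "acceptable I w m" for m w
  proof -
    have "w \<notin> Domain \<mu>" using that \<mu> I by (auto simp: is_matching_def smt_instance_def)
    then show ?thesis using that cases[of w] acc by (auto simp: agents_def wishes_def prefers_def rank_the)
  qed
  have not_both: "\<not> (wishes I m (?f m) w \<and> wishes I w (?f w) m)"
    if "m \<in> men I" "w \<in> women I" "acceptable I m w" for m w
  proof
    assume "wishes I m (?f m) w \<and> wishes I w (?f w) m"
    then have "blocking_pair I \<mu> m w"
      unfolding blocking_pair_def
      using that acceptable_sym[OF that(3)] wish_man[of m w] wish_woman[of w m] by blast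
    then show False using st by (auto simp: stable_matching_def)
  qed
  have "compatible I u (?f u) v (?f v)" if uv: "u \<in> agents I" "v \<in> agents I" for u v
  proof (cases "acceptable I u v")
    case True
    have "?f v = u + 2" if "?f u = v + 2"
      using cases[OF uv(1)] that assignment_of_men[OF \<mu>] assignment_of_women[OF \<mu>] by auto
    moreover have "\<not> (wishes I u (?f u) v \<and> wishes I v (?f v) u)"
      using uv not_both[of u v] not_both[of v u] True acceptable_sym[OF True] acceptable_men[OF True] acceptable_women[OF True]
      by (auto simp: agents_def)
    ultimately show ?thesis by (auto simp: compatible_def)
  next
    case False
    then show ?thesis using rank_pos[of u v] by (auto simp: compatible_def)
  qed
  moreover have "?f v = 0" if "v \<notin> agents I" for v using that by (simp add: assignment_of_def)
  ultimately show ?thesis using ch E' unfolding valid_def by blast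
qed

lemma sum_matching_men:
  assumes f: "valid I (agents I) E f"
  shows "(\<Sum>(m, w) \<in> matching_of I f. h m w) = (\<Sum>m \<in> men I. if f m < 2 then 0 else h m (f m - 2) :: nat)"
proof -
  have fin: "finite (men I)" using I by (auto simp: smt_instance_def)
  have "(\<Sum>m \<in> men I. if f m < 2 then 0 else h m (f m - 2)) = (\<Sum>m | m \<in> men I \<and> \<not> f m < 2. h m (f m - 2))"
    using fin by (subst sum.inter_filter) (auto intro: sum.cong)
  also have "\<dots> = (\<Sum>(m, w) \<in> matching_of I f. h m w)"
    by (rule sum.reindex_bij_witness[of _ fst "\<lambda>m. (m, f m - 2)"]) (auto simp: matching_of_def)
  finally show ?thesis by simp
qed

lemma sum_matching_women:
  assumes f: "valid I (agents I) E f"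
  shows "(\<Sum>(m, w) \<in> matching_of I f. h w m) = (\<Sum>w \<in> women I. if f w < 2 then 0 else h w (f w - 2) :: nat)"
proof -
  have fin: "finite (women I)" using I by (auto simp: smt_instance_def)
  have "(\<Sum>w \<in> women I. if f w < 2 then 0 else h w (f w - 2)) = (\<Sum>w | w \<in> women I \<and> \<not> f w < 2. h w (f w - 2))"
    using fin by (subst sum.inter_filter) (auto intro: sum.cong)
  also have "\<dots> = (\<Sum>(m, w) \<in> matching_of I f. h w m)"
    by (rule sum.reindex_bij_witness[of _ snd "\<lambda>w. (f w - 2, w)"]) (use matching_of_women[OF f] in auto)
  finally show ?thesis by simp
qed

lemma sat_M_eq:
  assumes f: "valid I (agents I) E f"
  shows "sat_M I (matching_of I f) = (\<Sum>m \<in> men I. if f m < 2 then 0 else rank_of I m (f m - 2))"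
proof -
  have "sat_M I (matching_of I f) = (\<Sum>(m, w) \<in> matching_of I f. rank_of I m w)"
    unfolding sat_M_def using stable_matching_of[OF f]
    by (intro sum.cong) (auto simp: stable_matching_def rank_the)
  then show ?thesis using sum_matching_men[OF f, of "rank_of I"] by simp
qed

lemma sat_W_eq:
  assumes f: "valid I (agents I) E f"
  shows "sat_W I (matching_of I f) = (\<Sum>w \<in> women I. if f w < 2 then 0 else rank_of I w (f w - 2))"
proof -
  have "sat_W I (matching_of I f) = (\<Sum>(m, w) \<in> matching_of I f. rank_of I w m)"
    unfolding sat_W_def using stable_matching_of[OF f]
    by (intro sum.cong) (auto simp: stable_matching_def rank_the)
  then show ?thesis using sum_matching_women[OF f, of "rank_of I"] by simp
qed

lemma card_eq:
  assumes f: "valid I (agents I) E f"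
  shows "card (matching_of I f) = (\<Sum>m \<in> men I. if f m < 2 then 0 else 1)"
  unfolding sum_matching_men[OF f, of "\<lambda>_ _. 1", symmetric] by (simp add: split_def)

end

section \<open>Separation in tree decompositions\<close>

abbreviation td_names :: "rooted_td \<Rightarrow> nat set" where
  "td_names r \<equiv> fst ` set (td_nodes r)"

definition td_verts :: "rooted_td \<Rightarrow> nat set" where
  "td_verts r = (\<Union>(x, b) \<in> set (td_nodes r). set b)"

definition td_pairs :: "rooted_td \<Rightarrow> (nat \<times> nat) set" where
  "td_pairs r = (\<Union>(x, b) \<in> set (td_nodes r). set b \<times> set b)"

lemma td_verts_Node: "td_verts (Node x b ts) = set b \<union> (\<Union>c \<in> set ts. td_verts c)"
  by (auto simp: td_verts_def)

lemma td_pairs_Node: "td_pairs (Node x b ts) = set b \<times> set b \<union> (\<Union>c \<in> set ts. td_pairs c)"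
  by (auto simp: td_pairs_def)

text \<open>These conditions supply the overlap hypotheses of \<open>solves_join\<close>: what the
  tables to be joined share is visible in the current bag, and what the current bag shares with a
  child's table is visible in the child's bag.\<close>

primrec separated :: "rooted_td \<Rightarrow> bool" where
  "separated (Node x b ts) \<longleftrightarrow> (\<forall>s \<in> set (map separated ts). s) \<and>
     (\<forall>c \<in> set ts. td_verts c \<inter> set b \<subseteq> set (td_bag c)) \<and>
     sorted_wrt (\<lambda>c c'. td_verts c \<inter> td_verts c' \<subseteq> set b) ts"

definition nodes_with :: "rooted_td \<Rightarrow> nat \<Rightarrow> nat set" where
  "nodes_with r v = {x. \<exists>b. (x, b) \<in> set (td_nodes r) \<and> v \<in> set b}"

abbreviation step_rel :: "nat set set \<Rightarrow> nat set \<Rightarrow> (nat \<times> nat) set" where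
  "step_rel E S \<equiv> {(x, y). x \<in> S \<and> y \<in> S \<and> {x, y} \<in> E}"

lemma td_edges_names: "e \<in> td_edges r \<Longrightarrow> e \<subseteq> td_names r"
proof (induction r)
  case (Node x b ts)
  have "td_name t \<in> td_names t" for t by (cases t) simp
  then show ?case using Node by fastforce
qed

lemma td_name_in_names: "td_name t \<in> td_names t"
  by (cases t) simp

lemma sorted_wrt_disjoint_concat:
  "distinct (concat (map g ts)) \<Longrightarrow> sorted_wrt (\<lambda>c c'. set (g c) \<inter> set (g c') = {}) ts"
  by (induction ts) auto

lemma nodes_with_root:
  assumes "distinct (map fst (td_nodes c))" "td_name c \<in> nodes_with c v"
  shows "v \<in> set (td_bag c)"
  using assms by (cases c) (force simp: nodes_with_def)

context
  fixes x :: nat and b :: "nat list" and ts :: "rooted_td list" and c :: rooted_td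
  assumes dist: "distinct (map fst (td_nodes (Node x b ts)))" and c: "c \<in> set ts"
begin

lemma root_notin_child: "x \<notin> td_names c"
  using dist c by auto

lemma distinct_child: "distinct (map fst (td_nodes c))"
  using dist c by (auto simp: map_concat comp_def distinct_concat_iff)

lemma children_disjoint: "sorted_wrt (\<lambda>c c'. td_names c \<inter> td_names c' = {}) ts"
  using dist sorted_wrt_disjoint_concat[of "\<lambda>c. map fst (td_nodes c)" ts] by (simp add: map_concat comp_def)

lemma child_unique: "c' \<in> set ts \<Longrightarrow> y \<in> td_names c \<Longrightarrow> y \<in> td_names c' \<Longrightarrow> c' = c"
  using children_disjoint c by (induction ts) auto

lemma nodes_with_child:
  assumes "y \<in> nodes_with (Node x b ts) v" "y \<in> td_names c"
  shows "y \<in> nodes_with c v"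
proof -
  from assms obtain b' where b': "(y, b') \<in> set (td_nodes (Node x b ts))" "v \<in> set b'"
    by (auto simp: nodes_with_def)
  moreover have "y \<noteq> x" using assms root_notin_child by blast
  ultimately obtain c' where "c' \<in> set ts" "(y, b') \<in> set (td_nodes c')" by auto
  moreover from this have "c' = c" using child_unique[of c' y] assms by force
  ultimately show ?thesis using b' by (auto simp: nodes_with_def)
qed

lemma nodes_with_parent: "x \<in> nodes_with (Node x b ts) v \<Longrightarrow> v \<in> set b"
  using dist by (force simp: nodes_with_def)

lemma edge_child:
  assumes e: "{y, z} \<in> td_edges (Node x b ts)" and y: "y \<in> td_names c"
  shows "{y, z} \<in> td_edges c \<and> z \<in> td_names c \<or> z = x \<and> y = td_name c"
proof -
  consider t where "t \<in> set ts" "{y, z} = {x, td_name t}" | t where "t \<in> set ts" "{y, z} \<in> td_edges t"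
    using e by auto
  then show ?thesis
  proof cases
    case 1
    then have "y = td_name t" "z = x" using y root_notin_child by (auto simp: doubleton_eq_iff)
    then show ?thesis using child_unique[of t y] 1 y td_name_in_names by blast
  next
    case 2
    then have "y \<in> td_names t" "z \<in> td_names t" using td_edges_names[of "{y, z}" t] by auto
    then show ?thesis using child_unique[of t y] 2 y by blast
  qed
qed

text \<open>A walk leaves or enters the subtree of \<open>c\<close> only along the edge between
  \<open>x\<close> and the root of \<open>c\<close>, so excursions can be cut out. An end inside
  yields connectivity within the subtree, as needed for the induction; an end outside shows that
  \<open>v\<close> lies in both bags at the crossing edge.\<close>

lemma walk_from_child:
  assumes u: "u \<in> td_names c"
    and walk: "(u, y) \<in> (step_rel (td_edges (Node x b ts)) (nodes_with (Node x b ts) v))\<^sup>*"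
  shows "if y \<in> td_names c then (u, y) \<in> (step_rel (td_edges c) (nodes_with c v))\<^sup>*
    else (u, td_name c) \<in> (step_rel (td_edges c) (nodes_with c v))\<^sup>* \<and> v \<in> set b \<and> v \<in> set (td_bag c)"
  using walk
proof induction
  case base
  then show ?case using u by simp
next
  case (step y z)
  let ?R = "step_rel (td_edges c) (nodes_with c v)"
  have yz: "y \<in> nodes_with (Node x b ts) v" "z \<in> nodes_with (Node x b ts) v"
    and e: "{y, z} \<in> td_edges (Node x b ts)" using step.hyps by auto
  have e': "{z, y} \<in> td_edges (Node x b ts)" using e by (simp add: insert_commute)
  show ?case
  proof (cases "y \<in> td_names c")
    case y: True
    then have IH: "(u, y) \<in> ?R\<^sup>*" using step.IH by simp
    from edge_child[OF e y] show ?thesis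
    proof
      assume z: "{y, z} \<in> td_edges c \<and> z \<in> td_names c"
      then have "(y, z) \<in> ?R" using nodes_with_child yz y by blast
      then show ?thesis using IH z by (simp add: rtrancl.rtrancl_into_rtrancl)
    next
      assume z: "z = x \<and> y = td_name c"
      then have "v \<in> set b" using nodes_with_parent yz by blast
      moreover have "v \<in> set (td_bag c)"
        using nodes_with_root[OF distinct_child] nodes_with_child[OF yz(1) y] z by blast
      ultimately show ?thesis using IH z root_notin_child by simp
    qed
  next
    case y: False
    then have IH: "(u, td_name c) \<in> ?R\<^sup>*" "v \<in> set b" "v \<in> set (td_bag c)" using step.IH by auto
    show ?thesis
    proof (cases "z \<in> td_names c")
      case True
      then have "z = td_name c" using edge_child[OF e'] y by blast
      then show ?thesis using True IH by simp
    next
      case False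
      then show ?thesis using IH by simp
    qed
  qed
qed

end

text \<open>An agent occurring below a child and also at a node outside that subtree lies in both
  bags at the connecting edge. Applied to the root and to the nodes of another child, this gives the
  two local conditions.\<close>

lemma connected_nodes_separated:
  assumes "distinct (map fst (td_nodes r))"
    and "\<And>v. connected_in (td_edges r) (nodes_with r v)"
  shows "separated r"
  using assms
proof (induction r)
  case (Node x b ts)
  let ?r = "Node x b ts"
  note dist = Node.prems(1)
  have walk: "(y, z) \<in> (step_rel (td_edges ?r) (nodes_with ?r v))\<^sup>*"
    if "y \<in> nodes_with ?r v" "z \<in> nodes_with ?r v" for y z v
    using Node.prems(2)[of v] that by (simp add: connected_in_def del: td_edges.simps)
  have sub: "y \<in> nodes_with ?r v" if "c \<in> set ts" "y \<in> nodes_with c v" for c y v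
    using that by (auto simp: nodes_with_def)
  have names: "y \<in> td_names c" if "y \<in> nodes_with c v" for c y v
    using that by (force simp: nodes_with_def)
  have verts: "\<exists>y. y \<in> nodes_with c v" if "v \<in> td_verts c" for c v
    using that by (auto simp: td_verts_def nodes_with_def)
  have outside: "v \<in> set b \<and> v \<in> set (td_bag c)"
    if c: "c \<in> set ts" and v: "v \<in> td_verts c" and z: "z \<in> nodes_with ?r v" "z \<notin> td_names c" for c v z
  proof -
    obtain y where y: "y \<in> nodes_with c v" using verts[OF v] ..
    show ?thesis using walk_from_child[OF dist c names[OF y] walk[OF sub[OF c y] z(1)]] z(2) by simp
  qed
  have "separated c" if c: "c \<in> set ts" for c
  proof (rule Node.IH[OF c distinct_child[OF dist c]])
    fix v
    show "connected_in (td_edges c) (nodes_with c v)"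
      unfolding connected_in_def
    proof (intro ballI)
      fix y z assume y: "y \<in> nodes_with c v" and z: "z \<in> nodes_with c v"
      show "(y, z) \<in> (step_rel (td_edges c) (nodes_with c v))\<^sup>*"
        using walk_from_child[OF dist c names[OF y] walk[OF sub[OF c y] sub[OF c z]]] names[OF z] by simp
    qed
  qed
  moreover have "td_verts c \<inter> set b \<subseteq> set (td_bag c)" if c: "c \<in> set ts" for c
  proof
    fix v assume v: "v \<in> td_verts c \<inter> set b"
    then have "x \<in> nodes_with ?r v" by (auto simp: nodes_with_def)
    then show "v \<in> set (td_bag c)" using outside[OF c] v root_notin_child[OF dist c] by blast
  qed
  moreover have "sorted_wrt (\<lambda>c c'. td_verts c \<inter> td_verts c' \<subseteq> set b) ts"
  proof (rule sorted_wrt_mono_rel[rotated])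
    show "sorted_wrt (\<lambda>c c'. td_names c \<inter> td_names c' = {}) ts"
      using dist sorted_wrt_disjoint_concat[of "\<lambda>c. map fst (td_nodes c)" ts] by (simp add: map_concat comp_def)
    fix c c' assume c: "c \<in> set ts" "c' \<in> set ts" and disj: "td_names c \<inter> td_names c' = {}"
    show "td_verts c \<inter> td_verts c' \<subseteq> set b"
    proof
      fix v assume v: "v \<in> td_verts c \<inter> td_verts c'"
      then obtain z where z: "z \<in> nodes_with c' v" using verts[of v c'] by blast
      then show "v \<in> set b" using outside[OF c(1) _ sub[OF c(2) z]] v names[OF z] disj by blast
    qed
  qed
  ultimately show ?case by simp
qed

section \<open>Dynamic programming\<close>

type_synonym assignment = "(nat \<times> nat) list"

definition lookup :: "assignment \<Rightarrow> nat \<Rightarrow> nat" where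
  "lookup a v = (case map_of a v of None \<Rightarrow> 0 | Some c \<Rightarrow> c)"

definition agrees :: "assignment \<Rightarrow> assignment \<Rightarrow> bool" where
  "agrees a a' \<longleftrightarrow> (\<forall>v \<in> fst ` set a. lookup a v = 0 \<or> lookup a' v = 0 \<or> lookup a v = lookup a' v)"

definition check_bag :: "sm_inst \<Rightarrow> nat list \<Rightarrow> assignment \<Rightarrow> bool" where
  "check_bag I b a \<longleftrightarrow> (\<forall>u \<in> set b. \<forall>v \<in> set b. compatible I u (lookup a u) v (lookup a v))"

lemma lookup_Nil [simp]: "lookup [] v = 0"
  by (simp add: lookup_def)

lemma lookup_Cons: "lookup ((u, c) # a) v = (if u = v then c else lookup a v)"
  by (simp add: lookup_def)

text \<open>An entry of \<open>a\<close> with value 0 would hide an entry of \<open>a'\<close> for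
  the same agent, hence the premise.\<close>

lemma lookup_append: "0 \<notin> snd ` set a \<Longrightarrow> lookup (a @ a') v = (if lookup a v \<noteq> 0 then lookup a v else lookup a' v)"
  by (induction a) (auto simp: lookup_Cons)

lemma lookup_in: "lookup a v \<noteq> 0 \<Longrightarrow> (v, lookup a v) \<in> set a"
  by (auto simp: lookup_def split: option.splits dest: map_of_SomeD)

text \<open>Agents that are not listed in \<open>a\<close> look up to 0, so the finite test that a
  program can perform is already the full condition.\<close>

lemma agrees_iff:
  "agrees a a' \<longleftrightarrow> (\<forall>v. lookup a v = 0 \<or> lookup a' v = 0 \<or> lookup a v = lookup a' v)"
proof -
  have "v \<in> fst ` set a" if "lookup a v \<noteq> 0" for v using lookup_in[OF that] by force
  then have "lookup a v = 0 \<or> v \<in> fst ` set a" for v by blast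
  then show ?thesis unfolding agrees_def by (metis (no_types, lifting))
qed

definition codes :: "sm_inst \<Rightarrow> nat set" where
  "codes I = insert 1 ((\<lambda>p. p + 2) ` agents I)"

text \<open>It excludes the value 0, as concatenation requires, and gives a range of values common
  to all agents for counting keys.\<close>

definition coded :: "sm_inst \<Rightarrow> assignment \<Rightarrow> bool" where
  "coded I a \<longleftrightarrow> snd ` set a \<subseteq> codes I"

lemma coded_append: "coded I (a @ a') \<longleftrightarrow> coded I a \<and> coded I a'"
  by (auto simp: coded_def)

lemma coded_pos: "coded I a \<Longrightarrow> 0 \<notin> snd ` set a"
  by (auto simp: coded_def codes_def)

lemma coded_lookup: "coded I a \<Longrightarrow> lookup a v \<in> insert 0 (codes I)"
  using lookup_in[of a v] by (force simp: coded_def)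

definition restrict_to :: "(nat \<Rightarrow> nat) \<Rightarrow> nat set \<Rightarrow> nat \<Rightarrow> nat" where
  "restrict_to f X v = (if v \<in> X then f v else 0)"

lemma valid_restrict: "valid I Z E f \<Longrightarrow> X \<subseteq> Z \<Longrightarrow> E' \<subseteq> E \<Longrightarrow> valid I X E' (restrict_to f X)"
proof -
  assume f: "valid I Z E f" and X: "X \<subseteq> Z" and E: "E' \<subseteq> E"
  have "compatible I u (restrict_to f X u) v (restrict_to f X v)" if "(u, v) \<in> E'" for u v
  proof (cases "u \<in> X \<and> v \<in> X")
    case True
    then show ?thesis using f E that by (auto simp: valid_def restrict_to_def)
  next
    case False
    then show ?thesis by (auto simp: compatible_def restrict_to_def)
  qed
  moreover have "\<forall>v \<in> X. restrict_to f X v \<in> choices I v" "\<forall>v. v \<notin> X \<longrightarrow> restrict_to f X v = 0"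
    using f X by (auto simp: valid_def restrict_to_def)
  ultimately show ?thesis unfolding valid_def by blast
qed

locale weighted =
  fixes I :: sm_inst and wt :: "nat \<Rightarrow> nat \<Rightarrow> nat"
  assumes I: "smt_instance I"
    and wt0 [simp]: "wt v 0 = 0"
begin

definition weight :: "nat set \<Rightarrow> (nat \<Rightarrow> nat) \<Rightarrow> nat" where
  "weight S f = (\<Sum>v \<in> S. wt v (f v))"

text \<open>All that can matter above the current node: among the treated agents only those of the
  bag can meet further constraints, and the objectives see only the two weights.\<close>

definition key :: "nat list \<Rightarrow> assignment \<Rightarrow> nat list \<times> nat \<times> nat" where
  "key b a = (map (lookup a) b, weight (men I) (lookup a), weight (women I) (lookup a))"

lemma key_eq_iff: "key b a = key b a' \<longleftrightarrow> (\<forall>v \<in> set b. lookup a v = lookup a' v) \<and>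
   weight (men I) (lookup a) = weight (men I) (lookup a') \<and> weight (women I) (lookup a) = weight (women I) (lookup a')"
  by (auto simp: key_def)

definition join_one :: "nat list \<Rightarrow> assignment \<Rightarrow> assignment list \<Rightarrow> assignment list \<Rightarrow> assignment list" where
  "join_one b a acc T = foldr (\<lambda>a' acc.
     if agrees a a' \<and> check_bag I b (a @ a') \<and> key b (a @ a') \<notin> key b ` set acc
     then (a @ a') # acc else acc) T acc"

definition join :: "nat list \<Rightarrow> assignment list \<Rightarrow> assignment list \<Rightarrow> assignment list" where
  "join b T1 T2 = foldr (\<lambda>a acc. join_one b a acc T2) T1 []"

lemma join_one_Nil [simp]: "join_one b a acc [] = acc"
  by (simp add: join_one_def)

lemma join_one_Cons: "join_one b a acc (a' # T) =
    (if agrees a a' \<and> check_bag I b (a @ a') \<and> key b (a @ a') \<notin> key b ` set (join_one b a acc T)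
     then (a @ a') # join_one b a acc T else join_one b a acc T)"
  by (simp add: join_one_def)

lemma join_Nil [simp]: "join b [] T2 = []"
  by (simp add: join_def)

lemma join_Cons: "join b (a # T1) T2 = join_one b a (join b T1 T2) T2"
  by (simp add: join_def)

lemma distinct_join_one: "distinct (map (key b) acc) \<Longrightarrow> distinct (map (key b) (join_one b a acc T))"
  by (induction T) (auto simp: join_one_Cons)

lemma distinct_join: "distinct (map (key b) (join b T1 T2))"
  by (induction T1) (auto simp: join_Cons distinct_join_one)

lemma join_one_subset:
  "set (join_one b a acc T) \<subseteq> set acc \<union> {a @ a' | a'. a' \<in> set T \<and> agrees a a' \<and> check_bag I b (a @ a')}"
  by (induction T) (auto simp: join_one_Cons)

lemma join_subset:
  "set (join b T1 T2) \<subseteq> {a @ a' | a a'. a \<in> set T1 \<and> a' \<in> set T2 \<and> agrees a a' \<and> check_bag I b (a @ a')}"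
proof (induction T1)
  case (Cons a T1)
  show ?case
  proof
    fix m assume "m \<in> set (join b (a # T1) T2)"
    then consider "m \<in> set (join b T1 T2)" | a' where "m = a @ a'" "a' \<in> set T2" "agrees a a'" "check_bag I b (a @ a')"
      using join_one_subset[of b a "join b T1 T2" T2] unfolding join_Cons by blast
    then show "m \<in> {a' @ a'' | a' a''. a' \<in> set (a # T1) \<and> a'' \<in> set T2 \<and> agrees a' a'' \<and> check_bag I b (a' @ a'')}"
    proof cases
      case 1
      from subsetD[OF Cons.IH 1] obtain a1 a2 where
        "m = a1 @ a2" "a1 \<in> set T1" "a2 \<in> set T2" "agrees a1 a2" "check_bag I b (a1 @ a2)" by blast
      then show ?thesis by auto
    next
      case 2
      then show ?thesis by auto
    qed
  qed
qed simp

lemma join_one_acc: "set acc \<subseteq> set (join_one b a acc T)"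
  by (induction T) (auto simp: join_one_Cons)

lemma join_one_complete:
  "a' \<in> set T \<Longrightarrow> agrees a a' \<Longrightarrow> check_bag I b (a @ a') \<Longrightarrow> key b (a @ a') \<in> key b ` set (join_one b a acc T)"
  by (induction T) (auto simp: join_one_Cons)

lemma join_complete:
  "a \<in> set T1 \<Longrightarrow> a' \<in> set T2 \<Longrightarrow> agrees a a' \<Longrightarrow> check_bag I b (a @ a') \<Longrightarrow>
    key b (a @ a') \<in> key b ` set (join b T1 T2)"
proof (induction T1)
  case (Cons a0 T1)
  then show ?case using join_one_complete[of a' T2 a b] join_one_acc[of "join b T1 T2" b a0 T2]
    by (auto simp: join_Cons)
qed simp

text \<open>Soundness of every entry, and completeness up to the values on \<open>B\<close> and the
  two weights. Off \<open>B\<close> the entry representing \<open>f\<close> may differ from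
  \<open>f\<close>.\<close>

definition solves :: "assignment list \<Rightarrow> nat set \<Rightarrow> (nat \<times> nat) set \<Rightarrow> nat set \<Rightarrow> bool" where
  "solves T X E B \<longleftrightarrow> E \<subseteq> X \<times> X \<and> (\<forall>a \<in> set T. coded I a \<and> valid I X E (lookup a)) \<and>
     (\<forall>f. valid I X E f \<longrightarrow> (\<exists>a \<in> set T. (\<forall>v \<in> B. lookup a v = f v) \<and>
        weight (men I) (lookup a) = weight (men I) f \<and> weight (women I) (lookup a) = weight (women I) f))"

lemma valid_zero: "valid I X E f \<Longrightarrow> f v = 0 \<longleftrightarrow> v \<notin> X"
  using choices_pos[of "f v" I v] by (auto simp: valid_def)

text \<open>Inclusion and exclusion. Adding the weight of \<open>f\<close> on
  \<open>X \<inter> Y\<close> to either side produces the sum of the weights on \<open>X\<close> and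
  on \<open>Y\<close>; since \<open>g1\<close> and \<open>g2\<close> have the values of
  \<open>f\<close> on the overlap, the added term is the same for the merged assignment and for
  \<open>f\<close>, and it cancels.\<close>

lemma weight_merge:
  assumes f: "valid I (X \<union> Y) E f"
    and g1: "\<And>v. g1 v = 0 \<longleftrightarrow> v \<notin> X" and g2: "\<And>v. g2 v = 0 \<longleftrightarrow> v \<notin> Y"
    and w1: "weight S g1 = weight S (restrict_to f X)" and w2: "weight S g2 = weight S (restrict_to f Y)"
    and i1: "\<And>v. v \<in> X \<inter> Y \<Longrightarrow> g1 v = f v" and i2: "\<And>v. v \<in> X \<inter> Y \<Longrightarrow> g2 v = f v"
  shows "weight S (\<lambda>v. if g1 v \<noteq> 0 then g1 v else g2 v) = weight S f"
proof -
  let ?g = "\<lambda>v. if g1 v \<noteq> 0 then g1 v else g2 v"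
  let ?i = "weight S (restrict_to f (X \<inter> Y))"
  have fz: "f v = 0" if "v \<notin> X" "v \<notin> Y" for v using valid_zero[OF f] that by blast
  have gp: "g1 v \<noteq> 0" if "v \<in> X" for v using g1 that by blast
  have gz: "g1 v = 0" if "v \<notin> X" for v using g1 that by blast
  have gz': "g2 v = 0" if "v \<notin> Y" for v using g2 that by blast
  have "weight S ?g + ?i = weight S g1 + weight S g2"
    unfolding weight_def sum.distrib[symmetric]
    by (rule sum.cong) (use gp gz gz' i1 i2 in \<open>auto simp: restrict_to_def\<close>)
  moreover have "weight S f + ?i = weight S (restrict_to f X) + weight S (restrict_to f Y)"
    unfolding weight_def sum.distrib[symmetric]
    by (rule sum.cong) (use fz in \<open>auto simp: restrict_to_def\<close>)
  ultimately show ?thesis using w1 w2 by simp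
qed

text \<open>For completeness, the two restrictions of \<open>f\<close> have representatives that
  equal \<open>f\<close> on \<open>X \<inter> Y\<close>, because the overlap is contained both in
  the bag and in \<open>C\<close>. Hence they agree, their concatenation passes the test on the bag,
  and \<open>weight_merge\<close> gives its weights. The join may keep another assignment instead,
  but one with the same key.\<close>

lemma solves_join:
  assumes T1: "solves T1 X E (set b)" and T2: "solves T2 Y E' C"
    and XY: "X \<inter> Y \<subseteq> set b" and bY: "set b \<inter> Y \<subseteq> C"
  shows "solves (join b T1 T2) (X \<union> Y) (E \<union> E' \<union> (set b \<inter> (X \<union> Y)) \<times> (set b \<inter> (X \<union> Y))) (set b)"
    (is "solves ?T ?Z ?E _")
  unfolding solves_def
proof (intro conjI ballI allI impI)
  show "?E \<subseteq> ?Z \<times> ?Z" using T1 T2 by (auto simp: solves_def)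
next
  fix m assume "m \<in> set ?T"
  then obtain a a' where m: "m = a @ a'" "a \<in> set T1" "a' \<in> set T2" "agrees a a'" "check_bag I b (a @ a')"
    using join_subset by blast
  have a: "coded I a" "valid I X E (lookup a)" and a': "coded I a'" "valid I Y E' (lookup a')"
    and E: "E \<subseteq> X \<times> X" "E' \<subseteq> Y \<times> Y"
    using T1 T2 m by (auto simp: solves_def)
  note z = valid_zero[OF a(2)] and z' = valid_zero[OF a'(2)]
  have lX: "lookup m v = lookup a v" if "v \<in> X" for v
    using z that unfolding m lookup_append[OF coded_pos[OF a(1)]] by auto
  \<comment> \<open>The entries of \<open>a\<close> take precedence in the concatenation; on the
    overlap \<open>agrees\<close> identifies them with those of \<open>a'\<close>.\<close>
  have lY: "lookup m v = lookup a' v" if "v \<in> Y" for v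
    using z z' that m(4) unfolding m(1) lookup_append[OF coded_pos[OF a(1)]] agrees_iff by auto
  have l0: "lookup m v = 0" if "v \<notin> X" "v \<notin> Y" for v
    using z z' that unfolding m lookup_append[OF coded_pos[OF a(1)]] by auto
  show "coded I m" using a a' m by (simp add: coded_append)
  have "compatible I u (lookup m u) v (lookup m v)" if "(u, v) \<in> ?E" for u v
    using that
  proof (elim UnE)
    assume uv: "(u, v) \<in> E"
    then have "u \<in> X" "v \<in> X" using E by auto
    then show ?thesis using a(2) uv lX by (auto simp: valid_def)
  next
    assume uv: "(u, v) \<in> E'"
    then have "u \<in> Y" "v \<in> Y" using E by auto
    then show ?thesis using a'(2) uv lY by (auto simp: valid_def)
  next
    assume uv: "(u, v) \<in> (set b \<inter> (X \<union> Y)) \<times> (set b \<inter> (X \<union> Y))"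
    then show ?thesis using m by (auto simp: check_bag_def)
  qed
  moreover have "lookup m v \<in> choices I v" if "v \<in> ?Z" for v
    using that lX[of v] lY[of v] a(2) a'(2) unfolding valid_def by auto
  ultimately show "valid I ?Z ?E (lookup m)" using l0 unfolding valid_def by blast
next
  fix f assume f: "valid I ?Z ?E f"
  have f1: "valid I X E (restrict_to f X)" and f2: "valid I Y E' (restrict_to f Y)"
    using valid_restrict[OF f] by auto
  obtain a where a: "a \<in> set T1" "\<And>v. v \<in> set b \<Longrightarrow> lookup a v = restrict_to f X v"
    "weight (men I) (lookup a) = weight (men I) (restrict_to f X)"
    "weight (women I) (lookup a) = weight (women I) (restrict_to f X)"
    using T1 f1 unfolding solves_def by meson
  obtain a' where a': "a' \<in> set T2" "\<And>v. v \<in> C \<Longrightarrow> lookup a' v = restrict_to f Y v"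
    "weight (men I) (lookup a') = weight (men I) (restrict_to f Y)"
    "weight (women I) (lookup a') = weight (women I) (restrict_to f Y)"
    using T2 f2 unfolding solves_def by meson
  have va: "coded I a" "valid I X E (lookup a)" and va': "coded I a'" "valid I Y E' (lookup a')"
    using T1 T2 a(1) a'(1) by (auto simp: solves_def)
  note z = valid_zero[OF va(2)] and z' = valid_zero[OF va'(2)]
  have l: "lookup (a @ a') = (\<lambda>v. if lookup a v \<noteq> 0 then lookup a v else lookup a' v)"
    using lookup_append[OF coded_pos[OF va(1)]] by auto
  have i1: "lookup a v = f v" and i2: "lookup a' v = f v" if "v \<in> X \<inter> Y" for v
    using a(2)[of v] a'(2)[of v] that XY bY by (auto simp: restrict_to_def)
  have ag: "agrees a a'" unfolding agrees_iff using i1 i2 z z' by force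
  have lb: "lookup (a @ a') v = f v" if v: "v \<in> set b" for v
  proof (cases "v \<in> X")
    case True
    then show ?thesis using a(2)[OF v] z by (auto simp: l restrict_to_def)
  next
    case X: False
    show ?thesis
    proof (cases "v \<in> Y")
      case True
      then have "v \<in> C" using bY v by blast
      then show ?thesis using a'(2) z X True by (auto simp: l restrict_to_def)
    next
      case False
      then show ?thesis using z z' X valid_zero[OF f, of v] by (auto simp: l)
    qed
  qed
  \<comment> \<open>\<open>check_bag\<close> tests the whole bag, also agents that have not been
    introduced yet; these have value 0 and pass.\<close>
  have "compatible I u (f u) v (f v)" if "u \<in> set b" "v \<in> set b" for u v
  proof (cases "f u = 0 \<or> f v = 0")
    case False
    then have "u \<in> ?Z" "v \<in> ?Z" using valid_zero[OF f, of u] valid_zero[OF f, of v] by auto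
    then have "(u, v) \<in> ?E" using that by blast
    then show ?thesis using f unfolding valid_def by blast
  qed (auto simp: compatible_def)
  then have "check_bag I b (a @ a')" using lb by (simp add: check_bag_def)
  from join_complete[OF a(1) a'(1) ag this] obtain m where m: "m \<in> set ?T" "key b (a @ a') = key b m"
    by auto
  have w: "weight S (lookup (a @ a')) = weight S f" if "S = men I \<or> S = women I" for S
    unfolding l by (rule weight_merge[OF f z z']) (use that a a' i1 i2 in auto)
  show "\<exists>m \<in> set ?T. (\<forall>v \<in> set b. lookup m v = f v) \<and>
        weight (men I) (lookup m) = weight (men I) f \<and> weight (women I) (lookup m) = weight (women I) f"
    using m lb w unfolding key_eq_iff by (intro bexI[OF _ m(1)]) auto
qed

definition singles :: "(nat \<times> nat) list \<Rightarrow> nat \<Rightarrow> assignment list" where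
  "singles ps v = foldr (\<lambda>(p, q) acc. [(v, p + 2)] # acc) ps [[(v, 1)]]"

lemma set_singles: "set (singles ps v) = insert [(v, 1)] ((\<lambda>p. [(v, p + 2)]) ` fst ` set ps)"
  unfolding singles_def by (induction ps) (simp_all add: split_def insert_commute)

lemma length_singles: "length (singles ps v) = length ps + 1"
  unfolding singles_def by (induction ps) (simp_all add: split_def)

lemma solves_singles:
  assumes "map_of ps = pref I v"
  shows "solves (singles ps v) {v} {} {v}"
proof -
  have dom: "fst ` set ps = dom (pref I v)" using assms dom_map_of_conv_image_fst by metis
  have ag: "p \<in> agents I" if "p \<in> dom (pref I v)" for p
    using I that by (auto simp: smt_instance_def acceptable_def agents_def)
  have "coded I a \<and> valid I {v} {} (lookup a)" if "a \<in> set (singles ps v)" for a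
    using that by (auto simp: set_singles dom coded_def codes_def valid_def lookup_Cons choices_def intro!: imageI ag)
  moreover have "\<exists>a \<in> set (singles ps v). lookup a = f" if f: "valid I {v} {} f" for f
  proof (intro bexI)
    show "lookup [(v, f v)] = f" using f by (auto simp: lookup_Cons valid_def)
    show "[(v, f v)] \<in> set (singles ps v)" using f by (auto simp: set_singles dom valid_def choices_def)
  qed
  ultimately show ?thesis unfolding solves_def by blast
qed

end

locale presented = weighted +
  fixes prefs :: "nat \<Rightarrow> (nat \<times> nat) list"
  assumes prefs: "map_of (prefs v) = pref I v"
begin

text \<open>The agents of a bag are added one at a time by the same \<open>join\<close> that merges
  children, so building initial tables needs no second algorithm or correctness argument.\<close>

definition introduce :: "nat list \<Rightarrow> nat list \<Rightarrow> assignment list" where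
  "introduce b vs = foldr (\<lambda>v acc. join b acc (singles (prefs v) v)) vs [[]]"

primrec table :: "rooted_td \<Rightarrow> assignment list" where
  "table (Node x b ts) = foldr (\<lambda>T acc. join b acc T) (map table ts) (introduce b b)"

lemma solves_introduce:
  "set vs \<subseteq> set b \<Longrightarrow> solves (introduce b vs) (set vs) (set vs \<times> set vs) (set b)"
proof (induction vs)
  case Nil
  show ?case
    by (auto simp: introduce_def solves_def coded_def valid_def weight_def)
next
  case (Cons v vs)
  have "solves (join b (introduce b vs) (singles (prefs v) v)) (set vs \<union> {v})
    (set vs \<times> set vs \<union> {} \<union> (set b \<inter> (set vs \<union> {v})) \<times> (set b \<inter> (set vs \<union> {v}))) (set b)"
    using Cons by (intro solves_join[OF _ solves_singles[OF prefs]]) auto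
  moreover have "set vs \<times> set vs \<union> {} \<union> (set b \<inter> (set vs \<union> {v})) \<times> (set b \<inter> (set vs \<union> {v}))
     = set (v # vs) \<times> set (v # vs)" using Cons.prems by auto
  ultimately show ?case by (simp add: introduce_def)
qed

lemma solves_children:
  assumes "\<And>c. c \<in> set ts \<Longrightarrow> solves (table c) (td_verts c) (td_pairs c) (set (td_bag c))"
    and "\<And>c. c \<in> set ts \<Longrightarrow> td_verts c \<inter> set b \<subseteq> set (td_bag c)"
    and "sorted_wrt (\<lambda>c c'. td_verts c \<inter> td_verts c' \<subseteq> set b) ts"
  shows "solves (foldr (\<lambda>T acc. join b acc T) (map table ts) (introduce b b))
    (set b \<union> (\<Union>c \<in> set ts. td_verts c)) (set b \<times> set b \<union> (\<Union>c \<in> set ts. td_pairs c)) (set b)"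
  using assms
proof (induction ts)
  case Nil
  then show ?case using solves_introduce[of b b] by simp
next
  case (Cons c ts)
  let ?X = "set b \<union> (\<Union>c \<in> set ts. td_verts c)" and ?E = "set b \<times> set b \<union> (\<Union>c \<in> set ts. td_pairs c)"
  let ?T = "foldr (\<lambda>T acc. join b acc T) (map table ts) (introduce b b)"
  have "solves (join b ?T (table c)) (?X \<union> td_verts c)
      (?E \<union> td_pairs c \<union> (set b \<inter> (?X \<union> td_verts c)) \<times> (set b \<inter> (?X \<union> td_verts c))) (set b)"
  proof (rule solves_join)
    show "solves ?T ?X ?E (set b)" using Cons by simp
    show "solves (table c) (td_verts c) (td_pairs c) (set (td_bag c))" using Cons.prems by simp
  qed (use Cons.prems in auto)
  moreover have "?E \<union> td_pairs c \<union> (set b \<inter> (?X \<union> td_verts c)) \<times> (set b \<inter> (?X \<union> td_verts c))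
     = set b \<times> set b \<union> (\<Union>c \<in> set (c # ts). td_pairs c)" by auto
  moreover have "?X \<union> td_verts c = set b \<union> (\<Union>c \<in> set (c # ts). td_verts c)" by auto
  ultimately show ?case by simp
qed

lemma solves_table: "separated r \<Longrightarrow> solves (table r) (td_verts r) (td_pairs r) (set (td_bag r))"
proof (induction r)
  case (Node x b ts)
  show ?case using solves_children[of ts b] Node
    by (simp add: td_verts_Node td_pairs_Node)
qed

text \<open>Since concatenation never drops repeated entries, this is the exact length of every
  assignment in the table, and so a bound for the time of a lookup.\<close>

definition td_size :: "rooted_td \<Rightarrow> nat" where
  "td_size r = (\<Sum>(x, b) \<leftarrow> td_nodes r. length b)"

lemma length_introduce: "a \<in> set (introduce b vs) \<Longrightarrow> length a = length vs"
proof (induction vs arbitrary: a)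
  case (Cons v vs)
  then have "a \<in> set (join b (introduce b vs) (singles (prefs v) v))" by (simp add: introduce_def)
  then show ?case using join_subset[of b "introduce b vs" "singles (prefs v) v"] Cons.IH
    by (auto simp: set_singles)
qed (simp add: introduce_def)

lemma length_children:
  assumes "\<And>c a. c \<in> set ts \<Longrightarrow> a \<in> set (table c) \<Longrightarrow> length a = td_size c"
    and "a \<in> set (foldr (\<lambda>T acc. join b acc T) (map table ts) (introduce b b))"
  shows "length a = length b + (\<Sum>c \<leftarrow> ts. td_size c)"
  using assms
proof (induction ts arbitrary: a)
  case Nil
  then show ?case using length_introduce by simp
next
  case (Cons c ts)
  let ?T = "foldr (\<lambda>T acc. join b acc T) (map table ts) (introduce b b)"
  have "a \<in> set (join b ?T (table c))" using Cons.prems by simp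
  then obtain a1 a2 where "a = a1 @ a2" "a1 \<in> set ?T" "a2 \<in> set (table c)" using join_subset by blast
  then show ?case using Cons by simp
qed

lemma td_size_Node: "td_size (Node x b ts) = length b + (\<Sum>c \<leftarrow> ts. td_size c)"
proof -
  have "(\<Sum>(x, b) \<leftarrow> concat (map td_nodes ts). length b) = (\<Sum>c \<leftarrow> ts. td_size c)"
    by (induction ts) (auto simp: td_size_def)
  then show ?thesis by (simp add: td_size_def)
qed

lemma length_table: "a \<in> set (table r) \<Longrightarrow> length a = td_size r"
proof (induction r arbitrary: a)
  case (Node x b ts)
  show ?case using length_children[of ts a b] Node by (simp add: td_size_Node)
qed

end

section \<open>The program\<close>

abbreviation enc_row :: "nat \<times> (nat \<times> nat) list \<Rightarrow> val" where
  "enc_row \<equiv> \<lambda>(a, ps). VPair (Num a) (enc_list (map enc_pair ps))"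

abbreviation (input) "f_append \<equiv> 1 :: nat"
abbreviation (input) "f_lookup \<equiv> 2 :: nat"
abbreviation (input) "f_agrees \<equiv> 3 :: nat"
abbreviation (input) "f_rank \<equiv> 4 :: nat"
abbreviation (input) "f_wishes \<equiv> 5 :: nat"
abbreviation (input) "f_compatible \<equiv> 6 :: nat"
abbreviation (input) "f_check_row \<equiv> 7 :: nat"
abbreviation (input) "f_check \<equiv> 8 :: nat"
abbreviation (input) "f_weight \<equiv> 9 :: nat"
abbreviation (input) "f_same_on \<equiv> 10 :: nat"
abbreviation (input) "f_same_key \<equiv> 11 :: nat"
abbreviation (input) "f_member \<equiv> 12 :: nat"
abbreviation (input) "f_join_one \<equiv> 13 :: nat"
abbreviation (input) "f_join \<equiv> 14 :: nat"
abbreviation (input) "f_singles \<equiv> 15 :: nat"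
abbreviation (input) "f_introduce \<equiv> 16 :: nat"
abbreviation (input) "f_children \<equiv> 17 :: nat"
abbreviation (input) "f_table \<equiv> 18 :: nat"
abbreviation (input) "f_pick \<equiv> 19 :: nat"
abbreviation (input) "f_read_off \<equiv> 20 :: nat"
abbreviation (input) "f_cost \<equiv> 21 :: nat"

text \<open>
  In the body of a loop, \<open>Var 0\<close> is the result for the tail of the list, \<open>Var 1\<close> is the list and
  the other arguments start at \<open>Var 2\<close>; in the base case, they start at \<open>Var 1\<close>.
  The context argument \<open>ctx\<close> consists of both sides of the market and their concatenation.
  In \<open>wexp\<close>, \<open>Var 0\<close> is the value assigned to the agent at the head of the list \<open>Var 2\<close>; in \<open>cexp\<close>,
  \<open>Var 1\<close> and \<open>Var 0\<close> are the weights of the men and of the women.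
\<close>

definition main_body :: expr where  \<comment> \<open>main(input)\<close>
  "main_body =
   LetIn (MkPair (Fst (Var 0)) (MkPair (Fst (Snd (Var 0)))
        (Call f_append [Fst (Var 0), Fst (Snd (Var 0))])))
      (Call f_read_off [Fst (Var 0),
        Fst (Call f_pick [Call f_table [Snd (Snd (Var 1)), Var 0], Var 0])])"

definition append_body :: expr where  \<comment> \<open>append(xs, ys)\<close>
  "append_body =
   Loop f_append 1 (MkPair (Fst (Var 1)) (Var 0)) (Var 1)"

definition lookup_body :: expr where  \<comment> \<open>lookup(xs, k)\<close>
  "lookup_body =
   Loop f_lookup 1 (Cond (eEq (Fst (Fst (Var 1))) (Var 2)) (Snd (Fst (Var 1))) (Var 0)) (Const 0)"

definition agrees_body :: expr where  \<comment> \<open>agrees(xs, a, a')\<close>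
  "agrees_body =
   Loop f_agrees 2
      (LetIn (Call f_lookup [Var 2, Fst (Fst (Var 1))]) (LetIn (Call f_lookup [Var 4, Fst (Fst (Var 2))])
        (eAnd (eOr (eEq (Var 1) (Const 0)) (eOr (eEq (Var 0) (Const 0)) (eEq (Var 1) (Var 0)))) (Var 2))))
      (Const 1)"

definition rank_body :: expr where  \<comment> \<open>rank(all, u, v)\<close>
  "rank_body =
   Call f_lookup [Call f_lookup [Var 0, Var 1], Var 2]"

definition wishes_body :: expr where  \<comment> \<open>wishes(all, u, c, v)\<close>
  "wishes_body =
   eOr (Less (Var 2) (Const 2))
      (Less (Call f_rank [Var 0, Var 1, Var 3]) (Call f_rank [Var 0, Var 1, Sub (Var 2) (Const 2)]))"

definition compatible_body :: expr where  \<comment> \<open>compatible(all, u, c, v, d)\<close>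
  "compatible_body =
   eOr (eEq (Var 2) (Const 0)) (eOr (eEq (Var 4) (Const 0))
      (eOr (eEq (Call f_rank [Var 0, Var 1, Var 3]) (Const 0))
        (eAnd (eOr (eNot (eEq (Var 2) (Add (Var 3) (Const 2)))) (eEq (Var 4) (Add (Var 1) (Const 2))))
          (eNot (eAnd (Call f_wishes [Var 0, Var 1, Var 2, Var 3]) (Call f_wishes [Var 0, Var 3, Var 4, Var 1]))))))"

definition check_row_body :: expr where  \<comment> \<open>check_row(vs, u, a, all)\<close>
  "check_row_body =
   Loop f_check_row 3
      (eAnd (Call f_compatible [Var 4, Var 2, Call f_lookup [Var 3, Var 2],
          Fst (Var 1), Call f_lookup [Var 3, Fst (Var 1)]]) (Var 0))
      (Const 1)"

definition check_body :: expr where  \<comment> \<open>check(us, vs, a, all)\<close>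
  "check_body =
   Loop f_check 3 (eAnd (Call f_check_row [Var 2, Fst (Var 1), Var 3, Var 4]) (Var 0)) (Const 1)"

definition weight_body :: "expr \<Rightarrow> expr" where  \<comment> \<open>weight(side, a)\<close>
  "weight_body wexp =
   Loop f_weight 1 (LetIn (Call f_lookup [Var 2, Fst (Fst (Var 1))]) (Add wexp (Var 1))) (Const 0)"

definition same_on_body :: expr where  \<comment> \<open>same_on(vs, a, a')\<close>
  "same_on_body =
   Loop f_same_on 2 (eAnd (eEq (Call f_lookup [Var 2, Fst (Var 1)]) (Call f_lookup [Var 3, Fst (Var 1)])) (Var 0))
      (Const 1)"

definition same_key_body :: expr where  \<comment> \<open>same_key(b, a, a', ctx)\<close>
  "same_key_body =
   eAnd (Call f_same_on [Var 0, Var 1, Var 2]) (eAnd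
      (eEq (Call f_weight [Fst (Var 3), Var 1]) (Call f_weight [Fst (Var 3), Var 2]))
      (eEq (Call f_weight [Fst (Snd (Var 3)), Var 1]) (Call f_weight [Fst (Snd (Var 3)), Var 2])))"

definition member_body :: expr where  \<comment> \<open>member(T, a, b, ctx)\<close>
  "member_body =
   Loop f_member 3 (eOr (Call f_same_key [Var 3, Var 2, Fst (Var 1), Var 4]) (Var 0)) (Const 0)"

definition join_one_body :: expr where  \<comment> \<open>join_one(T, a, acc, b, ctx)\<close>
  "join_one_body =
   Loop f_join_one 4
      (LetIn (Call f_append [Var 2, Fst (Var 1)])
        (Cond (eAnd (Call f_agrees [Var 3, Var 3, Fst (Var 2)])
            (eAnd (Call f_check [Var 5, Var 5, Var 0, Snd (Snd (Var 6))])
              (eNot (Call f_member [Var 1, Var 0, Var 5, Var 6]))))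
          (MkPair (Var 0) (Var 1)) (Var 1)))
      (Var 2)"

definition join_body :: expr where  \<comment> \<open>join(T1, T2, b, ctx)\<close>
  "join_body =
   Loop f_join 3 (Call f_join_one [Var 2, Fst (Var 1), Var 0, Var 3, Var 4]) (Const 0)"

definition singles_body :: expr where  \<comment> \<open>singles(ps, v)\<close>
  "singles_body =
   Loop f_singles 1
      (MkPair (MkPair (MkPair (Var 2) (Add (Fst (Fst (Var 1))) (Const 2))) (Const 0)) (Var 0))
      (MkPair (MkPair (MkPair (Var 1) (Const 1)) (Const 0)) (Const 0))"

definition introduce_body :: expr where  \<comment> \<open>introduce(vs, b, ctx)\<close>
  "introduce_body =
   Loop f_introduce 2
      (Call f_join [Var 0, Call f_singles [Call f_lookup [Snd (Snd (Var 3)), Fst (Var 1)], Fst (Var 1)],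
        Var 2, Var 3])
      (MkPair (Const 0) (Const 0))"

definition children_body :: expr where  \<comment> \<open>children(ts, b, T, ctx)\<close>
  "children_body =
   Loop f_children 3 (Call f_join [Var 0, Call f_table [Fst (Var 1), Var 4], Var 2, Var 4]) (Var 2)"

definition table_body :: expr where  \<comment> \<open>table(td, ctx)\<close>
  "table_body =
   Call f_children [Snd (Snd (Var 0)), Fst (Snd (Var 0)),
      Call f_introduce [Fst (Snd (Var 0)), Fst (Snd (Var 0)), Var 1], Var 1]"

definition pick_body :: expr where  \<comment> \<open>pick(T, ctx)\<close>
  "pick_body =
   Loop f_pick 1
      (Cond (IsPair (Var 0))
        (Cond (Less (Call f_cost [Fst (Var 1), Var 2]) (Call f_cost [Fst (Var 0), Var 2]))
          (MkPair (Fst (Var 1)) (Const 0)) (Var 0))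
        (MkPair (Fst (Var 1)) (Const 0)))
      (Const 0)"

definition read_off_body :: expr where  \<comment> \<open>read_off(side, a)\<close>
  "read_off_body =
   Loop f_read_off 1
      (LetIn (Call f_lookup [Var 2, Fst (Fst (Var 1))])
        (Cond (Less (Var 0) (Const 2)) (Var 1)
          (MkPair (MkPair (Fst (Fst (Var 2))) (Sub (Var 0) (Const 2))) (Var 1))))
      (Const 0)"

definition cost_body :: "expr \<Rightarrow> expr" where  \<comment> \<open>cost(a, ctx)\<close>
  "cost_body cexp =
   LetIn (Call f_weight [Fst (Var 1), Var 0]) (LetIn (Call f_weight [Fst (Snd (Var 2)), Var 1]) cexp)"

definition prog :: "expr \<Rightarrow> expr \<Rightarrow> prog" where
  "prog wexp cexp =
   [main_body,
    append_body,
    lookup_body,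
    agrees_body,
    rank_body,
    wishes_body,
    compatible_body,
    check_row_body,
    check_body,
    weight_body wexp,
    same_on_body,
    same_key_body,
    member_body,
    join_one_body,
    join_body,
    singles_body,
    introduce_body,
    children_body,
    table_body,
    pick_body,
    read_off_body,
    cost_body cexp]"

lemma prog_nth:
  "prog wexp cexp ! 0 = main_body"
  "prog wexp cexp ! 1 = append_body"
  "prog wexp cexp ! 2 = lookup_body"
  "prog wexp cexp ! 3 = agrees_body"
  "prog wexp cexp ! 4 = rank_body"
  "prog wexp cexp ! 5 = wishes_body"
  "prog wexp cexp ! 6 = compatible_body"
  "prog wexp cexp ! 7 = check_row_body"
  "prog wexp cexp ! 8 = check_body"
  "prog wexp cexp ! 9 = weight_body wexp"
  "prog wexp cexp ! 10 = same_on_body"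
  "prog wexp cexp ! 11 = same_key_body"
  "prog wexp cexp ! 12 = member_body"
  "prog wexp cexp ! 13 = join_one_body"
  "prog wexp cexp ! 14 = join_body"
  "prog wexp cexp ! 15 = singles_body"
  "prog wexp cexp ! 16 = introduce_body"
  "prog wexp cexp ! 17 = children_body"
  "prog wexp cexp ! 18 = table_body"
  "prog wexp cexp ! 19 = pick_body"
  "prog wexp cexp ! 20 = read_off_body"
  "prog wexp cexp ! 21 = cost_body cexp"
  by (simp_all add: prog_def)

lemmas prog_bodies = prog_nth[unfolded main_body_def append_body_def lookup_body_def agrees_body_def rank_body_def wishes_body_def compatible_body_def check_row_body_def check_body_def weight_body_def same_on_body_def same_key_body_def member_body_def join_one_body_def join_body_def singles_body_def introduce_body_def children_body_def table_body_def pick_body_def read_off_body_def cost_body_def]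

lemma prog_length: "length (prog wexp cexp) = 22"
  by (simp add: prog_def)

lemma ev_funI: "f < length P \<Longrightarrow> P ! f = e \<Longrightarrow> ev P vs e v T \<Longrightarrow> ev_fun P f vs v T"
  by (simp add: ev_fun_def)

definition loop_time :: "nat \<Rightarrow> nat \<Rightarrow> nat \<Rightarrow> nat" where
  "loop_time S k s = (S + 1) * (s + (k + 8))"

text \<open>
  The running times are all bounded in terms of one number \<open>S\<close>, which bounds the lengths of all lists,
  the tables included, and the number of nodes of the tree decomposition.
\<close>

definition "t_append S = loop_time S 1 10"
definition "t_lookup S = loop_time S 1 40"
definition "t_agrees S = loop_time S 2 (2 * t_lookup S + 60)"
definition "t_rank S = 2 * t_lookup S + 10"
definition "t_wishes S = 2 * t_rank S + 30"
definition "t_compatible S = 2 * t_rank S + 2 * t_wishes S + 100"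
definition "t_check_row S = loop_time S 3 (2 * t_lookup S + t_compatible S + 30)"
definition "t_check S = loop_time S 3 (t_check_row S + 20)"
definition "t_weight S = loop_time S 1 (2 * t_lookup S + 70)"
definition "t_same_on S = loop_time S 2 (4 * t_lookup S + 40)"
definition "t_same_key S = t_same_on S + 8 * t_weight S + 100"
definition "t_member S = loop_time S 3 (t_same_key S + 20)"
definition "t_join_one S = loop_time S 4 (t_append S + t_agrees S + t_check S + t_member S + 60)"
definition "t_join S = loop_time S 3 (t_join_one S + 20)"
definition "t_singles S = loop_time S 1 20"
definition "t_introduce S = loop_time S 2 (t_join S + t_singles S + t_lookup S + 30)"
definition "t_cost S = 2 * t_weight S + 80"
definition "t_pick S = loop_time S 1 (2 * t_cost S + 30)"
definition "t_read_off S = loop_time S 1 (t_lookup S + 30)"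
definition "t_node S = t_introduce S + t_join S + 100"
definition "t_main S = t_append S + S * t_node S + t_pick S + t_read_off S + 100"

lemmas ev_fun_Loop_time = ev_fun_Loop_uniform[folded loop_time_def]

lemma pair_elem: "xs = zs @ x # ys \<Longrightarrow> x \<in> set xs" by simp

lemma f_lt: "f < 22 \<Longrightarrow> f < length (prog wexp cexp)" by (simp add: prog_length)

lemma ev_append:
  assumes "length xs \<le> S"
  shows "ev_fun (prog wexp cexp) f_append [enc_list (map d xs), enc_list (map d ys)] (enc_list (map d (xs @ ys))) (t_append S)"
proof -
  have "ev_fun (prog wexp cexp) f_append (enc_list (map d xs) # [enc_list (map d ys)]) (enc_list (map d (foldr (#) xs ys))) (t_append S)"
    unfolding t_append_def
    by (rule ev_fun_Loop_time[where e = "\<lambda>xs. enc_list (map d xs)"], rule f_lt, simp, rule prog_bodies, simp,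
       (rule ev_weaken, (rule ev_rules)+, simp, simp)+, rule assms)
  moreover have "foldr (#) xs ys = xs @ ys" by (induction xs) auto
  ultimately show ?thesis by simp
qed

text \<open>One function serves assignments, preference lists and whole sides, whose values are
  encoded lists; hence the arbitrary encoding \<open>e\<close>. The default \<open>Num 0\<close>
  then means untreated, unacceptable or the empty list, respectively.\<close>

lemma ev_lookup_gen:
  assumes "length xs \<le> S" "\<And>k v. (k, v) \<in> set xs \<Longrightarrow> d (k, v) = VPair (Num k) (e v)"
  shows "ev_fun (prog wexp cexp) f_lookup [enc_list (map d xs), Num k]
    (case map_of xs k of None \<Rightarrow> Num 0 | Some v \<Rightarrow> e v) (t_lookup S)"
proof -
  let ?F = "\<lambda>(k', v) acc. if k' = k then e v else acc"
  have "ev_fun (prog wexp cexp) f_lookup (enc_list (map d xs) # [Num k]) (id (foldr ?F xs (Num 0))) (t_lookup S)"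
    unfolding t_lookup_def
  proof (rule ev_fun_Loop_time, rule f_lt, simp, rule prog_bodies, simp)
    fix ys x zs assume "xs = zs @ x # ys"
    moreover obtain k' v where x: "x = (k', v)" by force
    ultimately have d: "d x = VPair (Num k') (e v)" using assms(2)[of k' v] by simp
    show "ev (prog wexp cexp) (id (foldr ?F ys (Num 0)) # VPair (d x) (enc_list (map d ys)) # [Num k])
      (Cond (eEq (Fst (Fst (Var 1))) (Var 2)) (Snd (Fst (Var 1))) (Var 0)) (id (?F x (foldr ?F ys (Num 0)))) 40"
      unfolding d
      by (rule ev_weaken, (rule ev_rules)+) (simp_all add: x)
  qed (simp, rule ev_weaken, (rule ev_rules)+, simp, simp, rule assms)
  moreover have "foldr ?F xs (Num 0) = (case map_of xs k of None \<Rightarrow> Num 0 | Some v \<Rightarrow> e v)"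
    by (induction xs) auto
  ultimately show ?thesis by simp
qed

lemma ev_lookup:
  assumes "length a \<le> S"
  shows "ev_fun (prog wexp cexp) f_lookup [enc_list (map enc_pair a), Num k] (Num (lookup a k)) (t_lookup S)"
  by (rule ev_fun_weaken, rule ev_lookup_gen[where e = Num, OF assms])
    (auto simp: enc_pair_def lookup_def split: option.splits)

lemma enc_pair_apply: "enc_pair (k, v) = VPair (Num k) (Num v)"
  by (simp add: enc_pair_def)

section \<open>Correctness and running time of the functions of the program\<close>

text \<open>\<open>q\<close> bounds the bags, and \<open>sized\<close> converts that bound into one
  on tables: this is where the treewidth enters. The \<open>+ 1\<close> in \<open>len_prefs\<close>
  accounts for the unmatched option in \<open>singles\<close>. The environment in
  \<open>wexp\<close> is the one inside the weight loop; its time includes one lookup, so that a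
  preference list can be searched.\<close>

locale program = presented I wt prefs for I wt prefs +
  fixes wexp cexp :: expr and cost :: "nat \<Rightarrow> nat \<Rightarrow> nat"
    and ms ws :: side_list and S q :: nat
  assumes ms: "lists_side I (men I) ms" and ws: "lists_side I (women I) ws"
    and prefs_def: "prefs v = (case map_of (ms @ ws) v of None \<Rightarrow> [] | Some ps \<Rightarrow> ps)"
    and len_sides: "length ms + length ws \<le> S"
    and len_prefs: "length (prefs v) + 1 \<le> S"
    and wexp: "(v, ps) \<in> set (ms @ ws) \<Longrightarrow>
      ev (prog wexp cexp) [Num c, acc, VPair (VPair (Num v) (enc_list (map enc_pair ps))) rest, a]
        wexp (Num (wt v c)) (t_lookup S + 50)"
    and cexp: "ev (prog wexp cexp) (Num B # Num A # \<rho>) cexp (Num (cost A B)) 50"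
    and sized: "distinct (map (key b) T) \<Longrightarrow> (\<And>a. a \<in> set T \<Longrightarrow> coded I a) \<Longrightarrow> length b \<le> q \<Longrightarrow> length T \<le> S"
    and q: "q \<le> S"
begin

abbreviation "P \<equiv> prog wexp cexp"

abbreviation (input) ctx :: val where
  "ctx \<equiv> VPair (enc_side ms) (VPair (enc_side ws) (enc_side (ms @ ws)))"

abbreviation (input) "enc_table T \<equiv> enc_list (map (\<lambda>a. enc_list (map enc_pair a)) T)"

lemma ev_lookup_side:
  "ev_fun P f_lookup [enc_side (ms @ ws), Num v] (enc_list (map enc_pair (prefs v))) (t_lookup S)"
  unfolding enc_side_def
  by (rule ev_fun_weaken, rule ev_lookup_gen[where e = "\<lambda>ps. enc_list (map enc_pair ps)"])
    (use len_sides in \<open>auto simp: prefs_def split: option.splits\<close>)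

lemma lookup_prefs: "lookup (prefs u) v = rank_of I u v"
  by (simp add: lookup_def rank_of_def prefs)

lemma ev_rank: "ev_fun P f_rank [enc_side (ms @ ws), Num u, Num v] (Num (rank_of I u v)) (t_rank S)"
  by (rule ev_funI, rule f_lt, simp, rule prog_bodies, rule ev_weaken,
      (rule ev_rules ev_lookup_side ev_lookup[where S = S] | (use len_prefs[of u] in simp; fail))+)
    (simp_all add: lookup_prefs t_rank_def)

lemma ev_wishes: "ev_fun P f_wishes [enc_side (ms @ ws), Num u, Num c, Num v] (Num (of_bool (wishes I u c v))) (t_wishes S)"
  by (rule ev_funI, rule f_lt, simp, rule prog_bodies, rule ev_weaken, (rule ev_rules ev_rank)+)
    (simp_all add: wishes_def t_wishes_def)

lemma ev_compatible: "ev_fun P f_compatible [enc_side (ms @ ws), Num u, Num c, Num v, Num d]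
   (Num (of_bool (compatible I u c v d))) (t_compatible S)"
  by (rule ev_funI, rule f_lt, simp, rule prog_bodies, rule ev_weaken, (rule ev_rules ev_rank ev_wishes)+)
    (auto simp: compatible_def t_compatible_def)

text \<open>The first assignment is passed twice because the loop consumes one copy while lookups
  need the whole list.\<close>

lemma ev_agrees:
  assumes "length a \<le> S" "length a' \<le> S"
  shows "ev_fun P f_agrees [enc_list (map enc_pair a), enc_list (map enc_pair a), enc_list (map enc_pair a')]
    (Num (of_bool (agrees a a'))) (t_agrees S)"
proof -
  let ?F = "\<lambda>(k, _ :: nat) acc. (lookup a k = 0 \<or> lookup a' k = 0 \<or> lookup a k = lookup a' k) \<and> acc"
  have "ev_fun P f_agrees (enc_list (map enc_pair a) # [enc_list (map enc_pair a), enc_list (map enc_pair a')])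
    (Num (of_bool (foldr ?F a True))) (t_agrees S)"
    unfolding t_agrees_def
  proof (rule ev_fun_Loop_time[where e = "\<lambda>p. Num (of_bool p)"], rule f_lt, simp, rule prog_bodies, simp)
    fix ys zs :: assignment and x :: "nat \<times> nat"
    obtain k v where x: "x = (k, v)" by force
    show "ev P (Num (of_bool (foldr ?F ys True)) # VPair (enc_pair x) (enc_list (map enc_pair ys)) #
        [enc_list (map enc_pair a), enc_list (map enc_pair a')])
      (LetIn (Call f_lookup [Var 2, Fst (Fst (Var 1))]) (LetIn (Call f_lookup [Var 4, Fst (Fst (Var 2))])
      (eAnd (eOr (eEq (Var 1) (Const 0)) (eOr (eEq (Var 0) (Const 0)) (eEq (Var 1) (Var 0)))) (Var 2))))
      (Num (of_bool (?F x (foldr ?F ys True)))) (2 * t_lookup S + 60)"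
      unfolding x enc_pair_apply
      by (rule ev_weaken, (rule ev_rules ev_lookup assms)+) simp_all
  qed (rule ev_weaken, (rule ev_rules)+, simp, simp, rule assms)
  moreover have "foldr ?F xs True \<longleftrightarrow> (\<forall>v \<in> fst ` set xs. lookup a v = 0 \<or> lookup a' v = 0 \<or> lookup a v = lookup a' v)" for xs
    by (induction xs) auto
  ultimately show ?thesis by (simp add: agrees_def)
qed

lemma ev_check_row:
  assumes "length a \<le> S" "length vs \<le> S"
  shows "ev_fun P f_check_row [enc_list (map Num vs), Num u, enc_list (map enc_pair a), enc_side (ms @ ws)]
    (Num (of_bool (\<forall>v \<in> set vs. compatible I u (lookup a u) v (lookup a v)))) (t_check_row S)"
proof -
  let ?F = "\<lambda>v acc. compatible I u (lookup a u) v (lookup a v) \<and> acc"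
  have "ev_fun P f_check_row (enc_list (map Num vs) # [Num u, enc_list (map enc_pair a), enc_side (ms @ ws)])
    (Num (of_bool (foldr ?F vs True))) (t_check_row S)"
    unfolding t_check_row_def
    apply (rule ev_fun_Loop_time[where e = "\<lambda>p. Num (of_bool p)"], rule f_lt, simp, rule prog_bodies, simp)
    by (rule ev_weaken, (rule ev_rules ev_lookup ev_compatible assms)+, simp, simp)+ (rule assms)
  moreover have "foldr ?F vs True \<longleftrightarrow> (\<forall>v \<in> set vs. compatible I u (lookup a u) v (lookup a v))"
    by (induction vs) auto
  ultimately show ?thesis by simp
qed

lemma ev_check:
  assumes "length a \<le> S" "length b \<le> S"
  shows "ev_fun P f_check [enc_list (map Num b), enc_list (map Num b), enc_list (map enc_pair a), enc_side (ms @ ws)]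
    (Num (of_bool (check_bag I b a))) (t_check S)"
proof -
  let ?F = "\<lambda>u acc. (\<forall>v \<in> set b. compatible I u (lookup a u) v (lookup a v)) \<and> acc"
  have "ev_fun P f_check (enc_list (map Num b) # [enc_list (map Num b), enc_list (map enc_pair a), enc_side (ms @ ws)])
    (Num (of_bool (foldr ?F b True))) (t_check S)"
    unfolding t_check_def
    apply (rule ev_fun_Loop_time[where e = "\<lambda>p. Num (of_bool p)"], rule f_lt, simp, rule prog_bodies, simp)
    by (rule ev_weaken, (rule ev_rules ev_check_row assms)+, simp, simp)+ (rule assms)
  moreover have "foldr ?F us True \<longleftrightarrow> (\<forall>u \<in> set us. \<forall>v \<in> set b. compatible I u (lookup a u) v (lookup a v))" for us
    by (induction us) auto
  ultimately show ?thesis by (simp add: check_bag_def)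
qed

lemma ev_weight:
  assumes a: "length a \<le> S" and L: "set L \<subseteq> set (ms @ ws)" "length L \<le> S" "lists_side I X L"
  shows "ev_fun P f_weight [enc_side L, enc_list (map enc_pair a)] (Num (weight X (lookup a))) (t_weight S)"
proof -
  let ?F = "\<lambda>(v, ps :: (nat \<times> nat) list) acc. wt v (lookup a v) + acc"
  have "ev_fun P f_weight (enc_list (map enc_row L) # [enc_list (map enc_pair a)]) (Num (foldr ?F L 0)) (t_weight S)"
    unfolding t_weight_def
  proof (rule ev_fun_Loop_time, rule f_lt, simp, rule prog_bodies, simp)
    fix ys x zs assume "L = zs @ x # ys"
    then have x: "x \<in> set (ms @ ws)" using L by auto
    obtain v ps where v: "x = (v, ps)" by force
    note wexp' = wexp[OF x[unfolded v]]
    show "ev P (Num (foldr ?F ys 0) # VPair (enc_row x) (enc_list (map enc_row ys)) # [enc_list (map enc_pair a)])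
      (LetIn (Call f_lookup [Var 2, Fst (Fst (Var 1))]) (Add wexp (Var 1)))
      (Num (?F x (foldr ?F ys 0))) (2 * t_lookup S + 70)"
      unfolding v prod.case
      by (rule ev_weaken, (rule wexp' ev_rules ev_lookup a)+) simp_all
  qed (rule ev_weaken, (rule ev_rules)+, simp, simp, rule L)
  moreover have "foldr ?F L 0 = (\<Sum>v \<leftarrow> map fst L. wt v (lookup a v))" for L
    by (induction L) auto
  moreover have "(\<Sum>v \<leftarrow> map fst L. wt v (lookup a v)) = weight X (lookup a)"
    using L(3) unfolding lists_side_def weight_def by (subst sum_list_distinct_conv_sum_set) auto
  ultimately show ?thesis by (simp add: enc_side_def)
qed

lemmas ev_weight_sides =
  ev_weight[OF _ _ _ ms] ev_weight[OF _ _ _ ws]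

lemma sides: "set ms \<subseteq> set (ms @ ws)" "set ws \<subseteq> set (ms @ ws)" "length ms \<le> S" "length ws \<le> S"
  using len_sides by auto

lemma ev_same_on:
  assumes "length vs \<le> S" "length a \<le> S" "length a' \<le> S"
  shows "ev_fun P f_same_on [enc_list (map Num vs), enc_list (map enc_pair a), enc_list (map enc_pair a')]
    (Num (of_bool (\<forall>v \<in> set vs. lookup a v = lookup a' v))) (t_same_on S)"
proof -
  let ?F = "\<lambda>v acc. lookup a v = lookup a' v \<and> acc"
  have "ev_fun P f_same_on (enc_list (map Num vs) # [enc_list (map enc_pair a), enc_list (map enc_pair a')])
    (Num (of_bool (foldr ?F vs True))) (t_same_on S)"
    unfolding t_same_on_def
    apply (rule ev_fun_Loop_time[where e = "\<lambda>p. Num (of_bool p)"], rule f_lt, simp, rule prog_bodies, simp)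
    by (rule ev_weaken, (rule ev_rules ev_lookup assms)+, simp, simp)+ (rule assms)
  moreover have "foldr ?F vs True \<longleftrightarrow> (\<forall>v \<in> set vs. lookup a v = lookup a' v)"
    by (induction vs) auto
  ultimately show ?thesis by simp
qed

lemma ev_same_key:
  assumes "length b \<le> S" "length a \<le> S" "length a' \<le> S"
  shows "ev_fun P f_same_key [enc_list (map Num b), enc_list (map enc_pair a), enc_list (map enc_pair a'), ctx]
    (Num (of_bool (key b a = key b a'))) (t_same_key S)"
  by (rule ev_funI, rule f_lt, simp, rule prog_bodies, rule ev_weaken,
      (rule ev_rules ev_same_on ev_weight_sides assms sides)+)
    (auto simp: key_eq_iff t_same_key_def)

lemma ev_member:
  assumes "length b \<le> S" "length a \<le> S" "length T \<le> S" "\<And>a'. a' \<in> set T \<Longrightarrow> length a' \<le> S"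
  shows "ev_fun P f_member [enc_table T, enc_list (map enc_pair a), enc_list (map Num b), ctx]
    (Num (of_bool (key b a \<in> key b ` set T))) (t_member S)"
proof -
  let ?F = "\<lambda>a' acc. key b a = key b a' \<or> acc"
  have "ev_fun P f_member (enc_table T # [enc_list (map enc_pair a), enc_list (map Num b), ctx])
    (Num (of_bool (foldr ?F T False))) (t_member S)"
    unfolding t_member_def
    apply (rule ev_fun_Loop_time[where e = "\<lambda>p. Num (of_bool p)"], rule f_lt, simp, rule prog_bodies, simp)
    by (rule ev_weaken, (rule ev_rules ev_same_key assms(1,2) assms(4)[OF pair_elem] | assumption)+, simp, simp)+ (rule assms)
  moreover have "foldr ?F T False \<longleftrightarrow> key b a \<in> key b ` set T"
    by (induction T) auto
  ultimately show ?thesis by simp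
qed

text \<open>The loop invariant for tables: the conditions on keys and values bound the number of
  entries through \<open>sized\<close>, and \<open>n\<close> bounds the lengths of the
  entries.\<close>

definition good_table :: "nat list \<Rightarrow> assignment list \<Rightarrow> nat \<Rightarrow> bool" where
  "good_table b T n \<longleftrightarrow> distinct (map (key b) T) \<and> (\<forall>a \<in> set T. coded I a \<and> length a \<le> n)"

lemma good_table_length: "good_table b T n \<Longrightarrow> length b \<le> q \<Longrightarrow> length T \<le> S"
  unfolding good_table_def by (rule sized) auto

lemma good_table_join_one:
  assumes "good_table b acc n" "coded I a" "\<And>a'. a' \<in> set T \<Longrightarrow> coded I a' \<and> length (a @ a') \<le> n"
  shows "good_table b (join_one b a acc T) n"
  using assms join_one_subset[of b a acc T] distinct_join_one[of b acc a T]
  unfolding good_table_def by (auto simp: coded_append dest!: subsetD)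

lemma good_table_join:
  assumes "\<And>a a'. a \<in> set T1 \<Longrightarrow> a' \<in> set T2 \<Longrightarrow> coded I a \<and> coded I a' \<and> length (a @ a') \<le> n"
  shows "good_table b (join b T1 T2) n"
  unfolding good_table_def
proof (intro conjI distinct_join ballI)
  fix m assume "m \<in> set (join b T1 T2)"
  then obtain a a' where "m = a @ a'" "a \<in> set T1" "a' \<in> set T2" using join_subset by blast
  then show "coded I m" "length m \<le> n" using assms by (auto simp: coded_append)
qed

lemma ev_join_one:
  assumes b: "length b \<le> q" and T: "length T \<le> S" "\<And>a'. a' \<in> set T \<Longrightarrow> coded I a' \<and> length (a @ a') \<le> S"
    and a: "coded I a" "length a \<le> S" and acc: "good_table b acc S"
  shows "ev_fun P f_join_one [enc_table T, enc_list (map enc_pair a), enc_table acc, enc_list (map Num b), ctx]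
    (enc_table (join_one b a acc T)) (t_join_one S)"
proof -
  let ?F = "\<lambda>a' acc. if agrees a a' \<and> check_bag I b (a @ a') \<and> key b (a @ a') \<notin> key b ` set acc
     then (a @ a') # acc else acc"
  have bS: "length b \<le> S" using b q by simp
  have "ev_fun P f_join_one (enc_table T # [enc_list (map enc_pair a), enc_table acc, enc_list (map Num b), ctx])
    (enc_table (foldr ?F T acc)) (t_join_one S)"
    unfolding t_join_one_def
  proof (rule ev_fun_Loop_time[where e = "\<lambda>T. enc_table T"], rule f_lt, simp, rule prog_bodies, simp)
    fix ys a' zs assume split: "T = zs @ a' # ys"
    \<comment> \<open>Intermediate accumulators need the size bound too, since each is searched for
      a repeated key; each is a \<open>join_one\<close> over a suffix.\<close>
    have "good_table b (join_one b a acc ys) S"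
      by (rule good_table_join_one[OF acc a(1)]) (use T split in auto)
    then have g: "good_table b (foldr ?F ys acc) S" by (simp add: join_one_def)
    have g': "\<And>x. x \<in> set (foldr ?F ys acc) \<Longrightarrow> length x \<le> S" using g by (auto simp: good_table_def)
    have l: "length a' \<le> S" "length (a @ a') \<le> S" using T(2)[of a'] split by auto
    show "ev P (enc_table (foldr ?F ys acc) # VPair (enc_list (map enc_pair a')) (enc_table ys) #
       [enc_list (map enc_pair a), enc_table acc, enc_list (map Num b), ctx])
     (LetIn (Call f_append [Var 2, Fst (Var 1)])
      (Cond (eAnd (Call f_agrees [Var 3, Var 3, Fst (Var 2)])
          (eAnd (Call f_check [Var 5, Var 5, Var 0, Snd (Snd (Var 6))])
            (eNot (Call f_member [Var 1, Var 0, Var 5, Var 6]))))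
        (MkPair (Var 0) (Var 1)) (Var 1)))
     (enc_table (?F a' (foldr ?F ys acc))) (t_append S + t_agrees S + t_check S + t_member S + 60)"
    proof (rule ev_weaken, rule ev_LetIn)
      show "ev P (enc_list (map enc_pair (a @ a')) # enc_table (foldr ?F ys acc) # VPair (enc_list (map enc_pair a')) (enc_table ys) #
          [enc_list (map enc_pair a), enc_table acc, enc_list (map Num b), ctx])
        (Cond (eAnd (Call f_agrees [Var 3, Var 3, Fst (Var 2)])
          (eAnd (Call f_check [Var 5, Var 5, Var 0, Snd (Snd (Var 6))])
            (eNot (Call f_member [Var 1, Var 0, Var 5, Var 6]))))
        (MkPair (Var 0) (Var 1)) (Var 1)) (enc_table (?F a' (foldr ?F ys acc)))
        (t_agrees S + t_check S + t_member S + 40)"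
        by (rule ev_weaken, (rule ev_rules ev_agrees ev_check ev_member a l bS g'
              good_table_length[OF g b] | assumption)+)
          auto
    qed ((rule ev_rules ev_append a)+, simp, simp)
  qed (rule ev_weaken, (rule ev_rules)+, simp, simp, rule T)
  then show ?thesis by (simp add: join_one_def)
qed

text \<open>Separate bounds \<open>n1\<close> and \<open>n2\<close> are kept because lengths add up
  under concatenation: doubling one common bound at each join would become exponential along the
  tree.\<close>

lemma ev_join:
  assumes b: "length b \<le> q" and T: "length T1 \<le> S" "length T2 \<le> S"
    and T1: "\<And>a. a \<in> set T1 \<Longrightarrow> coded I a \<and> length a \<le> n1"
    and T2: "\<And>a. a \<in> set T2 \<Longrightarrow> coded I a \<and> length a \<le> n2" and n: "n1 + n2 \<le> S"
  shows "ev_fun P f_join [enc_table T1, enc_table T2, enc_list (map Num b), ctx]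
    (enc_table (join b T1 T2)) (t_join S)"
proof -
  let ?F = "\<lambda>a acc. join_one b a acc T2"
  have "ev_fun P f_join (enc_table T1 # [enc_table T2, enc_list (map Num b), ctx])
    (enc_table (foldr ?F T1 [])) (t_join S)"
    unfolding t_join_def
  proof (rule ev_fun_Loop_time[where e = "\<lambda>T. enc_table T"], rule f_lt, simp, rule prog_bodies, simp)
    fix ys a zs assume split: "T1 = zs @ a # ys"
    have a: "coded I a" "length a \<le> S" using T1[of a] n split by auto
    have T2': "coded I a' \<and> length (a @ a') \<le> S" if "a' \<in> set T2" for a'
      using T1[of a] T2[OF that] n split by auto
    have "good_table b (join b ys T2) S"
    proof (rule good_table_join)
      fix x x' assume "x \<in> set ys" "x' \<in> set T2"
      then show "coded I x \<and> coded I x' \<and> length (x @ x') \<le> S"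
        using T1[of x] T2[of x'] split n by auto
    qed
    then have g: "good_table b (foldr ?F ys []) S" by (simp add: join_def)
    show "ev P (enc_table (foldr ?F ys []) # VPair (enc_list (map enc_pair a)) (enc_table ys) #
        [enc_table T2, enc_list (map Num b), ctx])
      (Call f_join_one [Var 2, Fst (Var 1), Var 0, Var 3, Var 4])
      (enc_table (?F a (foldr ?F ys []))) (t_join_one S + 20)"
      by (rule ev_weaken, (rule ev_rules ev_join_one[OF b T(2) T2' a g] | assumption)+) simp_all
  qed (rule ev_weaken, (rule ev_rules)+, simp, simp, rule T)
  then show ?thesis by (simp add: join_def)
qed

lemma ev_singles:
  assumes "length ps \<le> S"
  shows "ev_fun P f_singles [enc_list (map enc_pair ps), Num v] (enc_table (singles ps v)) (t_singles S)"
proof -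
  let ?F = "\<lambda>(p, q :: nat) acc. [(v, p + 2)] # acc"
  have "ev_fun P f_singles (enc_list (map enc_pair ps) # [Num v]) (enc_table (foldr ?F ps [[(v, 1)]])) (t_singles S)"
    unfolding t_singles_def
  proof (rule ev_fun_Loop_time[where e = "\<lambda>T. enc_table T"], rule f_lt, simp, rule prog_bodies, simp)
    fix ys zs :: "(nat \<times> nat) list" and x :: "nat \<times> nat"
    obtain p r where x: "x = (p, r)" by force
    show "ev P (enc_table (foldr ?F ys [[(v, 1)]]) # VPair (enc_pair x) (enc_list (map enc_pair ys)) # [Num v])
      (MkPair (MkPair (MkPair (Var 2) (Add (Fst (Fst (Var 1))) (Const 2))) (Const 0)) (Var 0))
      (enc_table (?F x (foldr ?F ys [[(v, 1)]]))) 20"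
      unfolding x enc_pair_apply
      by (rule ev_weaken, (rule ev_rules)+) (simp_all add: enc_pair_apply)
  qed (rule ev_weaken, (rule ev_rules)+, simp add: enc_pair_apply, simp, rule assms)
  then show ?thesis by (simp add: singles_def)
qed

lemma coded_singles: "a \<in> set (singles (prefs v) v) \<Longrightarrow> coded I a \<and> length a \<le> 1"
  using solves_singles[OF prefs[of v]] by (auto simp: solves_def set_singles)

lemma coded_join:
  assumes "a \<in> set (join b T1 T2)" "\<And>a. a \<in> set T1 \<Longrightarrow> coded I a" "\<And>a. a \<in> set T2 \<Longrightarrow> coded I a"
  shows "coded I a"
  using subsetD[OF join_subset assms(1)] assms(2,3) by (auto simp: coded_append)

lemma coded_introduce: "a \<in> set (introduce b vs) \<Longrightarrow> coded I a"
proof (induction vs arbitrary: a)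
  case (Cons v vs)
  have "a \<in> set (join b (introduce b vs) (singles (prefs v) v))" using Cons.prems by (simp add: introduce_def)
  then show ?case by (rule coded_join) (use Cons.IH coded_singles in auto)
qed (simp add: introduce_def coded_def)

lemma good_table_introduce: "good_table b (introduce b vs) (length vs)"
  unfolding good_table_def
  using coded_introduce[of _ b vs] length_introduce[of _ b vs]
  by (cases vs) (auto simp: introduce_def distinct_join)

lemma ev_introduce:
  assumes b: "length b \<le> q" and vs: "length vs \<le> S"
  shows "ev_fun P f_introduce [enc_list (map Num vs), enc_list (map Num b), ctx]
    (enc_table (introduce b vs)) (t_introduce S)"
proof -
  let ?F = "\<lambda>v acc. join b acc (singles (prefs v) v)"
  have "ev_fun P f_introduce (enc_list (map Num vs) # [enc_list (map Num b), ctx])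
    (enc_table (foldr ?F vs [[]])) (t_introduce S)"
    unfolding t_introduce_def
  proof (rule ev_fun_Loop_time[where e = "\<lambda>T. enc_table T"], rule f_lt, simp, rule prog_bodies, simp)
    fix ys v zs assume split: "vs = zs @ v # ys"
    have g: "good_table b (foldr ?F ys [[]]) (length ys)"
      using good_table_introduce[of b ys] by (simp add: introduce_def)
    have g': "coded I a \<and> length a \<le> length ys" if "a \<in> set (foldr ?F ys [[]])" for a
      using g that by (simp add: good_table_def)
    have n: "length ys + 1 \<le> S" using vs split by simp
    have l: "length (prefs v) \<le> S" "length (singles (prefs v) v) \<le> S" using len_prefs[of v] by (auto simp: length_singles)
    note j = ev_join[OF b good_table_length[OF g b] l(2) g' coded_singles n]
    show "ev P (enc_table (foldr ?F ys [[]]) # VPair (Num v) (enc_list (map Num ys)) #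
        [enc_list (map Num b), ctx])
      (Call f_join [Var 0, Call f_singles [Call f_lookup [Snd (Snd (Var 3)), Fst (Var 1)], Fst (Var 1)],
         Var 2, Var 3])
      (enc_table (?F v (foldr ?F ys [[]]))) (t_join S + t_singles S + t_lookup S + 30)"
      by (rule ev_weaken, (rule ev_rules j ev_singles l ev_lookup_side | assumption)+) simp_all
  qed (rule ev_weaken, (rule ev_rules)+, simp, simp, rule vs)
  then show ?thesis by (simp add: introduce_def)
qed

lemma coded_children:
  assumes "\<And>c a. c \<in> set ts \<Longrightarrow> a \<in> set (table c) \<Longrightarrow> coded I a"
  shows "a \<in> set (foldr (\<lambda>T acc. join b acc T) (map table ts) (introduce b b)) \<Longrightarrow> coded I a"
  using assms
proof (induction ts arbitrary: a)
  case (Cons c ts)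
  have "a \<in> set (join b (foldr (\<lambda>T acc. join b acc T) (map table ts) (introduce b b)) (table c))"
    using Cons.prems by simp
  then show ?case by (rule coded_join) (use Cons in auto)
qed (use coded_introduce in simp)

lemma coded_table: "a \<in> set (table r) \<Longrightarrow> coded I a"
proof (induction r arbitrary: a)
  case (Node x b ts)
  show ?case using coded_children[of ts a b] Node by simp
qed

lemma good_table_children:
  "good_table b (foldr (\<lambda>T acc. join b acc T) (map table ts) (introduce b b)) (length b + (\<Sum>c \<leftarrow> ts. td_size c))"
proof -
  let ?T = "foldr (\<lambda>T acc. join b acc T) (map table ts) (introduce b b)"
  have "distinct (map (key b) ?T)"
    using good_table_introduce[of b b] by (cases ts) (auto simp: distinct_join good_table_def)
  then show ?thesis
    using length_children[of ts _ b] length_table coded_children[of ts _ b] coded_table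
    unfolding good_table_def by auto
qed

lemma good_table_table: "good_table (td_bag r) (table r) (td_size r)"
  using good_table_children[of "td_bag r" "td_children r"] by (cases r) (simp add: td_size_Node)

text \<open>The join of a child's table into that of its parent is charged to the child. So every
  node but the root costs a full \<open>t_node S\<close>, and the root only its own
  introduction.\<close>

definition table_time :: "rooted_td \<Rightarrow> nat" where
  "table_time r = (length (td_nodes r) - 1) * t_node S + t_introduce S + 50"

lemma table_time_Node: "table_time (Node x b ts) = (\<Sum>c \<leftarrow> ts. t_join S + table_time c + 50) + t_introduce S + 50"
proof -
  have "t_join S + table_time c + 50 = length (td_nodes c) * t_node S" for c
    by (cases c) (simp add: table_time_def t_node_def)
  then show ?thesis
    by (simp add: table_time_def length_concat comp_def sum_list_mult_const)
qed

lemma ev_table: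
  assumes "\<And>x b. (x, b) \<in> set (td_nodes r) \<Longrightarrow> length b \<le> q" "td_size r \<le> S"
  shows "ev_fun P f_table [enc_td r, ctx] (enc_table (table r)) (table_time r)"
  using assms
proof (induction r)
  case (Node x b ts)
  have b: "length b \<le> q" using Node.prems(1)[of x b] by simp
  then have bS: "length b \<le> S" using q by simp
  let ?F = "(\<lambda>T acc. join b acc T) \<circ> table"
  \<comment> \<open>Here the loop rule with individual step times is essential: the times of the
    children are summed, which keeps the total linear in the number of nodes.\<close>
  have "ev_fun P f_children (enc_list (map enc_td ts) # [enc_list (map Num b), enc_table (introduce b b), ctx])
    (enc_table (foldr ?F ts (introduce b b))) (1 + (3 + 8) + (\<Sum>c \<leftarrow> ts. (t_join S + table_time c + 39) + (3 + 8)))"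
  proof (rule ev_fun_Loop[where e = "\<lambda>T. enc_table T"], rule f_lt, simp, rule prog_bodies, simp)
    show "ev P (Num 0 # [enc_list (map Num b), enc_table (introduce b b), ctx]) (Var 2) (enc_table (introduce b b)) 1"
      by (rule ev_rules)
  next
    fix ys c zs assume split: "ts = zs @ c # ys"
    have g: "good_table b (foldr ?F ys (introduce b b)) (length b + (\<Sum>c \<leftarrow> ys. td_size c))"
      using good_table_children[of b ys] by (simp add: foldr_map)
    have g': "coded I a \<and> length a \<le> length b + (\<Sum>c \<leftarrow> ys. td_size c)" if "a \<in> set (foldr ?F ys (introduce b b))" for a
      using g that by (simp add: good_table_def)
    have c: "coded I a \<and> length a \<le> td_size c" if "a \<in> set (table c)" for a
      using that coded_table length_table by simp
    have n: "length b + (\<Sum>c \<leftarrow> ys. td_size c) + td_size c \<le> S"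
      using Node.prems(2) split by (simp add: td_size_Node)
    have "(td_name c, td_bag c) \<in> set (td_nodes c)" by (cases c) simp
    then have bc: "length (td_bag c) \<le> q" using Node.prems(1)[of "td_name c" "td_bag c"] split by auto
    have IH: "ev_fun P f_table [enc_td c, ctx] (enc_table (table c)) (table_time c)"
    proof (rule Node.IH)
      show "c \<in> set ts" using split by simp
      show "td_size c \<le> S" using n by simp
      fix y b' assume "(y, b') \<in> set (td_nodes c)"
      then show "length b' \<le> q" using Node.prems(1)[of y b'] split by auto
    qed
    note j = ev_join[OF b good_table_length[OF g b] good_table_length[OF good_table_table bc] g' c n]
    show "ev P (enc_table (foldr ?F ys (introduce b b)) # VPair (enc_td c) (enc_list (map enc_td ys)) #
        [enc_list (map Num b), enc_table (introduce b b), ctx])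
      (Call f_join [Var 0, Call f_table [Fst (Var 1), Var 4], Var 2, Var 4])
      (enc_table (?F c (foldr ?F ys (introduce b b)))) (t_join S + table_time c + 39)"
      by (rule ev_weaken, (rule ev_rules j IH | assumption)+) simp_all
  qed
  then have ch: "ev_fun P f_children [enc_list (map enc_td ts), enc_list (map Num b), enc_table (introduce b b), ctx]
      (enc_table (table (Node x b ts))) (12 + (\<Sum>c \<leftarrow> ts. t_join S + table_time c + 50))"
    by (simp add: foldr_map add.assoc)
  show ?case
    unfolding enc_td.simps
    by (rule ev_funI, rule f_lt, simp, rule prog_bodies, rule ev_weaken,
       (rule ev_rules ch ev_introduce b bS)+) (simp_all add: table_time_Node)
qed

definition cost_of :: "assignment \<Rightarrow> nat" where
  "cost_of a = cost (weight (men I) (lookup a)) (weight (women I) (lookup a))"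

lemma ev_cost:
  assumes "length a \<le> S"
  shows "ev_fun P f_cost [enc_list (map enc_pair a), ctx] (Num (cost_of a)) (t_cost S)"
  by (rule ev_funI, rule f_lt, simp, rule prog_bodies, rule ev_weaken,
      (rule cexp ev_rules ev_weight_sides assms sides)+)
    (auto simp: cost_of_def t_cost_def)

text \<open>A list with at most one element serves as an optional value, so the search starts
  without a dummy assignment or an infinite cost.\<close>

definition pick :: "assignment list \<Rightarrow> assignment list" where
  "pick T = foldr (\<lambda>a acc. if acc = [] \<or> cost_of a < cost_of (hd acc) then [a] else acc) T []"

lemma pick_cases: "pick T = [] \<and> T = [] \<or> (\<exists>x \<in> set T. pick T = [x] \<and> (\<forall>a \<in> set T. cost_of x \<le> cost_of a))"
  by (induction T) (auto simp: pick_def)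

lemma ev_pick:
  assumes T: "length T \<le> S" "\<And>a. a \<in> set T \<Longrightarrow> length a \<le> S"
  shows "ev_fun P f_pick [enc_table T, ctx] (enc_table (pick T)) (t_pick S)"
proof -
  let ?F = "\<lambda>a acc. if acc = [] \<or> cost_of a < cost_of (hd acc) then [a] else acc"
  have "ev_fun P f_pick (enc_table T # [ctx]) (enc_table (foldr ?F T [])) (t_pick S)"
    unfolding t_pick_def
  proof (rule ev_fun_Loop_time[where e = "\<lambda>T. enc_table T"], rule f_lt, simp, rule prog_bodies, simp)
    fix ys a zs assume split: "T = zs @ a # ys"
    have a: "length a \<le> S" using T split by simp
    have step: "ev P (enc_table (pick ys) # VPair (enc_list (map enc_pair a)) (enc_table ys) # [ctx])
      (Cond (IsPair (Var 0))
        (Cond (Less (Call f_cost [Fst (Var 1), Var 2]) (Call f_cost [Fst (Var 0), Var 2]))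
          (MkPair (Fst (Var 1)) (Const 0)) (Var 0))
        (MkPair (Fst (Var 1)) (Const 0)))
      (enc_table (?F a (pick ys))) (2 * t_cost S + 30)"
    \<comment> \<open>For empty \<open>ys\<close> the accumulator is the number 0, on which
      \<open>Fst\<close> is stuck; otherwise it encodes a singleton and both costs can be
      computed.\<close>
    proof (cases ys)
      case Nil
      then have p: "pick ys = []" by (simp add: pick_def)
      show ?thesis unfolding p list.map enc_list.simps
        by (rule ev_weaken, rule ev_Cond[where ?t1.0 = 0], (rule ev_rules)+, simp, (rule ev_rules)+) simp_all
    next
      case Cons
      then obtain x where x: "x \<in> set ys" "pick ys = [x]" using pick_cases[of ys] by auto
      have xl: "length x \<le> S" using x T split by simp
      show ?thesis unfolding x(2) list.map enc_list.simps
        by (rule ev_weaken, (rule ev_rules ev_cost a xl)+) simp_all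
    qed
    then show "ev P (enc_table (foldr ?F ys []) # VPair (enc_list (map enc_pair a)) (enc_table ys) # [ctx])
      (Cond (IsPair (Var 0))
        (Cond (Less (Call f_cost [Fst (Var 1), Var 2]) (Call f_cost [Fst (Var 0), Var 2]))
          (MkPair (Fst (Var 1)) (Const 0)) (Var 0))
        (MkPair (Fst (Var 1)) (Const 0)))
      (enc_table (?F a (foldr ?F ys []))) (2 * t_cost S + 30)"
      unfolding pick_def .
  qed (rule ev_weaken, (rule ev_rules)+, simp, simp, rule T)
  then show ?thesis by (simp add: pick_def)
qed

definition read_off :: "side_list \<Rightarrow> assignment \<Rightarrow> (nat \<times> nat) list" where
  "read_off L a = foldr (\<lambda>(v, _) acc. if lookup a v < 2 then acc else (v, lookup a v - 2) # acc) L []"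

lemma ev_extract:
  assumes a: "length a \<le> S" and L: "length L \<le> S"
  shows "ev_fun P f_read_off [enc_side L, enc_list (map enc_pair a)] (enc_list (map enc_pair (read_off L a))) (t_read_off S)"
proof -
  let ?F = "\<lambda>(v, _ :: (nat \<times> nat) list) acc. if lookup a v < 2 then acc else (v, lookup a v - 2) # acc"
  have "ev_fun P f_read_off (enc_list (map enc_row L) # [enc_list (map enc_pair a)])
    (enc_list (map enc_pair (foldr ?F L []))) (t_read_off S)"
    unfolding t_read_off_def
  proof (rule ev_fun_Loop_time[where e = "\<lambda>xs. enc_list (map enc_pair xs)"], rule f_lt, simp, rule prog_bodies, simp)
    fix ys zs :: side_list and x :: "nat \<times> (nat \<times> nat) list"
    obtain v ps where x: "x = (v, ps)" by force
    show "ev P (enc_list (map enc_pair (foldr ?F ys [])) # VPair (enc_row x) (enc_list (map enc_row ys)) # [enc_list (map enc_pair a)])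
      (LetIn (Call f_lookup [Var 2, Fst (Fst (Var 1))])
        (Cond (Less (Var 0) (Const 2)) (Var 1)
          (MkPair (MkPair (Fst (Fst (Var 2))) (Sub (Var 0) (Const 2))) (Var 1))))
      (enc_list (map enc_pair (?F x (foldr ?F ys [])))) (t_lookup S + 30)"
      unfolding x prod.case
      by (rule ev_weaken, (rule ev_rules ev_lookup a)+) (simp_all add: enc_pair_apply)
  qed (rule ev_weaken, (rule ev_rules)+, simp, simp, rule L)
  then show ?thesis by (simp add: read_off_def enc_side_def)
qed

lemma read_off_correct:
  "distinct (map fst L) \<Longrightarrow> distinct (read_off L a) \<and>
    set (read_off L a) = {(v, p). v \<in> fst ` set L \<and> lookup a v = p + 2}"
proof (induction L)
  case Nil
  then show ?case by (simp add: read_off_def)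
next
  case (Cons x L)
  obtain v ps where x: "x = (v, ps)" by force
  have "read_off (x # L) a = (if lookup a v < 2 then read_off L a else (v, lookup a v - 2) # read_off L a)"
    by (simp add: read_off_def x)
  moreover have "v \<notin> fst ` set L" using Cons.prems x by simp
  ultimately show ?case using Cons by (auto simp: x)
qed

lemma ev_main:
  assumes r: "\<And>x b. (x, b) \<in> set (td_nodes r) \<Longrightarrow> length b \<le> q" "td_size r \<le> S"
    and n: "length (td_nodes r) \<le> S"
    and best: "pick (table r) = [a]"
  shows "ev_fun P 0 [VPair (enc_side ms) (VPair (enc_side ws) (enc_td r))]
    (enc_list (map enc_pair (read_off ms a))) (t_main S)"
proof -
  have bag: "(td_name r, td_bag r) \<in> set (td_nodes r)" by (cases r) simp
  have len: "length (table r) \<le> S" using good_table_length[OF good_table_table] r(1)[OF bag] .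
  have len': "length a \<le> S" if "a \<in> set (table r)" for a using length_table[OF that] r by simp
  have "a \<in> set (table r)" using best pick_cases[of "table r"] by auto
  then have a: "length a \<le> S" by (rule len')
  note p = ev_pick[OF len len', unfolded best list.map enc_list.simps]
  have time: "table_time r \<le> S * t_node S"
  proof -
    have "td_nodes r \<noteq> []" by (cases r) simp
    then have "table_time r \<le> (length (td_nodes r) - 1) * t_node S + 1 * t_node S"
      by (simp add: table_time_def t_node_def)
    also have "\<dots> = length (td_nodes r) * t_node S"
      using \<open>td_nodes r \<noteq> []\<close> by (subst distrib_right[symmetric]) (simp add: Suc_leI)
    also have "\<dots> \<le> S * t_node S" using n by (rule mult_right_mono) simp
    finally show ?thesis .
  qed
  have app: "ev_fun P f_append [enc_side ms, enc_side ws] (enc_side (ms @ ws)) (t_append S)"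
    using ev_append[where d = enc_row and xs = ms and ys = ws and S = S] sides by (simp add: enc_side_def)
  show ?thesis
    by (rule ev_funI, rule f_lt, simp, rule prog_bodies, rule ev_weaken,
       (rule ev_rules app ev_extract a sides p ev_table r | assumption)+)
      (use time in \<open>simp_all add: t_main_def\<close>)
qed

end

section \<open>Solvability\<close>

definition poly_bounded :: "(nat \<Rightarrow> nat) \<Rightarrow> bool" where
  "poly_bounded f \<longleftrightarrow> (\<exists>C D. \<forall>S \<ge> 1. f S \<le> C * S ^ D)"

lemma poly_bounded_const: "poly_bounded (\<lambda>S. c)"
  unfolding poly_bounded_def by (rule exI[of _ c], rule exI[of _ 0]) simp

lemma poly_bounded_id: "poly_bounded (\<lambda>S. S)"
  unfolding poly_bounded_def by (rule exI[of _ 1], rule exI[of _ 1]) simp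

lemma poly_bounded_add:
  assumes "poly_bounded f" "poly_bounded g"
  shows "poly_bounded (\<lambda>S. f S + g S)"
proof -
  obtain C D C' D' where f: "\<And>S. S \<ge> 1 \<Longrightarrow> f S \<le> C * S ^ D" and g: "\<And>S. S \<ge> 1 \<Longrightarrow> g S \<le> C' * S ^ D'"
    using assms unfolding poly_bounded_def by meson
  have "f S + g S \<le> (C + C') * S ^ (D + D')" if S: "S \<ge> 1" for S
  proof -
    have "S ^ D \<le> S ^ (D + D')" "S ^ D' \<le> S ^ (D + D')" using S by (auto intro: power_increasing)
    then have "f S \<le> C * S ^ (D + D')" "g S \<le> C' * S ^ (D + D')"
      by (auto intro: order_trans[OF f[OF S]] order_trans[OF g[OF S]])
    then show ?thesis by (simp add: distrib_right)
  qed
  then show ?thesis unfolding poly_bounded_def by blast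
qed

lemma poly_bounded_mult:
  assumes "poly_bounded f" "poly_bounded g"
  shows "poly_bounded (\<lambda>S. f S * g S)"
proof -
  obtain C D C' D' where f: "\<And>S. S \<ge> 1 \<Longrightarrow> f S \<le> C * S ^ D" and g: "\<And>S. S \<ge> 1 \<Longrightarrow> g S \<le> C' * S ^ D'"
    using assms unfolding poly_bounded_def by meson
  have "f S * g S \<le> (C * C') * S ^ (D + D')" if S: "S \<ge> 1" for S
    using mult_mono[OF f[OF S] g[OF S]] by (simp add: power_add mult_ac)
  then show ?thesis unfolding poly_bounded_def by blast
qed

lemma poly_bounded_t_main: "poly_bounded t_main"
  unfolding t_main_def t_append_def t_lookup_def t_agrees_def t_rank_def t_wishes_def t_compatible_def
    t_check_row_def t_check_def t_weight_def t_same_on_def t_same_key_def t_member_def t_join_one_def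
    t_join_def t_singles_def t_introduce_def t_cost_def t_pick_def t_read_off_def t_node_def loop_time_def
  by (intro poly_bounded_add poly_bounded_mult poly_bounded_id poly_bounded_const)

lemma linear_bigo: "(\<lambda>w. real (a + b * w)) \<in> O(\<lambda>w. real w)"
proof (rule bigoI[where c = "real (a + b)"])
  show "\<forall>\<^sub>F w in sequentially. norm (real (a + b * w)) \<le> real (a + b) * norm (real w)"
    using eventually_ge_at_top[of 1]
  proof eventually_elim
    case (elim w)
    then have "a + b * w \<le> (a + b) * w" by (simp add: distrib_right)
    then have "real (a + b * w) \<le> real ((a + b) * w)" by (simp only: of_nat_le_iff)
    then show ?case by simp
  qed
qed

lemma lists_side_length:
  assumes "lists_side I X L"
  shows "length L = card X"
proof -
  have "card (set (map fst L)) = length (map fst L)" using assms by (intro distinct_card) (simp add: lists_side_def)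
  then show ?thesis using assms by (simp add: lists_side_def)
qed

lemma lists_side_prefs: "lists_side I X L \<Longrightarrow> (v, ps) \<in> set L \<Longrightarrow> map_of ps = pref I v \<and> distinct (map fst ps)"
  by (auto simp: lists_side_def)

lemma prefs_length:
  assumes I: "smt_instance I" and ps: "map_of ps = pref I v" "distinct (map fst ps)"
  shows "length ps \<le> card (agents I)"
proof -
  have "set (map fst ps) = dom (pref I v)" using ps dom_map_of_conv_image_fst[of ps] by simp
  also have "\<dots> \<subseteq> agents I" using I by (auto simp: smt_instance_def acceptable_def agents_def)
  finally have "card (set (map fst ps)) \<le> card (agents I)"
    using I by (intro card_mono) (auto simp: smt_instance_def agents_def)
  then show ?thesis using distinct_card[OF ps(2)] by simp
qed

lemma card_agents: "smt_instance I \<Longrightarrow> card (agents I) = card (men I) + card (women I)"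
  unfolding agents_def smt_instance_def by (subst card_Un_disjoint) auto

context
  fixes I T \<beta> r
  assumes td: "tree_decomposition (primal_graph I) T \<beta>" and r: "lists_td T \<beta> r"
begin

lemma td_fst: "fst T = td_names r" and td_snd: "snd T = td_edges r"
  using r by (auto simp: lists_td_def)

lemma bag_eq: "(x, b) \<in> set (td_nodes r) \<Longrightarrow> distinct b \<and> set b = \<beta> x"
  using r by (auto simp: lists_td_def)

lemma bags_Union: "td_verts r = agents I"
proof -
  have "td_verts r = (\<Union>x \<in> fst T. \<beta> x)" unfolding td_verts_def td_fst using bag_eq by fastforce
  then show ?thesis using td by (simp add: tree_decomposition_def primal_graph_def)
qed

lemma nodes_with_eq: "nodes_with r v = {x \<in> fst T. v \<in> \<beta> x}"
  unfolding nodes_with_def td_fst using bag_eq by force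

lemma separated_td: "separated r"
proof (rule connected_nodes_separated)
  show "distinct (map fst (td_nodes r))" using r by (simp add: lists_td_def)
  fix v
  show "connected_in (td_edges r) (nodes_with r v)"
  proof (cases "v \<in> agents I")
    case True
    then show ?thesis using td unfolding nodes_with_eq td_snd[symmetric]
      by (simp add: tree_decomposition_def primal_graph_def)
  next
    case False
    then have "nodes_with r v = {}" using bags_Union by (auto simp: nodes_with_def td_verts_def)
    then show ?thesis by (simp add: connected_in_def)
  qed
qed

lemma edges_covered:
  assumes I: "smt_instance I" and a: "acceptable I u v"
  shows "(u, v) \<in> td_pairs r"
proof -
  have "{u, v} \<in> snd (primal_graph I)"
    using I a unfolding smt_instance_def primal_graph_def by (simp, metis insert_commute)
  then obtain x where "x \<in> fst T" "{u, v} \<subseteq> \<beta> x" using td by (auto simp: tree_decomposition_def)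
  then show ?thesis using bag_eq unfolding td_fst td_pairs_def by fastforce
qed

lemma length_nodes: "length (td_nodes r) = card (fst T)"
proof -
  have "card (set (map fst (td_nodes r))) = length (map fst (td_nodes r))"
    using r by (intro distinct_card) (simp add: lists_td_def)
  then show ?thesis by (simp add: td_fst)
qed

text \<open>Adding 1 undoes the subtraction in \<open>td_width\<close>, and where that is truncated,
  the bags are empty and the bound is still correct.\<close>

lemma length_bag: "(x, b) \<in> set (td_nodes r) \<Longrightarrow> length b \<le> td_width T \<beta> + 1"
proof -
  assume xb: "(x, b) \<in> set (td_nodes r)"
  then have "length b = card (\<beta> x)" using bag_eq distinct_card by metis
  also have "\<dots> \<le> Max ((\<lambda>x. card (\<beta> x)) ` fst T)"
    using xb by (intro Max_ge) (force simp: td_fst)+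
  finally show ?thesis by (simp add: td_width_def)
qed

lemma length_bag_agents: "finite (agents I) \<Longrightarrow> (x, b) \<in> set (td_nodes r) \<Longrightarrow> length b \<le> card (agents I)"
  using bags_Union bag_eq[of x b] distinct_card[of b] card_mono[of "agents I" "set b"]
  by (auto simp: td_verts_def)

end

lemma card_codes: "finite (agents I) \<Longrightarrow> card (insert 0 (codes I)) \<le> card (agents I) + 2"
proof -
  assume fin: "finite (agents I)"
  let ?A = "(\<lambda>p. p + 2) ` agents I"
  have "card (insert 0 (insert 1 ?A)) \<le> Suc (Suc (card ?A))" using fin by (simp add: card_insert_if)
  then show ?thesis using card_image_le[OF fin, of "\<lambda>p. p + 2"] by (simp add: codes_def)
qed

context weighted
begin

lemma weight_le: "(\<And>v c. wt v c \<le> M) \<Longrightarrow> weight X f \<le> card X * M"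
  unfolding weight_def using sum_bounded_above[of X "\<lambda>v. wt v (f v)" M] by simp

text \<open>Keys are counted: at most \<open>card (agents I) + 2\<close> values for each of at most
  \<open>q\<close> agents of the bag, and for each of the two weights the numbers up to
  \<open>card (agents I) * M\<close>.\<close>

lemma distinct_keys_length:
  assumes "distinct (map (key b) T)" "\<And>a. a \<in> set T \<Longrightarrow> coded I a" "length b \<le> q"
    and M: "\<And>v c. wt v c \<le> M"
  shows "length T \<le> (card (agents I) + 2) ^ q * (card (agents I) * M + 1) ^ 2"
proof -
  let ?n = "card (agents I)"
  let ?W = "?n * M"
  have fin: "finite (agents I)" using I by (auto simp: smt_instance_def agents_def)
  have finc: "finite (insert 0 (codes I))" using fin by (simp add: codes_def)
  let ?L = "{xs. set xs \<subseteq> insert 0 (codes I) \<and> length xs = length b}"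
  let ?K = "?L \<times> {..?W} \<times> {..?W}"
  have w: "weight X f \<le> ?W" if "X \<subseteq> agents I" for X f
    using weight_le[OF M, of X f] card_mono[OF fin that] by (meson le_trans mult_le_mono1)
  have "key b ` set T \<subseteq> ?K"
    using w[of "men I"] w[of "women I"] assms(2) coded_lookup by (fastforce simp: key_def agents_def)
  moreover have finL: "finite ?L" using finite_lists_length_eq[OF finc] by simp
  ultimately have "card (key b ` set T) \<le> card ?K" by (intro card_mono) auto
  also have "card ?K = card (insert 0 (codes I)) ^ length b * (?W + 1) ^ 2"
    using card_lists_length_eq[OF finc, of "length b"] by (simp add: card_cartesian_product power2_eq_square)
  also have "\<dots> \<le> (?n + 2) ^ q * (?W + 1) ^ 2"
  proof (rule mult_right_mono)
    have "card (insert 0 (codes I)) ^ length b \<le> (?n + 2) ^ length b"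
      using card_codes[OF fin] by (rule power_mono) simp
    also have "\<dots> \<le> (?n + 2) ^ q" using assms(3) by (rule power_increasing) simp
    finally show "card (insert 0 (codes I)) ^ length b \<le> (?n + 2) ^ q" .
  qed simp
  finally have "card (key b ` set T) \<le> (?n + 2) ^ q * (?W + 1) ^ 2" .
  moreover have "card (key b ` set T) = length T" using distinct_card[OF assms(1)] by simp
  ultimately show ?thesis by simp
qed

end

text \<open>The frame common to the four problems. A problem is specified by agent weights, a cost
  of the two total weights and expressions that compute them; it remains to show in
  \<open>sol\<close> that minimal cost among valid assignments means optimality.\<close>

theorem solvable_by_prog:
  fixes wt :: "sm_inst \<Rightarrow> nat \<Rightarrow> nat \<Rightarrow> nat"
  assumes inst: "\<And>k I. admissible k I \<Longrightarrow> smt_instance I"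
    and wt0: "\<And>I v. wt I v 0 = 0"
    and wt_le: "\<And>k I v c. admissible k I \<Longrightarrow> wt I v c \<le> num_agents I ^ k"
    and wexp: "\<And>I v ps S c acc rest a. map_of ps = pref I v \<Longrightarrow> length ps \<le> S \<Longrightarrow>
      ev (prog wexp cexp) [Num c, acc, VPair (VPair (Num v) (enc_list (map enc_pair ps))) rest, a]
        wexp (Num (wt I v c)) (t_lookup S + 50)"
    and cexp: "\<And>A B \<rho>. ev (prog wexp cexp) (Num B # Num A # \<rho>) cexp (Num (cost A B)) 50"
    and sol: "\<And>k I E f. admissible k I \<Longrightarrow> full_constraints I E \<Longrightarrow> E \<subseteq> agents I \<times> agents I \<Longrightarrow>
      valid I (agents I) E f \<Longrightarrow>
      (\<And>g. valid I (agents I) E g \<Longrightarrow>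
        cost (\<Sum>v \<in> men I. wt I v (f v)) (\<Sum>v \<in> women I. wt I v (f v)) \<le>
        cost (\<Sum>v \<in> men I. wt I v (g v)) (\<Sum>v \<in> women I. wt I v (g v))) \<Longrightarrow>
      solution I (matching_of I f)"
  shows "solvable_in_time_n_pow_O_tw admissible solution"
proof -
  obtain C D where CD: "\<And>S. S \<ge> 1 \<Longrightarrow> t_main S \<le> C * S ^ D"
    using poly_bounded_t_main unfolding poly_bounded_def by blast
  have "\<exists>g :: nat \<Rightarrow> nat. (\<lambda>w. real (g w)) \<in> O(\<lambda>w. real w) \<and>
        (\<forall>I T \<beta> inp.
           admissible k I \<longrightarrow>
           tree_decomposition (primal_graph I) T \<beta> \<longrightarrow>
           td_width T \<beta> = treewidth (primal_graph I) \<longrightarrow>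
           card (fst T) \<le> num_agents I ^ k \<longrightarrow>
           encodes_input inp I T \<beta> \<longrightarrow>
           (\<exists>out \<mu> t. runs_to (prog wexp cexp) inp out t \<and> encodes_matching out \<mu> \<and> solution I \<mu> \<and>
              t \<le> num_agents I ^ g (treewidth (primal_graph I))))" for k
  \<comment> \<open>The time is at most \<open>(C + 2) * S ^ D\<close>. The factor
    \<open>C + 2\<close> is absorbed by \<open>N ^ (C + 2)\<close>, as \<open>N\<close> is at least
    2, and \<open>S\<close> contributes \<open>D\<close> times its exponent
    \<open>2 * tw + 2 * k + 6\<close>.\<close>
  proof (rule exI[of _ "\<lambda>w. (C + 2 + (2 * k + 6) * D) + 2 * D * w"], intro conjI allI impI)
    let ?g = "\<lambda>w. (C + 2 + (2 * k + 6) * D) + 2 * D * w"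
    show "(\<lambda>w. real (?g w)) \<in> O(\<lambda>w. real w)" by (rule linear_bigo)
    fix I T \<beta> inp
    assume adm: "admissible k I" and td: "tree_decomposition (primal_graph I) T \<beta>"
      and width: "td_width T \<beta> = treewidth (primal_graph I)"
      and nodes: "card (fst T) \<le> num_agents I ^ k" and inp: "encodes_input inp I T \<beta>"
    note I = inst[OF adm]
    obtain ms ws r where ms: "lists_side I (men I) ms" and ws: "lists_side I (women I) ws"
      and r: "lists_td T \<beta> r" and inp_eq: "inp = VPair (enc_side ms) (VPair (enc_side ws) (enc_td r))"
      using inp by (auto simp: encodes_input_def)
    define tw where "tw = treewidth (primal_graph I)"
    define n where "n = card (agents I)"
    define N where "N = num_agents I"
    have N: "2 \<le> N" "n \<le> N" by (auto simp: N_def n_def num_agents_def)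
    have NN: "N + N \<le> N ^ 2" using mult_right_mono[OF N(1), of N] by (simp add: power2_eq_square mult_2)
    \<comment> \<open>The exponent comes from the number of keys: \<open>2 * (tw + 1)\<close> for
      the values on a bag, where \<open>n + 2\<close> is at most \<open>N ^ 2\<close>, and
      \<open>2 * (k + 2)\<close> for the pair of weights.\<close>
    define S where "S = N ^ (2 * tw + 2 * k + 6)"
    define prefs where "prefs v = (case map_of (ms @ ws) v of None \<Rightarrow> [] | Some ps \<Rightarrow> ps)" for v
    have fin: "finite (agents I)" using I by (auto simp: smt_instance_def agents_def)
    have N_le: "N ^ j \<le> S" if "j \<le> 2 * tw + 2 * k + 6" for j
      unfolding S_def using N that by (intro power_increasing) auto
    have prefs_ok: "map_of ps = pref I v \<and> distinct (map fst ps)" if "(v, ps) \<in> set (ms @ ws)" for v ps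
      using that lists_side_prefs[OF ms] lists_side_prefs[OF ws] by auto
    have prefs: "map_of (prefs v) = pref I v \<and> distinct (map fst (prefs v))" for v
    proof (cases "map_of (ms @ ws) v")
      case None
      then have "v \<notin> fst ` set (ms @ ws)" unfolding map_of_eq_None_iff .
      then have "v \<notin> agents I" using ms ws by (auto simp: lists_side_def agents_def)
      then have "pref I v = Map.empty" using I
        by (auto simp: smt_instance_def acceptable_def agents_def)
      then show ?thesis using None by (simp add: prefs_def del: map_of_append)
    next
      case (Some ps)
      then show ?thesis using prefs_ok[of v ps] map_of_SomeD[OF Some] by (simp add: prefs_def)
    qed
    have ps_len: "length ps \<le> n" if "map_of ps = pref I v" "distinct (map fst ps)" for ps v
      unfolding n_def by (rule prefs_length[OF I that])
    have nS: "n + 1 \<le> S"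
    proof -
      have "n + 1 \<le> N + N" using N by simp
      also have "\<dots> \<le> N ^ 2" by (rule NN)
      also have "\<dots> \<le> S" by (rule N_le) simp
      finally show ?thesis .
    qed
    \<comment> \<open>A bag is also a set of agents; taking the minimum gives
      \<open>q \<le> S\<close> without relating \<open>tw\<close> to \<open>n\<close>.\<close>
    define q where "q = min (tw + 1) n"
    interpret program I "wt I" prefs wexp cexp cost ms ws S q
    proof
      show "smt_instance I" by (rule I)
      show "wt I v 0 = 0" for v by (rule wt0)
      show "map_of (prefs v) = pref I v" for v using prefs by simp
      show "lists_side I (men I) ms" "lists_side I (women I) ws" by (rule ms, rule ws)
      show "prefs v = (case map_of (ms @ ws) v of None \<Rightarrow> [] | Some ps \<Rightarrow> ps)" for v by (rule prefs_def)
      show "length ms + length ws \<le> S"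
        using nS card_agents[OF I] lists_side_length[OF ms] lists_side_length[OF ws] by (simp add: n_def)
      show "length (prefs v) + 1 \<le> S" for v using ps_len[of "prefs v" v] prefs[of v] nS by simp
      show "ev (prog wexp cexp) [Num c, acc, VPair (VPair (Num v) (enc_list (map enc_pair ps))) rest, a]
        wexp (Num (wt I v c)) (t_lookup S + 50)" if "(v, ps) \<in> set (ms @ ws)" for v ps c acc rest a
        using prefs_ok[OF that] ps_len[of ps v] nS by (intro wexp) auto
      show "ev (prog wexp cexp) (Num B # Num A # \<rho>) cexp (Num (cost A B)) 50" for A B \<rho> by (rule cexp)
      show "q \<le> S" using nS by (simp add: q_def)
      interpret weighted I "wt I" by (unfold_locales) (rule I, rule wt0)
      fix U :: "assignment list" and b
      assume U: "distinct (map (key b) U)" "\<And>a. a \<in> set U \<Longrightarrow> coded I a" "length b \<le> q"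
      have "length U \<le> (n + 2) ^ q * (n * N ^ k + 1) ^ 2"
        unfolding n_def by (rule distinct_keys_length[OF U]) (use wt_le[OF adm] in \<open>simp_all add: N_def\<close>)
      also have "\<dots> \<le> (N ^ 2) ^ (tw + 1) * (N ^ (k + 2)) ^ 2"
      proof (intro mult_mono power_mono)
        have "n + 2 \<le> N + N" using N by simp
        also have "\<dots> \<le> N ^ 2" by (rule NN)
        finally have n2: "n + 2 \<le> N ^ 2" .
        have "(n + 2) ^ q \<le> (N ^ 2) ^ q" by (rule power_mono[OF n2]) simp
        also have "\<dots> \<le> (N ^ 2) ^ (tw + 1)" using N by (intro power_increasing) (auto simp: q_def)
        finally show "(n + 2) ^ q \<le> (N ^ 2) ^ (tw + 1)" .
        have "n * N ^ k + 1 \<le> N * N ^ k + N * N ^ k"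
          using N by (intro add_mono mult_right_mono) auto
        also have "\<dots> = 2 * N ^ (k + 1)" by simp
        also have "\<dots> \<le> N * N ^ (k + 1)" using N by (intro mult_right_mono) auto
        also have "\<dots> = N ^ (k + 2)" by simp
        finally show "n * N ^ k + 1 \<le> N ^ (k + 2)" .
      qed auto
      also have "\<dots> = N ^ (2 * (tw + 1) + (k + 2) * 2)" by (simp only: power_add power_mult)
      also have "\<dots> = S" unfolding S_def by (rule arg_cong[where f = "\<lambda>j. N ^ j"]) simp
      finally show "length U \<le> S" .
    qed
    have bag: "length b \<le> q" if "(x, b) \<in> set (td_nodes r)" for x b
      using length_bag[OF td r that] length_bag_agents[OF td r fin that] width by (simp add: q_def tw_def n_def)
    have nodesS: "length (td_nodes r) \<le> S"
      using length_nodes[OF td r] nodes N_le[of k] by (simp add: N_def)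
    have "td_size r \<le> length (td_nodes r) * n"
      unfolding td_size_def n_def
      using sum_list_mono[of "td_nodes r" "\<lambda>(x, b). length b" "\<lambda>_. card (agents I)"] length_bag_agents[OF td r fin]
      by (force simp: sum_list_triv)
    also have "\<dots> \<le> N ^ k * N" using length_nodes[OF td r] nodes N by (intro mult_mono) (auto simp: N_def)
    also have "\<dots> = N ^ (k + 1)" by simp
    also have "\<dots> \<le> S" by (rule N_le) simp
    finally have sizeS: "td_size r \<le> S" .
    let ?E = "td_pairs r"
    have full: "full_constraints I ?E"
      using edges_covered[OF td r I] by (unfold_locales) (rule I)
    interpret full: full_constraints I ?E by (rule full)
    have solves: "solves (table r) (agents I) ?E (set (td_bag r))"
      using solves_table[OF separated_td[OF td r]] bags_Union[OF td r] by simp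
    then have E: "?E \<subseteq> agents I \<times> agents I" by (simp add: solves_def)
    have rep: "\<exists>a \<in> set (table r). weight (men I) (lookup a) = weight (men I) g \<and>
        weight (women I) (lookup a) = weight (women I) g" if "valid I (agents I) ?E g" for g
      using solves that unfolding solves_def by blast
    obtain \<mu> where "stable_matching I \<mu>" using stable_matching_exists[OF I] ..
    then have "table r \<noteq> []" using rep[OF full.valid_assignment_of[OF _ E]] by auto
    then obtain x where x: "x \<in> set (table r)" "pick (table r) = [x]"
      and best: "\<And>a. a \<in> set (table r) \<Longrightarrow> cost_of x \<le> cost_of a"
      using pick_cases[of "table r"] by blast
    have valid: "valid I (agents I) ?E (lookup x)" using solves x by (simp add: solves_def)
    have "solution I (matching_of I (lookup x))"
    proof (rule sol[OF adm full E valid])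
      fix g assume "valid I (agents I) ?E g"
      then obtain a where "a \<in> set (table r)" "weight (men I) (lookup a) = weight (men I) g"
        "weight (women I) (lookup a) = weight (women I) g" using rep by blast
      then show "cost (\<Sum>v \<in> men I. wt I v (lookup x v)) (\<Sum>v \<in> women I. wt I v (lookup x v)) \<le>
        cost (\<Sum>v \<in> men I. wt I v (g v)) (\<Sum>v \<in> women I. wt I v (g v))"
        using best[of a] by (simp add: cost_of_def weight_def)
    qed
    moreover have "encodes_matching (enc_list (map enc_pair (read_off ms x))) (matching_of I (lookup x))"
      unfolding encodes_matching_def matching_of_def
      using read_off_correct[of ms x] ms by (intro exI[of _ "read_off ms x"]) (auto simp: lists_side_def)
    moreover have "ev (prog wexp cexp) [inp] (Call 0 [Var 0]) (enc_list (map enc_pair (read_off ms x))) (t_main S + 2)"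
      unfolding inp_eq
      by (rule ev_weaken, (rule ev_rules ev_main[OF bag sizeS nodesS x(2)] | assumption)+) simp_all
    then obtain t where "runs_to (prog wexp cexp) inp (enc_list (map enc_pair (read_off ms x))) t"
      and t: "t \<le> t_main S + 2" by (auto simp: ev_def runs_to_def)
    moreover have "t \<le> num_agents I ^ ?g (treewidth (primal_graph I))"
    proof -
      have S1: "1 \<le> S" using nS by simp
      have "t \<le> C * S ^ D + 2" using t CD[OF S1] by simp
      also have "\<dots> \<le> (C + 2) * S ^ D" using one_le_power[OF S1, of D] by (simp add: distrib_right)
      also have "\<dots> \<le> N ^ (C + 2) * S ^ D"
      proof (rule mult_right_mono)
        have "C + 2 \<le> 2 ^ (C + 2)" using less_exp[of "C + 2"] by (rule less_imp_le)
        also have "\<dots> \<le> N ^ (C + 2)" using N by (intro power_mono) auto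
        finally show "C + 2 \<le> N ^ (C + 2)" .
      qed simp
      also have "\<dots> = N ^ (C + 2 + (2 * tw + 2 * k + 6) * D)"
        unfolding S_def by (simp only: power_add power_mult)
      also have "\<dots> = N ^ ?g tw"
        by (rule arg_cong[where f = "\<lambda>j. N ^ j"]) (simp add: algebra_simps)
      finally show ?thesis by (simp only: N_def tw_def)
    qed
    ultimately show "\<exists>out \<mu> t. runs_to (prog wexp cexp) inp out t \<and> encodes_matching out \<mu> \<and> solution I \<mu> \<and>
              t \<le> num_agents I ^ ?g (treewidth (primal_graph I))" by blast
  qed
  then show ?thesis unfolding solvable_in_time_n_pow_O_tw_def by blast
qed

section \<open>The four objectives as weights and costs\<close>

definition rank_exp :: expr where
  "rank_exp = Cond (Less (Var 0) (Const 2)) (Const 0) (Call f_lookup [Snd (Fst (Var 2)), Sub (Var 0) (Const 2)])"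

definition rank_weight :: "sm_inst \<Rightarrow> nat \<Rightarrow> nat \<Rightarrow> nat" where
  "rank_weight I v c = (if c < 2 then 0 else rank_of I v (c - 2))"

lemma ev_rank_exp:
  assumes "map_of ps = pref I v" "length ps \<le> S"
  shows "ev (prog rank_exp cexp) [Num c, acc, VPair (VPair (Num v) (enc_list (map enc_pair ps))) rest, a]
    rank_exp (Num (rank_weight I v c)) (t_lookup S + 50)"
proof -
  have "lookup ps u = rank_of I v u" for u using assms by (simp add: lookup_def rank_of_def)
  then show ?thesis
    \<comment> \<open>Only the evaluated expression is unfolded; the other occurrence is the
      parameter of \<open>prog\<close>.\<close>
    by (subst (2) rank_exp_def) (rule ev_weaken, (rule ev_rules ev_lookup assms)+, simp_all add: rank_weight_def)
qed

lemma rank_weight_le: "prefs_at_most b I \<Longrightarrow> rank_weight I v c \<le> b"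
  by (auto simp: prefs_at_most_def rank_weight_def rank_of_def split: option.splits)

lemma solvable_by_satisfactions:
  assumes cexp: "\<And>A B \<rho>. ev (prog rank_exp cexp) (Num B # Num A # \<rho>) cexp (Num (cost A B)) 50"
    and sol: "\<And>I \<mu>. sm_instance I \<Longrightarrow> stable_matching I \<mu> \<Longrightarrow>
      (\<And>\<nu>. stable_matching I \<nu> \<Longrightarrow> cost (sat_M I \<mu>) (sat_W I \<mu>) \<le> cost (sat_M I \<nu>) (sat_W I \<nu>)) \<Longrightarrow> solution I \<mu>"
  shows "solvable_in_time_n_pow_O_tw poly_sm_instance solution"
proof (rule solvable_by_prog[where wt = rank_weight and wexp = rank_exp])
  show "smt_instance I" if "poly_sm_instance k I" for k I
    using that by (simp add: poly_sm_instance_def sm_instance_def)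
  show "rank_weight I v c \<le> num_agents I ^ k" if "poly_sm_instance k I" for k I v c
    using that by (intro rank_weight_le) (simp add: poly_sm_instance_def)
  fix k I E f
  assume adm: "poly_sm_instance k I" and full: "full_constraints I E" and E_agents: "E \<subseteq> agents I \<times> agents I"
    and f: "valid I (agents I) E f"
    and best: "\<And>g. valid I (agents I) E g \<Longrightarrow>
        cost (\<Sum>v \<in> men I. rank_weight I v (f v)) (\<Sum>v \<in> women I. rank_weight I v (f v)) \<le>
        cost (\<Sum>v \<in> men I. rank_weight I v (g v)) (\<Sum>v \<in> women I. rank_weight I v (g v))"
  interpret full_constraints I E by (rule full)
  have eq: "(\<Sum>v \<in> men I. rank_weight I v (g v)) = sat_M I (matching_of I g)"
    "(\<Sum>v \<in> women I. rank_weight I v (g v)) = sat_W I (matching_of I g)" if "valid I (agents I) E g" for g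
    using sat_M_eq[OF that] sat_W_eq[OF that] by (simp_all add: rank_weight_def)
  show "solution I (matching_of I f)"
  proof (rule sol)
    show "sm_instance I" using adm by (simp add: poly_sm_instance_def)
    show "stable_matching I (matching_of I f)" by (rule stable_matching_of[OF f])
    fix \<nu> assume \<nu>: "stable_matching I \<nu>"
    note g = valid_assignment_of[OF \<nu> E_agents]
    have "matching_of I (assignment_of I \<nu>) = \<nu>" using \<nu> by (intro matching_of_assignment_of) (simp add: stable_matching_def)
    then show "cost (sat_M I (matching_of I f)) (sat_W I (matching_of I f)) \<le> cost (sat_M I \<nu>) (sat_W I \<nu>)"
      using best[OF g] eq[OF f] eq[OF g] by simp
  qed
qed (simp add: rank_weight_def, rule ev_rank_exp, assumption, assumption, rule cexp)

text \<open>Only the weight of the men enters the cost. The function \<open>h\<close> expresses it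
  through the number of men and the size of the matching, so that maximisation and minimisation of
  the size are both minimisations of a cost.\<close>

lemma solvable_by_size:
  assumes wt: "wt 0 = 0" "\<And>c. wt c \<le> (1 :: nat)"
    and wexp: "\<And>c \<rho>. ev (prog wexp (Var 1)) (Num c # \<rho>) wexp (Num (wt c)) 50"
    and sum_wt: "\<And>(X :: nat set) f. finite X \<Longrightarrow> (\<And>v. v \<in> X \<Longrightarrow> f v \<noteq> 0) \<Longrightarrow>
      (\<Sum>v \<in> X. wt (f v)) = h (card X) (\<Sum>v \<in> X. if f v < 2 then 0 else 1)"
    and sol: "\<And>I \<mu>. smt_instance I \<Longrightarrow> stable_matching I \<mu> \<Longrightarrow>
      (\<And>\<nu>. stable_matching I \<nu> \<Longrightarrow> card \<nu> \<le> card (men I) \<and>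
        h (card (men I)) (card \<mu>) \<le> h (card (men I)) (card \<nu>)) \<Longrightarrow> solution I \<mu>"
  shows "solvable_in_time_n_pow_O_tw (\<lambda>k. smt_instance) solution"
proof (rule solvable_by_prog[where wt = "\<lambda>I v. wt" and cost = "\<lambda>A B. A" and cexp = "Var 1" and wexp = wexp])
  show "wt c \<le> num_agents I ^ k" for I k c
  proof -
    have "1 \<le> num_agents I ^ k" by (simp add: num_agents_def)
    with wt(2)[of c] show ?thesis by (rule order_trans)
  qed
  show "ev (prog wexp (Var 1)) [Num c, acc, VPair (VPair (Num v) (enc_list (map enc_pair ps))) rest, a]
      wexp (Num (wt c)) (t_lookup S + 50)" for c acc v ps rest a S
    by (rule ev_weaken[OF wexp]) simp_all
  show "ev (prog wexp (Var 1)) (Num B # Num A # \<rho>) (Var 1) (Num A) 50" for A B \<rho>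
    by (rule ev_weaken, rule ev_Vars) simp_all
  fix k I E f
  assume I: "smt_instance I" and full: "full_constraints I E" and E_agents: "E \<subseteq> agents I \<times> agents I"
    and f: "valid I (agents I) E f"
    and best: "\<And>g. valid I (agents I) E g \<Longrightarrow> (\<Sum>v \<in> men I. wt (f v)) \<le> (\<Sum>v \<in> men I. wt (g v))"
  interpret full_constraints I E by (rule full)
  have fin: "finite (men I)" using I by (simp add: smt_instance_def)
  have eq: "(\<Sum>v \<in> men I. wt (g v)) = h (card (men I)) (card (matching_of I g))"
    if "valid I (agents I) E g" for g
  proof -
    have "g v \<noteq> 0" if "v \<in> men I" for v
      using \<open>valid I (agents I) E g\<close> that choices_pos[of "g v" I v] by (auto simp: valid_def agents_def)
    then show ?thesis unfolding card_eq[OF that] by (rule sum_wt[OF fin])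
  qed
  show "solution I (matching_of I f)"
  proof (rule sol[OF I stable_matching_of[OF f]])
    fix \<nu> assume \<nu>: "stable_matching I \<nu>"
    note g = valid_assignment_of[OF \<nu> E_agents]
    have m: "matching_of I (assignment_of I \<nu>) = \<nu>" using \<nu> by (intro matching_of_assignment_of) (simp add: stable_matching_def)
    have "card \<nu> \<le> (\<Sum>v \<in> men I. 1)"
      unfolding card_eq[OF g, unfolded m] by (rule sum_mono) simp
    then show "card \<nu> \<le> card (men I) \<and> h (card (men I)) (card (matching_of I f)) \<le> h (card (men I)) (card \<nu>)"
      using best[OF g] eq[OF f] eq[OF g] m by simp
  qed
qed (use wt in simp_all)

theorem theorem2:
  shows "solvable_in_time_n_pow_O_tw poly_sm_instance sesm_solution
    \<and> solvable_in_time_n_pow_O_tw poly_sm_instance bsm_solution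
    \<and> solvable_in_time_n_pow_O_tw (\<lambda>k. smt_instance) max_smt_solution
    \<and> solvable_in_time_n_pow_O_tw (\<lambda>k. smt_instance) min_smt_solution"
proof (intro conjI)
  show "solvable_in_time_n_pow_O_tw poly_sm_instance sesm_solution"
  \<comment> \<open>With truncated subtraction at least one summand is 0, so the sum is the absolute
    difference.\<close>
  proof (rule solvable_by_satisfactions[where cost = "\<lambda>A B. (A - B) + (B - A)"])
    show "ev (prog rank_exp (Add (Sub (Var 1) (Var 0)) (Sub (Var 0) (Var 1)))) (Num B # Num A # \<rho>)
        (Add (Sub (Var 1) (Var 0)) (Sub (Var 0) (Var 1))) (Num ((A - B) + (B - A))) 50" for A B \<rho>
      by (rule ev_weaken, (rule ev_rules)+) simp_all
    have abs: "\<bar>int a - int b\<bar> = int ((a - b) + (b - a))" for a b by linarith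
    fix I \<mu>
    assume "stable_matching I \<mu>" and "\<And>\<nu>. stable_matching I \<nu> \<Longrightarrow>
      sat_M I \<mu> - sat_W I \<mu> + (sat_W I \<mu> - sat_M I \<mu>) \<le> sat_M I \<nu> - sat_W I \<nu> + (sat_W I \<nu> - sat_M I \<nu>)"
    then show "sesm_solution I \<mu>"
      unfolding sesm_solution_def is_arg_min_def abs by (meson not_less of_nat_less_iff)
  qed
  show "solvable_in_time_n_pow_O_tw poly_sm_instance bsm_solution"
  proof (rule solvable_by_satisfactions[where cost = "\<lambda>A B. A + (B - A)"])
    show "ev (prog rank_exp (Add (Var 1) (Sub (Var 0) (Var 1)))) (Num B # Num A # \<rho>)
        (Add (Var 1) (Sub (Var 0) (Var 1))) (Num (A + (B - A))) 50" for A B \<rho>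
      by (rule ev_weaken, (rule ev_rules)+) simp_all
    have max: "max a b = a + (b - a)" for a b :: nat by simp
    fix I \<mu>
    assume "stable_matching I \<mu>" and "\<And>\<nu>. stable_matching I \<nu> \<Longrightarrow>
      sat_M I \<mu> + (sat_W I \<mu> - sat_M I \<mu>) \<le> sat_M I \<nu> + (sat_W I \<nu> - sat_M I \<nu>)"
    then show "bsm_solution I \<mu>"
      unfolding bsm_solution_def is_arg_min_def max by (meson not_less)
  qed
  show "solvable_in_time_n_pow_O_tw (\<lambda>k. smt_instance) max_smt_solution"
  \<comment> \<open>The value 1 marks unmatched agents: maximum size is a minimum number of
    unmatched men.\<close>
  proof (rule solvable_by_size[where wt = "\<lambda>c. of_bool (c = 1)" and h = "\<lambda>m c. m - c"])
    show "ev (prog (eEq (Var 0) (Const 1)) (Var 1)) (Num c # \<rho>) (eEq (Var 0) (Const 1)) (Num (of_bool (c = 1))) 50" for c \<rho>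
      by (rule ev_weaken, (rule ev_rules)+) simp_all
    fix X :: "nat set" and f :: "nat \<Rightarrow> nat"
    assume X: "finite X" and f: "\<And>v. v \<in> X \<Longrightarrow> f v \<noteq> 0"
    have "(\<Sum>v \<in> X. of_bool (f v = 1)) + (\<Sum>v \<in> X. if f v < 2 then 0 else 1) = (\<Sum>v \<in> X. 1 :: nat)"
      unfolding sum.distrib[symmetric] by (rule sum.cong) (use f in force)+
    then show "(\<Sum>v \<in> X. of_bool (f v = 1)) = card X - (\<Sum>v \<in> X. if f v < 2 then 0 else 1)"
      by simp
  next
    fix I \<mu>
    assume \<mu>: "stable_matching I \<mu>" and best: "\<And>\<nu>. stable_matching I \<nu> \<Longrightarrow> card \<nu> \<le> card (men I) \<and>
      card (men I) - card \<mu> \<le> card (men I) - card \<nu>"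
    \<comment> \<open>Sizes do not exceed the number of men, and in that range truncated subtraction
      is strictly decreasing.\<close>
    have "card \<nu> \<le> card \<mu>" if "stable_matching I \<nu>" for \<nu> using best[OF that] best[OF \<mu>] by linarith
    then show "max_smt_solution I \<mu>"
      using \<mu> unfolding max_smt_solution_def is_arg_max_def by (meson not_less)
  qed simp_all
  show "solvable_in_time_n_pow_O_tw (\<lambda>k. smt_instance) min_smt_solution"
  proof (rule solvable_by_size[where wt = "\<lambda>c. of_bool (1 < c)" and h = "\<lambda>m c. c"])
    show "ev (prog (Less (Const 1) (Var 0)) (Var 1)) (Num c # \<rho>) (Less (Const 1) (Var 0)) (Num (of_bool (1 < c))) 50" for c \<rho>
      by (rule ev_weaken, (rule ev_rules)+) simp_all
    show "(\<Sum>v \<in> X. of_bool (1 < f v)) = (\<Sum>v \<in> X. if f v < 2 then 0 else 1 :: nat)" for X and f :: "nat \<Rightarrow> nat"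
      by (rule sum.cong) auto
  next
    fix I \<mu>
    assume "stable_matching I \<mu>" and "\<And>\<nu>. stable_matching I \<nu> \<Longrightarrow> card \<nu> \<le> card (men I) \<and> card \<mu> \<le> card \<nu>"
    then show "min_smt_solution I \<mu>"
      unfolding min_smt_solution_def is_arg_min_def by (meson not_less)
  qed simp_all
qed

end
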